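(* Let $C$ be a smooth curve, let $\mathcal M$ be a birationally very ample line bundle on $C$, let $\mathcal F$ be a globally generated line bundle on $C$ with $h^0(\mathcal F)=2$, and let $F\in|\mathcal F|$. Assume that (1) $h^1(\mathcal M^2(F))=0$; (2) $h^1(\mathcal M^2)+1\le h^1(\mathcal M^2(-F))$; (3) the multiplication map $H^0(\mathcal M)\otimes H^0(\mathcal O_C(F))\to H^0(\mathcal M(F))$ is surjective. Then $\mathcal L:=\mathcal M(F)$ fails to be normally generated; more specifically, the 2-normality of $\phi_{\mathcal L}(C)$ does not hold.
   Context: Curves are irreducible and projective over an algebraically closed field of characteristic zero. For a line bundle $\mathcal L$ and a divisor $D$ on $C$, $\mathcal L(D):=\mathcal L\otimes\mathcal O_C(D)$, $\mathcal L^m:=\mathcal L^{\otimes m}$, and $h^i(\mathcal L):=\dim H^i(C,\mathcal L)$. $\phi_{\mathcal L}$ denotes the map $C\to\mathbb P^r:=\mathbb P(H^0(\mathcal L))$ defined by the complete linear system $|\mathcal L|$; $\mathcal L$ is birationally very ample if $\phi_{\mathcal L}$ is birational onto its image. A smooth curve $C\subset\mathbb P^r$ is projectively normal if $H^0(\mathbb P^r,\mathcal O_{\mathbb P^r}(m))\to H^0(C,\mathcal O_C(m))$ is surjective for every $m\ge 0$. A line bundle $\mathcal L$ is normally generated if it is very ample and $\phi_{\mathcal L}(C)$ is projectively normal. 2-normality of $\phi_{\mathcal L}(C)$ means that the natural map $H^0(\mathbb P^r,\mathcal O_{\mathbb P^r}(2))=\mathrm{Sym}^2H^0(\mathcal L)\to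 H^0(C,\mathcal L^2)$ is surjective. *)

theory Defs
  imports
    "HOL-Analysis.Abstract_Topology"
    "HOL-Computational_Algebra.Polynomial"
    "HOL-Library.Extended_Nat"
begin

text \<open>
  Curves are classical projective varieties over an algebraically closed field of characteristic
  zero.  Such a field is infinite, so homogeneous polynomials are identified with the functions
  they define on affine space.
\<close>

section \<open>Projective space\<close>

text \<open>
  A point of $P^n$ is the set of its homogeneous coordinate vectors; a vector of length $n+1$ is a
  function on the naturals that vanishes beyond \<open>n\<close>.
\<close>

type_synonym 'k vec = "nat \<Rightarrow> 'k"
type_synonym 'k ppoint = "'k vec set"

definition ppoint :: "'k::field vec \<Rightarrow> 'k ppoint" where
  "ppoint v = {\<lambda>i. c * v i | c. c \<noteq> 0}"

definition proj_space :: "nat \<Rightarrow> 'k::field ppoint set" where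
  "proj_space n = {ppoint v | v. (\<forall>i>n. v i = 0) \<and> v \<noteq> (\<lambda>_. 0)}"

text \<open>\<open>form n d F\<close>: \<open>F\<close> is a homogeneous polynomial of degree \<open>d\<close> in the coordinates
  $x_0, \ldots, x_n$ (possibly zero).\<close>

inductive form :: "nat \<Rightarrow> nat \<Rightarrow> ('k::field vec \<Rightarrow> 'k) \<Rightarrow> bool" for n where
  const: "form n 0 (\<lambda>_. c)"
| coord: "i \<le> n \<Longrightarrow> form n 1 (\<lambda>v. v i)"
| add: "form n d F \<Longrightarrow> form n d G \<Longrightarrow> form n d (\<lambda>v. F v + G v)"
| mult: "form n d F \<Longrightarrow> form n e G \<Longrightarrow> form n (d + e) (\<lambda>v. F v * G v)"

definition nonvanishing_locus :: "nat \<Rightarrow> ('k::field vec \<Rightarrow> 'k) set \<Rightarrow> 'k ppoint set" where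
  "nonvanishing_locus n S = {P \<in> proj_space n. \<exists>F\<in>S. \<exists>v\<in>P. F v \<noteq> 0}"

definition zariski :: "nat \<Rightarrow> 'k::field ppoint topology" where
  "zariski n = topology (\<lambda>U. \<exists>S \<subseteq> {F. \<exists>d. form n d F}. U = nonvanishing_locus n S)"

lemma form_homogeneous: "form n d F \<Longrightarrow> F (\<lambda>i. c * v i) = c ^ d * F v"
  by (induction rule: form.induct) (auto simp: algebra_simps power_add)

lemma form_nonzero_on_ppoint:
  assumes "form n d F" "P \<in> proj_space n" "u \<in> P" "w \<in> P" "F u \<noteq> 0"
  shows "F w \<noteq> 0"
proof -
  from assms(2) obtain v where P: "P = ppoint v" by (auto simp: proj_space_def)
  obtain a b where "u = (\<lambda>i. a * v i)" "w = (\<lambda>i. b * v i)" "a \<noteq> 0" "b \<noteq> 0"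
    using assms(3,4) unfolding P ppoint_def by blast
  then show ?thesis
    using assms(5) by (simp add: form_homogeneous[OF assms(1)])
qed

lemma openin_zariski_iff:
  "openin (zariski n) U \<longleftrightarrow> (\<exists>S \<subseteq> {F. \<exists>d. form n d F}. U = nonvanishing_locus n S)"
proof -
  let ?A = "{F. \<exists>d. form n d F} :: ('a vec \<Rightarrow> 'a) set"
  let ?O = "\<lambda>U. \<exists>S \<subseteq> ?A. U = nonvanishing_locus n S"
  have int: "?O (U \<inter> V)" if U: "?O U" and V: "?O V" for U V
  proof -
    obtain S where S: "S \<subseteq> ?A" "U = nonvanishing_locus n S"
      using U by (elim exE conjE)
    obtain T where T: "T \<subseteq> ?A" "V = nonvanishing_locus n T"
      using V by (elim exE conjE)
    let ?R = "(\<lambda>(F, G) v. F v * G v) ` (S \<times> T)"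
    have "?R \<subseteq> ?A"
    proof
      fix H assume "H \<in> ?R"
      then obtain F G where FG: "F \<in> S" "G \<in> T" "H = (\<lambda>v. F v * G v)" by auto
      obtain d where "form n d F" using subsetD[OF S(1) FG(1)] by auto
      moreover obtain e where "form n e G" using subsetD[OF T(1) FG(2)] by auto
      ultimately have "form n (d + e) (\<lambda>v. F v * G v)" by (rule form.mult)
      then show "H \<in> ?A" unfolding FG(3) by auto
    qed
    moreover have "P \<in> U \<inter> V \<longleftrightarrow> P \<in> nonvanishing_locus n ?R" for P
    proof
      assume P: "P \<in> U \<inter> V"
      obtain F u where F: "P \<in> proj_space n" "F \<in> S" "u \<in> P" "F u \<noteq> 0"
        using P unfolding S(2) nonvanishing_locus_def by auto
      obtain G w where G: "G \<in> T" "w \<in> P" "G w \<noteq> 0"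
        using P unfolding T(2) nonvanishing_locus_def by auto
      obtain d where "form n d F" using subsetD[OF S(1) F(2)] by auto
      then have "F w \<noteq> 0"
        using form_nonzero_on_ppoint F G(2) by metis
      then have "F w * G w \<noteq> 0" using G by simp
      then show "P \<in> nonvanishing_locus n ?R"
        using F G unfolding nonvanishing_locus_def by force
    next
      assume "P \<in> nonvanishing_locus n ?R"
      then show "P \<in> U \<inter> V"
        unfolding S(2) T(2) nonvanishing_locus_def by auto
    qed
    ultimately show ?thesis by (intro exI[of _ ?R]) auto
  qed
  have un: "?O (\<Union>\<K>)" if K: "\<forall>U\<in>\<K>. ?O U" for \<K>
  proof -
    obtain f where f: "\<forall>U\<in>\<K>. f U \<subseteq> ?A \<and> U = nonvanishing_locus n (f U)"
      using bchoice[OF K] by (elim exE)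
    have "\<Union>\<K> = (\<Union>U\<in>\<K>. nonvanishing_locus n (f U))" using f by auto
    also have "\<dots> = nonvanishing_locus n (\<Union>(f ` \<K>))"
      unfolding nonvanishing_locus_def by auto
    finally show ?thesis
      using f by (intro exI[of _ "\<Union>(f ` \<K>)"]) auto
  qed
  have "istopology ?O"
    unfolding istopology_def by (intro conjI allI impI; (rule int un; assumption))
  then show ?thesis
    unfolding zariski_def by (simp only: topology_inverse')
qed

abbreviation zopen :: "nat \<Rightarrow> 'k::field ppoint set \<Rightarrow> 'k ppoint set \<Rightarrow> bool" where
  "zopen n X U \<equiv> openin (subtopology (zariski n) X) U"

text \<open>\<open>regular n U f\<close>: \<open>f\<close> is a regular function on the (locally closed) subset \<open>U\<close> of $P^n$;
  the values of \<open>f\<close> off \<open>U\<close> are irrelevant.\<close>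

definition regular :: "nat \<Rightarrow> 'k::field ppoint set \<Rightarrow> ('k ppoint \<Rightarrow> 'k) \<Rightarrow> bool" where
  "regular n U f \<longleftrightarrow> (\<forall>P\<in>U. \<exists>W d F G. openin (zariski n) W \<and> P \<in> W \<and> form n d F \<and> form n d G \<and>
     (\<forall>Q\<in>W \<inter> U. \<forall>v\<in>Q. G v \<noteq> 0 \<and> f Q = F v / G v))"

definition morphism ::
  "nat \<Rightarrow> 'k::field ppoint set \<Rightarrow> nat \<Rightarrow> 'k ppoint set \<Rightarrow> ('k ppoint \<Rightarrow> 'k ppoint) \<Rightarrow> bool" where
  "morphism n X m Y \<phi> \<longleftrightarrow>
     continuous_map (subtopology (zariski n) X) (subtopology (zariski m) Y) \<phi> \<and>
     (\<forall>V f. zopen m Y V \<and> regular m V f \<longrightarrow> regular n {x\<in>X. \<phi> x \<in> V} (f \<circ> \<phi>))"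

definition isomorphism ::
  "nat \<Rightarrow> 'k::field ppoint set \<Rightarrow> nat \<Rightarrow> 'k ppoint set \<Rightarrow> ('k ppoint \<Rightarrow> 'k ppoint) \<Rightarrow> bool" where
  "isomorphism n X m Y \<phi> \<longleftrightarrow> morphism n X m Y \<phi> \<and>
     (\<exists>\<psi>. morphism m Y n X \<psi> \<and> (\<forall>x\<in>X. \<psi> (\<phi> x) = x) \<and> (\<forall>y\<in>Y. \<phi> (\<psi> y) = y))"


section \<open>Dimension of vector spaces\<close>

text \<open>
  \<open>qdim V W\<close> is the dimension of the quotient $V/W$ of spaces $W \subseteq V$ of \<open>k\<close>-valued
  functions.  It is \<open>\<infinity>\<close> for infinite-dimensional quotients (the library's \<open>dim\<close> would be 0 there).
\<close>

definition indep_mod :: "('x \<Rightarrow> 'k::field) set \<Rightarrow> ('x \<Rightarrow> 'k) set \<Rightarrow> bool" where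
  "indep_mod W B \<longleftrightarrow> (\<forall>c. (\<lambda>x. \<Sum>b\<in>B. c b * b x) \<in> W \<longrightarrow> (\<forall>b\<in>B. c b = 0))"

definition qdim :: "('x \<Rightarrow> 'k::field) set \<Rightarrow> ('x \<Rightarrow> 'k) set \<Rightarrow> enat" where
  "qdim V W = Sup {enat (card B) | B. finite B \<and> B \<subseteq> V \<and> indep_mod W B}"

abbreviation vdim :: "('x \<Rightarrow> 'k::field) set \<Rightarrow> enat" where
  "vdim V \<equiv> qdim V {\<lambda>_. 0}"


section \<open>Smooth curves\<close>

definition irreducible_subset :: "nat \<Rightarrow> 'k::field ppoint set \<Rightarrow> bool" where
  "irreducible_subset n Z \<longleftrightarrow> Z \<noteq> {} \<and>
     (\<forall>A B. closedin (zariski n) A \<and> closedin (zariski n) B \<and> Z \<subseteq> A \<union> B \<longrightarrow> Z \<subseteq> A \<or> Z \<subseteq> B)"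

definition krull_dim :: "nat \<Rightarrow> 'k::field ppoint set \<Rightarrow> enat" where
  "krull_dim n X = Sup {enat d | d. \<exists>Z. (\<forall>i\<le>d. closedin (subtopology (zariski n) X) (Z i) \<and>
     irreducible_subset n (Z i)) \<and> (\<forall>i<d. Z i \<subset> Z (Suc i))}"

text \<open>
  The maximal ideal $m_P$ of the local ring at \<open>P\<close> and its square.  Germs are represented by
  functions defined everywhere and arbitrary away from \<open>P\<close>; a function vanishing near \<open>P\<close> lies in
  \<open>max_ideal_sq\<close>, so that the quotient of the two is exactly the cotangent space $m_P/m_P^2$.
\<close>

definition max_ideal :: "nat \<Rightarrow> 'k::field ppoint set \<Rightarrow> 'k ppoint \<Rightarrow> ('k ppoint \<Rightarrow> 'k) set" where
  "max_ideal n X P = {f. \<exists>W. zopen n X W \<and> P \<in> W \<and> regular n W f \<and> f P = 0}"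

definition max_ideal_sq :: "nat \<Rightarrow> 'k::field ppoint set \<Rightarrow> 'k ppoint \<Rightarrow> ('k ppoint \<Rightarrow> 'k) set" where
  "max_ideal_sq n X P = {f. \<exists>W (m::nat) a b. zopen n X W \<and> P \<in> W \<and>
     (\<forall>i<m. a i \<in> max_ideal n X P \<and> b i \<in> max_ideal n X P) \<and>
     (\<forall>x\<in>W. f x = (\<Sum>i<m. a i x * b i x))}"

text \<open>Smoothness: all local rings are regular.  (On an irreducible variety the local rings at
  points all have the dimension of the variety.)\<close>

definition smooth_curve :: "nat \<Rightarrow> 'k::field ppoint set \<Rightarrow> bool" where
  "smooth_curve n C \<longleftrightarrow> closedin (zariski n) C \<and> irreducible_subset n C \<and> krull_dim n C = 1 \<and>
     (\<forall>P\<in>C. qdim (max_ideal n C P) (max_ideal_sq n C P) = krull_dim n C)"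


section \<open>Line bundles\<close>

text \<open>
  A line bundle on \<open>C\<close> is given by transition functions \<open>trans L i j\<close> (regular on
  $U_i \cap U_j$, with the cocycle condition) for an open cover $U_i$ = \<open>triv L i\<close>, which
  without loss of generality is indexed by the points of \<open>C\<close>, with $i \in U_i$.  A section over
  \<open>V\<close> is a family of regular functions $s_i$ on $V \cap U_i$ with $s_i = g_{ij} s_j$.
  Since $x \in U_x$, the family is determined by the function $\sigma(x) = s_x(x)$, namely
  $s_i(x) = g_{ix}(x) \sigma(x)$, and sections are represented by these functions $\sigma$.
\<close>

record 'k line_bundle =
  triv :: "'k ppoint \<Rightarrow> 'k ppoint set"
  trans :: "'k ppoint \<Rightarrow> 'k ppoint \<Rightarrow> 'k ppoint \<Rightarrow> 'k"

definition is_line_bundle :: "nat \<Rightarrow> 'k::field ppoint set \<Rightarrow> 'k line_bundle \<Rightarrow> bool" where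
  "is_line_bundle n C L \<longleftrightarrow>
     (\<forall>i\<in>C. zopen n C (triv L i) \<and> i \<in> triv L i) \<and>
     (\<forall>i\<in>C. \<forall>j\<in>C. regular n (triv L i \<inter> triv L j) (trans L i j)) \<and>
     (\<forall>i\<in>C. \<forall>x\<in>triv L i. trans L i i x = 1) \<and>
     (\<forall>i\<in>C. \<forall>j\<in>C. \<forall>k\<in>C. \<forall>x\<in>triv L i \<inter> triv L j \<inter> triv L k.
        trans L i j x * trans L j k x = trans L i k x)"

definition lb_section ::
  "nat \<Rightarrow> 'k::field ppoint set \<Rightarrow> 'k line_bundle \<Rightarrow> 'k ppoint set \<Rightarrow> ('k ppoint \<Rightarrow> 'k) \<Rightarrow> bool" where
  "lb_section n C L V \<sigma> \<longleftrightarrow> (\<forall>i\<in>C. regular n (V \<inter> triv L i) (\<lambda>x. trans L i x x * \<sigma> x))"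

definition lb_trivial :: "'k::field ppoint set \<Rightarrow> 'k line_bundle" where
  "lb_trivial C = \<lparr>triv = (\<lambda>_. C), trans = (\<lambda>_ _ _. 1)\<rparr>"

definition lb_tensor :: "'k::field line_bundle \<Rightarrow> 'k line_bundle \<Rightarrow> 'k line_bundle" where
  "lb_tensor L M = \<lparr>triv = (\<lambda>i. triv L i \<inter> triv M i),
                    trans = (\<lambda>i j x. trans L i j x * trans M i j x)\<rparr>"

definition lb_power :: "'k::field ppoint set \<Rightarrow> 'k line_bundle \<Rightarrow> nat \<Rightarrow> 'k line_bundle" where
  "lb_power C L m = (lb_tensor L ^^ m) (lb_trivial C)"


section \<open>Cohomology\<close>

definition H0 :: "nat \<Rightarrow> 'k::field ppoint set \<Rightarrow> 'k line_bundle \<Rightarrow> ('k ppoint \<Rightarrow> 'k) set" where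
  "H0 n C L = {\<sigma>. lb_section n C L C \<sigma> \<and> (\<forall>x. x \<notin> C \<longrightarrow> \<sigma> x = 0)}"

definition h0 :: "nat \<Rightarrow> 'k::field ppoint set \<Rightarrow> 'k line_bundle \<Rightarrow> enat" where
  "h0 n C L = vdim (H0 n C L)"

text \<open>
  $H^1$ is Cech cohomology (which in degree 1 is sheaf cohomology on every space): the direct
  limit over all open covers, among which the covers $(V_P)$ indexed by points with $P \in V_P$ are
  cofinal.  A cochain is a function of triples \<open>(P, Q, x)\<close>, arbitrary for $x$ outside
  $V_P \cap V_Q$.  Two cocycles, possibly on different covers, agree in the direct limit iff their
  difference is a coboundary on some common refinement, i.e. lies in \<open>cech_B1\<close>.  Hence the direct
  limit is \<open>cech_Z1\<close> modulo \<open>cech_B1\<close>.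
\<close>

definition pointed_cover :: "nat \<Rightarrow> 'k::field ppoint set \<Rightarrow> ('k ppoint \<Rightarrow> 'k ppoint set) \<Rightarrow> bool" where
  "pointed_cover n C V \<longleftrightarrow> (\<forall>P\<in>C. zopen n C (V P) \<and> P \<in> V P)"

definition cech_Z1 ::
  "nat \<Rightarrow> 'k::field ppoint set \<Rightarrow> 'k line_bundle \<Rightarrow> ('k ppoint \<times> 'k ppoint \<times> 'k ppoint \<Rightarrow> 'k) set" where
  "cech_Z1 n C L = {c. \<exists>V. pointed_cover n C V \<and>
     (\<forall>P\<in>C. \<forall>Q\<in>C. lb_section n C L (V P \<inter> V Q) (\<lambda>x. c (P, Q, x))) \<and>
     (\<forall>P\<in>C. \<forall>Q\<in>C. \<forall>R\<in>C. \<forall>x\<in>V P \<inter> V Q \<inter> V R. c (P, R, x) = c (P, Q, x) + c (Q, R, x))}"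

definition cech_B1 ::
  "nat \<Rightarrow> 'k::field ppoint set \<Rightarrow> 'k line_bundle \<Rightarrow> ('k ppoint \<times> 'k ppoint \<times> 'k ppoint \<Rightarrow> 'k) set" where
  "cech_B1 n C L = {c. \<exists>V h. pointed_cover n C V \<and> (\<forall>P\<in>C. lb_section n C L (V P) (h P)) \<and>
     (\<forall>P\<in>C. \<forall>Q\<in>C. \<forall>x\<in>V P \<inter> V Q. c (P, Q, x) = h Q x - h P x)}"

definition h1 :: "nat \<Rightarrow> 'k::field ppoint set \<Rightarrow> 'k line_bundle \<Rightarrow> enat" where
  "h1 n C L = qdim (cech_Z1 n C L) (cech_B1 n C L)"


section \<open>Divisors\<close>

text \<open>A local parameter \<open>t\<close> at \<open>P\<close>: a generator of the maximal ideal at \<open>P\<close>, regular on the open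
  set \<open>V\<close> and without zeros there other than \<open>P\<close>.\<close>

definition local_param ::
  "nat \<Rightarrow> 'k::field ppoint set \<Rightarrow> 'k ppoint \<Rightarrow> 'k ppoint set \<Rightarrow> ('k ppoint \<Rightarrow> 'k) \<Rightarrow> bool" where
  "local_param n C P V t \<longleftrightarrow> zopen n C V \<and> P \<in> V \<and> regular n V t \<and> (\<forall>x\<in>V. t x = 0 \<longleftrightarrow> x = P) \<and>
     (\<forall>f\<in>max_ideal n C P. \<exists>W u. zopen n C W \<and> P \<in> W \<and> regular n W u \<and> (\<forall>x\<in>W. f x = t x * u x))"

text \<open>Order of vanishing at \<open>P\<close> of a function that is regular, and not identically zero, near
  \<open>P\<close>.\<close>

definition vanishing_order ::
  "nat \<Rightarrow> 'k::field ppoint set \<Rightarrow> 'k ppoint \<Rightarrow> ('k ppoint \<Rightarrow> 'k) \<Rightarrow> nat" where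
  "vanishing_order n C P f = (THE m. \<exists>V t W u. local_param n C P V t \<and>
     zopen n C W \<and> P \<in> W \<and> regular n W u \<and> u P \<noteq> 0 \<and> (\<forall>x\<in>W. f x = t x ^ m * u x))"

definition div_of_section ::
  "nat \<Rightarrow> 'k::field ppoint set \<Rightarrow> 'k line_bundle \<Rightarrow> ('k ppoint \<Rightarrow> 'k) \<Rightarrow> ('k ppoint \<Rightarrow> int)" where
  "div_of_section n C L \<sigma> = (\<lambda>P. if P \<in> C
     then int (vanishing_order n C P (\<lambda>x. trans L P x x * \<sigma> x)) else 0)"

definition complete_linear_system ::
  "nat \<Rightarrow> 'k::field ppoint set \<Rightarrow> 'k line_bundle \<Rightarrow> ('k ppoint \<Rightarrow> int) set" where
  "complete_linear_system n C L = div_of_section n C L ` (H0 n C L - {\<lambda>_. 0})"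

text \<open>
  The line bundle $O_C(D)$.  Around \<open>P\<close> the divisor \<open>D\<close> has the local equation $t_P^{D(P)}$, where
  $t_P$ is a (chosen) local parameter with domain $V_P$; this is valid on $V_P$ minus the other
  points of the support of \<open>D\<close>.  The transition functions are the quotients of local equations.
  On the overlap of two different charts no \<open>0 powi\<close> with nonzero exponent occurs.
\<close>

definition chosen_param ::
  "nat \<Rightarrow> 'k::field ppoint set \<Rightarrow> 'k ppoint \<Rightarrow> 'k ppoint set \<times> ('k ppoint \<Rightarrow> 'k)" where
  "chosen_param n C P = (SOME (V, t). local_param n C P V t)"

definition lb_of_div ::
  "nat \<Rightarrow> 'k::field ppoint set \<Rightarrow> ('k ppoint \<Rightarrow> int) \<Rightarrow> 'k line_bundle" where
  "lb_of_div n C D = \<lparr>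
     triv = (\<lambda>P. fst (chosen_param n C P) - ({Q. D Q \<noteq> 0} - {P})),
     trans = (\<lambda>P Q x. if P = Q then 1
        else snd (chosen_param n C P) x powi D P / snd (chosen_param n C Q) x powi D Q)\<rparr>"

definition lb_twist ::
  "nat \<Rightarrow> 'k::field ppoint set \<Rightarrow> 'k line_bundle \<Rightarrow> ('k ppoint \<Rightarrow> int) \<Rightarrow> 'k line_bundle" where
  "lb_twist n C L D = lb_tensor L (lb_of_div n C D)"


section \<open>Maps defined by complete linear systems\<close>

definition globally_generated :: "nat \<Rightarrow> 'k::field ppoint set \<Rightarrow> 'k line_bundle \<Rightarrow> bool" where
  "globally_generated n C L \<longleftrightarrow> (\<forall>x\<in>C. \<exists>\<sigma>\<in>H0 n C L. \<sigma> x \<noteq> 0)"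

definition section_basis ::
  "nat \<Rightarrow> 'k::field ppoint set \<Rightarrow> 'k line_bundle \<Rightarrow> nat \<Rightarrow> (nat \<Rightarrow> 'k ppoint \<Rightarrow> 'k) \<Rightarrow> bool" where
  "section_basis n C L r s \<longleftrightarrow> (\<forall>i\<le>r. s i \<in> H0 n C L) \<and>
     (\<forall>\<sigma>\<in>H0 n C L. \<exists>!c. (\<forall>i>r. c i = 0) \<and> \<sigma> = (\<lambda>x. \<Sum>i\<le>r. c i * s i x))"

text \<open>The map $x \mapsto [s_0(x) : \ldots : s_r(x)]$, meaningful off the base locus.  For a basis of
  $H^0(L)$ this is the map $\phi_L$, up to a linear change of coordinates of $P^r$.\<close>

definition phi_map :: "nat \<Rightarrow> (nat \<Rightarrow> 'k ppoint \<Rightarrow> 'k::field) \<Rightarrow> 'k ppoint \<Rightarrow> 'k ppoint" where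
  "phi_map r s x = ppoint (\<lambda>i. if i \<le> r then s i x else 0)"

definition off_base_locus ::
  "'k::field ppoint set \<Rightarrow> nat \<Rightarrow> (nat \<Rightarrow> 'k ppoint \<Rightarrow> 'k) \<Rightarrow> 'k ppoint set" where
  "off_base_locus C r s = {x \<in> C. \<exists>i\<le>r. s i x \<noteq> 0}"

text \<open>$\phi_L$ is birational onto its image: it restricts to an isomorphism from a nonempty open
  subset of \<open>C\<close> onto an open subset of the closure of the image of the complement of the base
  locus.\<close>

definition birationally_very_ample :: "nat \<Rightarrow> 'k::field ppoint set \<Rightarrow> 'k line_bundle \<Rightarrow> bool" where
  "birationally_very_ample n C L \<longleftrightarrow> (\<exists>r s. section_basis n C L r s \<and>
     (\<exists>U V. zopen n C U \<and> U \<noteq> {} \<and> U \<subseteq> off_base_locus C r s \<and>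
        zopen r (zariski r closure_of (phi_map r s ` off_base_locus C r s)) V \<and>
        isomorphism n U r V (phi_map r s)))"

definition very_ample :: "nat \<Rightarrow> 'k::field ppoint set \<Rightarrow> 'k line_bundle \<Rightarrow> bool" where
  "very_ample n C L \<longleftrightarrow> (\<exists>r s. section_basis n C L r s \<and> off_base_locus C r s = C \<and>
     closedin (zariski r) (phi_map r s ` C) \<and> isomorphism n C r (phi_map r s ` C) (phi_map r s))"

text \<open>Global sections of $O_X(m)$ for $X \subseteq P^r$, as functions on the cone over \<open>X\<close> that are
  locally quotients of forms whose degrees differ by \<open>m\<close>.\<close>

definition twisting_sections ::
  "nat \<Rightarrow> 'k::field ppoint set \<Rightarrow> nat \<Rightarrow> ('k vec \<Rightarrow> 'k) set" where
  "twisting_sections r X m = {t. \<forall>P\<in>X. \<exists>W e F G. openin (zariski r) W \<and> P \<in> W \<and>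
     form r (e + m) F \<and> form r e G \<and> (\<forall>Q\<in>W \<inter> X. \<forall>v\<in>Q. G v \<noteq> 0 \<and> t v = F v / G v)}"

text \<open>Here $H^0(P^r, O(m))$ is the space of forms of degree \<open>m\<close>.\<close>

definition projectively_normal :: "nat \<Rightarrow> 'k::field ppoint set \<Rightarrow> bool" where
  "projectively_normal r X \<longleftrightarrow> (\<forall>m. \<forall>t\<in>twisting_sections r X m.
     \<exists>F. form r m F \<and> (\<forall>P\<in>X. \<forall>v\<in>P. F v = t v))"

definition normally_generated :: "nat \<Rightarrow> 'k::field ppoint set \<Rightarrow> 'k line_bundle \<Rightarrow> bool" where
  "normally_generated n C L \<longleftrightarrow> very_ample n C L \<and>
     (\<exists>r s. section_basis n C L r s \<and> projectively_normal r (phi_map r s ` C))"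

text \<open>Surjectivity of $H^0(L) \otimes H^0(M) \to H^0(L \otimes M)$; the image of this map consists
  of the finite sums of products.  (As functions $\sigma$, sections are multiplied pointwise.)\<close>

definition mult_map_surj ::
  "nat \<Rightarrow> 'k::field ppoint set \<Rightarrow> 'k line_bundle \<Rightarrow> 'k line_bundle \<Rightarrow> bool" where
  "mult_map_surj n C L M \<longleftrightarrow> (\<forall>\<sigma>\<in>H0 n C (lb_tensor L M). \<exists>(m::nat) a b.
     (\<forall>i<m. a i \<in> H0 n C L \<and> b i \<in> H0 n C M) \<and> \<sigma> = (\<lambda>x. \<Sum>i<m. a i x * b i x))"

text \<open>2-normality of $\phi_L(C)$: surjectivity of $Sym^2 H^0(L) \to H^0(L^2)$.\<close>

definition two_normal :: "nat \<Rightarrow> 'k::field ppoint set \<Rightarrow> 'k line_bundle \<Rightarrow> bool" where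
  "two_normal n C L \<longleftrightarrow> (\<forall>\<sigma>\<in>H0 n C (lb_power C L 2). \<exists>(m::nat) a b.
     (\<forall>i<m. a i \<in> H0 n C L \<and> b i \<in> H0 n C L) \<and> \<sigma> = (\<lambda>x. \<Sum>i<m. a i x * b i x))"

end

theory Submission
  imports Defs "HOL-Library.Function_Algebras" "HOL-Analysis.Abstract_Limits"
begin

text \<open>
  Write $N = M^2$ and $A = O_C(F)$, and let \<open>s\<close>, \<open>t\<close> be a basis of $H^0(A)$.  They have no common
  zero, because $A$ is isomorphic to the globally generated bundle $\mathcal F$.  Suppose that
  $\phi_L(C)$ is 2-normal, where $L = M \otimes A$.  By the surjectivity assumption every section of
  $L$ is $s a + t b$ with $a, b \in H^0(M)$, hence every section of $L^2 = N A^2$ is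
  $s^2 p + s t q + t^2 r$ with $p, q, r \in H^0(N)$.

  The engine is the base-point-free pencil trick, carried out on Cech cocycles (\<open>pencil_H1\<close>): if
  $H^1(B A) = 0$ and $H^0(B A^2) = s H^0(B A) + t H^0(B A)$, then $H^1(B) = 0$.  Indeed, for a
  cocycle $c$ of $B$ the cocycles $s c$ and $t c$ are coboundaries of some $h$ and $k$.  The local
  sections $t h_P - s k_P$ glue to a global section of $B A^2$.  Subtracting global sections from
  $h$ and $k$ one reaches $t h_P = s k_P$, and then $h_P / s = k_P / t$ is a cochain of $B$ with
  coboundary $c$.

  The trick is used twice (\<open>two_normal_imp_H1_zero\<close>).  With $B = N$ the hypotheses are
  $H^1(M^2(F)) = 0$ and the description of $H^0(N A^2)$ above.  With $B = N A^{-1}$ they are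
  $H^1(N) = 0$, which has just been obtained, and $H^0(N A) = s H^0(N) + t H^0(N)$.  For the latter
  take $\eta \in H^0(N A)$ and write $s \eta = s^2 p + s t q + t^2 r$.  Then
  $t (t r) = s (\eta - s p - t q)$, so there is $y \in H^0(N)$ with $s y = t r$ and
  $t y = \eta - s p - t q$, and $\eta = s p + t (q + y)$.  The conclusion $H^1(M^2(-F)) = 0$
  contradicts $h^1(M^2) + 1 \le h^1(M^2(-F))$.

  What remains is to know that $O_C(F)$, glued from powers of local parameters, is a line
  bundle isomorphic to $\mathcal F$ (\<open>ex_pencil\<close>).  Local parameters exist by Nakayama's lemma,
  and a section that is not zero near a point vanishes there to finite order because local rings of
  $C$ are Noetherian, which comes from Hilbert's basis theorem.  Finally, normal
  generation implies 2-normality (\<open>normally_generated_imp_two_normal\<close>): a section of $L^2$ is a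
  section of $O(2)$ on the image, hence a quadratic form in a basis of $H^0(L)$.
\<close>

section \<open>Hilbert's basis theorem\<close>

definition subring :: "'a::comm_ring_1 set \<Rightarrow> bool" where
  "subring R \<longleftrightarrow> 1 \<in> R \<and> (\<forall>a\<in>R. \<forall>b\<in>R. a - b \<in> R \<and> a * b \<in> R)"

text \<open>
  Linear combinations of elements of \<open>S\<close> with coefficients in \<open>R\<close>, built up one summand at a time so
  that relations between generators can be transported by induction.
\<close>

inductive_set ideal_span :: "'a::comm_ring_1 set \<Rightarrow> 'a set \<Rightarrow> 'a set" for R S where
  zero: "0 \<in> ideal_span R S"
| step: "f \<in> ideal_span R S \<Longrightarrow> a \<in> R \<Longrightarrow> s \<in> S \<Longrightarrow> f + a * s \<in> ideal_span R S"

text \<open>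
  For a subring this is equivalent to all ideals being finitely generated.  It is stated for sequences
  because in the study of orders of vanishing an infinite sequence of functions has to be stopped.
\<close>

definition noetherian :: "'a::comm_ring_1 set \<Rightarrow> bool" where
  "noetherian R \<longleftrightarrow> (\<forall>f::nat \<Rightarrow> 'a. range f \<subseteq> R \<longrightarrow> (\<exists>N. f N \<in> ideal_span R (f ` {..<N})))"

text \<open>
  Polynomial expressions in \<open>x\<close> of formal degree less than \<open>d\<close>.  As \<open>x\<close> need not be
  transcendental over \<open>R\<close>, the coefficients are not determined by the element.
\<close>

primrec polys_below :: "'a::comm_ring_1 set \<Rightarrow> 'a \<Rightarrow> nat \<Rightarrow> 'a set" where
  "polys_below R x 0 = {0}"
| "polys_below R x (Suc d) = {p + r * x ^ d | p r. p \<in> polys_below R x d \<and> r \<in> R}"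

definition adjoin :: "'a::comm_ring_1 set \<Rightarrow> 'a \<Rightarrow> 'a set" where
  "adjoin R x = (\<Union>d. polys_below R x d)"

lemma subringD:
  assumes "subring R"
  shows "1 \<in> R" "0 \<in> R" "a \<in> R \<Longrightarrow> b \<in> R \<Longrightarrow> a - b \<in> R" "a \<in> R \<Longrightarrow> b \<in> R \<Longrightarrow> a * b \<in> R"
    "a \<in> R \<Longrightarrow> - a \<in> R" "a \<in> R \<Longrightarrow> b \<in> R \<Longrightarrow> a + b \<in> R"
proof -
  show 1: "1 \<in> R" and d: "\<And>a b. a \<in> R \<Longrightarrow> b \<in> R \<Longrightarrow> a - b \<in> R"
    and "a \<in> R \<Longrightarrow> b \<in> R \<Longrightarrow> a * b \<in> R"
    using assms by (auto simp: subring_def)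
  show 0: "0 \<in> R" using d[OF 1 1] by simp
  show m: "- a \<in> R" if "a \<in> R" for a using d[OF 0 that] by simp
  show "a \<in> R \<Longrightarrow> b \<in> R \<Longrightarrow> a + b \<in> R" using d[of a "- b"] m[of b] by simp
qed

lemma ideal_span_add:
  assumes "f \<in> ideal_span R S" "g \<in> ideal_span R S" shows "f + g \<in> ideal_span R S"
  using assms(2)
proof induction
  case (step g a s)
  then have "(f + g) + a * s \<in> ideal_span R S" by (intro ideal_span.step) auto
  then show ?case by (simp add: add.assoc)
qed (simp add: assms(1))

lemma ideal_span_mult:
  assumes "subring R" "a \<in> R" "f \<in> ideal_span R S"
  shows "a * f \<in> ideal_span R S"
  using assms(3)
proof induction
  case (step f b s)
  then have "a * f + (a * b) * s \<in> ideal_span R S"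
    by (intro ideal_span.step) (auto simp: subringD(4)[OF assms(1,2)])
  then show ?case by (simp add: algebra_simps)
qed (auto intro: ideal_span.intros)

lemma ideal_span_base: "subring R \<Longrightarrow> s \<in> S \<Longrightarrow> s \<in> ideal_span R S"
  using ideal_span.step[OF ideal_span.zero, of 1 R s S] subringD(1)[of R] by auto

lemma ideal_span_subset:
  assumes "subring R" "S \<subseteq> ideal_span R T" shows "ideal_span R S \<subseteq> ideal_span R T"
proof
  fix f assume "f \<in> ideal_span R S" then show "f \<in> ideal_span R T"
    by induction (use assms in \<open>auto intro: ideal_span.zero ideal_span_add ideal_span_mult\<close>)
qed

lemma ideal_span_mono: "subring R \<Longrightarrow> S \<subseteq> T \<Longrightarrow> ideal_span R S \<subseteq> ideal_span R T"
  by (intro ideal_span_subset) (auto intro: ideal_span_base)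

lemma polys_below_SucI:
  "p \<in> polys_below R x d \<Longrightarrow> r \<in> R \<Longrightarrow> q = p + r * x ^ d \<Longrightarrow> q \<in> polys_below R x (Suc d)"
  by auto

lemma polys_below_Suc: "subring R \<Longrightarrow> polys_below R x d \<subseteq> polys_below R x (Suc d)"
  by (intro subsetI, rule polys_below_SucI[where r = 0]) (auto simp: subringD(2))

lemma polys_below_0: "subring R \<Longrightarrow> 0 \<in> polys_below R x d"
proof (induction d)
  case (Suc d)
  then show ?case using polys_below_Suc by blast
qed simp

lemma polys_below_mono: "subring R \<Longrightarrow> d \<le> e \<Longrightarrow> polys_below R x d \<subseteq> polys_below R x e"
  using lift_Suc_mono_le[of "polys_below R x" d e] polys_below_Suc[of R x] by blast

lemma polys_below_diff:
  assumes R: "subring R"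
  shows "p \<in> polys_below R x d \<Longrightarrow> q \<in> polys_below R x d \<Longrightarrow> p - q \<in> polys_below R x d"
proof (induction d arbitrary: p q)
  case (Suc d)
  from Suc.prems obtain p' r q' s where *: "p = p' + r * x ^ d" "q = q' + s * x ^ d"
     "p' \<in> polys_below R x d" "q' \<in> polys_below R x d" "r \<in> R" "s \<in> R" by auto
  have "p - q = (p' - q') + (r - s) * x ^ d" by (simp add: * algebra_simps)
  then show ?case
    by (intro polys_below_SucI[OF Suc.IH[OF *(3,4)] subringD(3)[OF R *(5,6)]])
qed simp

lemma polys_below_add:
  assumes "subring R" "p \<in> polys_below R x d" "q \<in> polys_below R x d"
  shows "p + q \<in> polys_below R x d"
  using polys_below_diff[OF assms(1,2) polys_below_diff[OF assms(1) polys_below_0[OF assms(1)] assms(3)]]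
  by simp

lemma polys_below_scale:
  assumes R: "subring R" "a \<in> R"
  shows "p \<in> polys_below R x d \<Longrightarrow> a * x ^ k * p \<in> polys_below R x (d + k)"
proof (induction d arbitrary: p)
  case (Suc d)
  then obtain q r where *: "p = q + r * x ^ d" "q \<in> polys_below R x d" "r \<in> R" by auto
  have "a * x ^ k * p = a * x ^ k * q + (a * r) * x ^ (d + k)"
    by (simp add: * algebra_simps power_add)
  then show ?case
    using polys_below_SucI[OF Suc.IH[OF *(2)] subringD(4)[OF R *(3)]] by simp
qed (simp add: polys_below_0[OF R(1)])

lemma adjoin_add:
  assumes R: "subring R" and "p \<in> adjoin R x" "q \<in> adjoin R x"
  shows "p + q \<in> adjoin R x" "p - q \<in> adjoin R x"
proof -
  from assms(2,3) obtain d e where "p \<in> polys_below R x d" "q \<in> polys_below R x e"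
    unfolding adjoin_def by blast
  then have pq: "p \<in> polys_below R x (max d e)" "q \<in> polys_below R x (max d e)"
    using polys_below_mono[OF R max.cobounded1[of d e]] polys_below_mono[OF R max.cobounded2[of e d]]
    by auto
  then have "p + q \<in> polys_below R x (max d e)" "p - q \<in> polys_below R x (max d e)"
    using polys_below_add[OF R pq] polys_below_diff[OF R pq] by auto
  then show "p + q \<in> adjoin R x" "p - q \<in> adjoin R x"
    unfolding adjoin_def by (auto simp del: polys_below.simps)
qed

lemma adjoin_base: "subring R \<Longrightarrow> r \<in> R \<Longrightarrow> r * x ^ k \<in> adjoin R x"
  unfolding adjoin_def
  by (rule UN_I[of "Suc k"]) (auto intro!: polys_below_SucI[OF polys_below_0] simp del: polys_below.simps)

lemma subring_adjoin:
  assumes R: "subring R" shows "subring (adjoin R x)"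
proof -
  have "p * q \<in> adjoin R x" if p: "p \<in> polys_below R x d" and q: "q \<in> adjoin R x" for p q d
    using p
  proof (induction d arbitrary: p)
    case 0 then show ?case using adjoin_base[OF R subringD(2)[OF R]] by simp
  next
    case (Suc d)
    then obtain p' r where *: "p = p' + r * x ^ d" "p' \<in> polys_below R x d" "r \<in> R" by auto
    obtain e where "q \<in> polys_below R x e" using q by (auto simp: adjoin_def)
    then have "r * x ^ d * q \<in> adjoin R x"
      using polys_below_scale[OF R *(3)] unfolding adjoin_def by blast
    then show ?case using adjoin_add(1)[OF R Suc.IH[OF *(2)]] by (simp add: * distrib_right)
  qed
  then have "p * q \<in> adjoin R x" if "p \<in> adjoin R x" "q \<in> adjoin R x" for p q
    using that unfolding adjoin_def[of R x] by blast
  then show ?thesis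
    using adjoin_base[OF R subringD(1)[OF R], of x 0] adjoin_add(2)[OF R]
    unfolding subring_def by simp
qed

text \<open>
  Hilbert's argument works in any ring extension generated by one element, since it only needs the
  existence of leading coefficients.  The ideal \<open>I\<close> generated by a bad sequence is not finitely
  generated, so one can choose \<open>f N\<close> of least degree in \<open>I\<close> outside the ideal of its predecessors.  A relation among
  the leading coefficients lifts to an element of that ideal with the same leading term as \<open>f N\<close>,
  and the difference has smaller degree.
\<close>

proposition Hilbert_basis:
  assumes R: "subring R" and noeth: "noetherian R"
  shows "noetherian (adjoin R x)"
proof (rule ccontr)
  let ?A = "adjoin R x"
  note A = subring_adjoin[OF R, of x]
  assume "\<not> noetherian ?A"
  then obtain g :: "nat \<Rightarrow> 'a" where gA: "range g \<subseteq> ?A" and bad: "\<And>N. g N \<notin> ideal_span ?A (g ` {..<N})"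
    unfolding noetherian_def by blast
  define I where "I = ideal_span ?A (range g)"
  have I_A: "f \<in> ?A" if "f \<in> I" for f
    using that unfolding I_def
    by induction (use A gA subringD(2,4,6)[OF A] in auto)
  have below: "\<exists>M. f \<in> ideal_span ?A (g ` {..<M})" if "f \<in> I" for f
    using that unfolding I_def
  proof induction
    case (step f a s)
    then obtain M k where M: "f \<in> ideal_span ?A (g ` {..<M})" "s = g k" by auto
    have "g ` {..<M} \<subseteq> g ` {..<M + Suc k}" by auto
    from ideal_span_mono[OF A this] have "f \<in> ideal_span ?A (g ` {..<M + Suc k})" using M by auto
    then have "f + a * s \<in> ideal_span ?A (g ` {..<M + Suc k})"
      using step M by (intro ideal_span.step) auto
    then show ?case by blast
  qed (auto intro: ideal_span.zero)
  have fin_below: "\<exists>M. T \<subseteq> ideal_span ?A (g ` {..<M})" if "finite T" "T \<subseteq> I" for T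
    using that
  proof (induction T rule: finite_induct)
    case (insert t T)
    then obtain M where "T \<subseteq> ideal_span ?A (g ` {..<M})" by auto
    moreover obtain M' where "t \<in> ideal_span ?A (g ` {..<M'})" using below insert.prems by blast
    ultimately have M: "T \<subseteq> ideal_span ?A (g ` {..<M})" "t \<in> ideal_span ?A (g ` {..<M'})" by auto
    have "g ` {..<M} \<subseteq> g ` {..<M + M'}" "g ` {..<M'} \<subseteq> g ` {..<M + M'}"
      by (intro image_mono; simp)+
    from this[THEN ideal_span_mono[OF A]] have "insert t T \<subseteq> ideal_span ?A (g ` {..<M + M'})"
      using M by auto
    then show ?case by blast
  qed auto
  have outside: "\<exists>h. h \<in> I - ideal_span ?A T" if "finite T" "T \<subseteq> I" for T
  proof -
    obtain M where "T \<subseteq> ideal_span ?A (g ` {..<M})" using fin_below \<open>finite T\<close> \<open>T \<subseteq> I\<close> by blast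
    then have "ideal_span ?A T \<subseteq> ideal_span ?A (g ` {..<M})" by (rule ideal_span_subset[OF A])
    then show ?thesis using bad[of M] ideal_span_base[OF A, of "g M" "range g"] unfolding I_def by blast
  qed
  define deg where "deg h = (LEAST d. h \<in> polys_below R x d)" for h
  define pick where "pick T = arg_min deg (\<lambda>h. h \<in> I - ideal_span ?A T)" for T
  have pick: "pick T \<in> I - ideal_span ?A T" "h \<in> I - ideal_span ?A T \<Longrightarrow> deg (pick T) \<le> deg h"
    if "finite T" "T \<subseteq> I" for T h
    using arg_min_nat_lemma[of "\<lambda>h. h \<in> I - ideal_span ?A T"] outside[OF that] unfolding pick_def by blast+
  define T where "T = rec_nat {} (\<lambda>_ T. insert (pick T) T)"
  have T_simps: "T 0 = {}" "T (Suc N) = insert (pick (T N)) (T N)" for N by (auto simp: T_def)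
  define f where "f N = pick (T N)" for N
  have T_eq: "T N = f ` {..<N}" for N
    by (induction N) (auto simp: T_simps f_def lessThan_Suc)
  have T: "finite (T N)" "T N \<subseteq> I" for N
  proof -
    show fin: "finite (T N)" for N by (simp add: T_eq)
    show "T N \<subseteq> I"
    proof (induction N)
      case (Suc N)
      then show ?case using pick(1)[of "T N"] fin[of N] by (auto simp: T_simps)
    qed (simp add: T_simps)
  qed
  have f: "f N \<in> I" "f N \<notin> ideal_span ?A (T N)" "h \<in> I \<Longrightarrow> h \<notin> ideal_span ?A (T N) \<Longrightarrow> deg (f N) \<le> deg h" for N h
    using pick[OF T] unfolding f_def by auto
  have deg: "h \<in> polys_below R x (deg h)" if "h \<in> ?A" for h
    using that LeastI_ex[of "\<lambda>d. h \<in> polys_below R x d"] unfolding deg_def adjoin_def by blast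
  have deg_mono: "deg (f i) \<le> deg (f j)" if "i \<le> j" for i j
  proof -
    have "T i \<subseteq> T j" using that by (auto simp: T_eq)
    from ideal_span_mono[OF A this] show ?thesis using f(1,2)[of j] f(3)[of "f j" i] by auto
  qed
  have "\<exists>e p r. deg (f N) = Suc e \<and> f N = p + r * x ^ e \<and> p \<in> polys_below R x e \<and> r \<in> R" for N
  proof (cases "deg (f N)")
    case 0
    then have "f N = 0" using deg[OF I_A[OF f(1)], of N] by simp
    then show ?thesis using f(2)[of N] by (simp add: ideal_span.zero)
  next
    case (Suc e)
    then show ?thesis using deg[OF I_A[OF f(1)], of N] by auto
  qed
  then obtain e p r where lead: "\<And>N. deg (f N) = Suc (e N)" "\<And>N. f N = p N + r N * x ^ e N"
      "\<And>N. p N \<in> polys_below R x (e N)" "\<And>N. r N \<in> R" by metis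
  obtain N where N: "r N \<in> ideal_span R (r ` {..<N})"
    using noeth lead(4) unfolding noetherian_def by blast
  \<comment> \<open>Degrees do not decrease along the sequence, so every \<open>f i\<close> with \<open>i < N\<close> can be multiplied by a power
    of \<open>x\<close> to reach the degree of \<open>f N\<close>.\<close>
  have "\<exists>h \<in> ideal_span ?A (f ` {..<N}). h - q * x ^ e N \<in> polys_below R x (e N)"
    if "q \<in> ideal_span R (r ` {..<N})" for q
    using that
  proof induction
    case zero
    show ?case by (intro bexI[of _ 0]) (auto simp: polys_below_0[OF R] ideal_span.zero)
  next
    case (step q a s)
    then obtain h i where h: "h \<in> ideal_span ?A (f ` {..<N})" "h - q * x ^ e N \<in> polys_below R x (e N)"
      and i: "i < N" "s = r i" by auto
    have le: "e i \<le> e N" using deg_mono[of i N] i lead(1)[of i] lead(1)[of N] by simp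
    define c where "c = a * x ^ (e N - e i)"
    have "c * p i \<in> polys_below R x (e i + (e N - e i))"
      unfolding c_def by (rule polys_below_scale[OF R step.hyps(2) lead(3)])
    then have "(h - q * x ^ e N) + c * p i \<in> polys_below R x (e N)"
      using polys_below_add[OF R h(2)] le by simp
    moreover have "h + c * f i - (q + a * s) * x ^ e N = (h - q * x ^ e N) + c * p i"
      using le by (simp add: lead(2)[of i] c_def i algebra_simps flip: power_add)
    moreover have "h + c * f i \<in> ideal_span ?A (f ` {..<N})"
      using h(1) i adjoin_base[OF R step.hyps(2)] by (intro ideal_span.step) (auto simp: c_def)
    ultimately show ?case by metis
  qed
  from this[OF N] obtain h where h: "h \<in> ideal_span ?A (T N)"
    and low: "h - r N * x ^ e N \<in> polys_below R x (e N)" by (auto simp: T_eq)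
  let ?d = "f N - h"
  have "p N - (h - r N * x ^ e N) \<in> polys_below R x (e N)"
    by (rule polys_below_diff[OF R lead(3) low])
  moreover have "?d = p N - (h - r N * x ^ e N)"
    by (simp add: lead(2)[of N])
  ultimately have "?d \<in> polys_below R x (e N)" by (simp only:)
  then have "deg ?d \<le> e N" unfolding deg_def by (rule Least_le)
  then have less: "deg ?d < deg (f N)" by (simp add: lead(1))
  have "ideal_span ?A (T N) \<subseteq> I"
    unfolding I_def by (rule ideal_span_subset[OF A]) (use T in \<open>auto simp: I_def\<close>)
  then have "h \<in> I" using h by auto
  then have "?d \<in> I"
    using ideal_span_add[OF f(1)[unfolded I_def] ideal_span_mult[OF A subringD(5)[OF A subringD(1)[OF A]], of h]]
    unfolding I_def by simp
  moreover have "?d \<notin> ideal_span ?A (T N)"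
    using ideal_span_add[OF _ h, of ?d] f(2)[of N] by auto
  ultimately have "deg (f N) \<le> deg ?d" by (rule f(3))
  then show False using less by simp
qed

inductive_set polyfun :: "nat \<Rightarrow> ('k::field vec \<Rightarrow> 'k) set" for m where
  const: "(\<lambda>_. c) \<in> polyfun m"
| coord: "i < m \<Longrightarrow> (\<lambda>v. v i) \<in> polyfun m"
| add: "F \<in> polyfun m \<Longrightarrow> G \<in> polyfun m \<Longrightarrow> F + G \<in> polyfun m"
| mult: "F \<in> polyfun m \<Longrightarrow> G \<in> polyfun m \<Longrightarrow> F * G \<in> polyfun m"

lemma subring_polyfun: "subring (polyfun m)"
proof -
  have "F - G \<in> polyfun m" if "F \<in> polyfun m" "G \<in> polyfun m" for F G :: "'a vec \<Rightarrow> 'a"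
    using polyfun.add[OF that(1) polyfun.mult[OF polyfun.const[of "- 1"] that(2)]]
    by (simp add: plus_fun_def times_fun_def fun_diff_def)
  then show ?thesis
    unfolding subring_def using polyfun.const[of 1 m] by (auto simp: one_fun_def intro: polyfun.mult)
qed

lemma polyfun_mono: "F \<in> polyfun m \<Longrightarrow> m \<le> l \<Longrightarrow> F \<in> polyfun l"
  by (induction rule: polyfun.induct) (auto intro: polyfun.intros)

lemma polyfun_Suc: "polyfun (Suc m) = adjoin (polyfun m) (\<lambda>v::'k::field vec. v m)"
proof (intro set_eqI iffI)
  let ?x = "\<lambda>v::'k vec. v m"
  note R = subring_polyfun[of m]
  note A = subring_adjoin[OF subring_polyfun[of m], of ?x]
  fix F :: "'k vec \<Rightarrow> 'k"
  show "F \<in> adjoin (polyfun m) ?x" if "F \<in> polyfun (Suc m)"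
    using that
  proof induction
    case (const c)
    show ?case using adjoin_base[OF R polyfun.const[of c], where x = ?x and k = 0] by simp
  next
    case (coord i)
    show ?case
    proof (cases "i = m")
      case True
      show ?thesis unfolding True using adjoin_base[OF R subringD(1)[OF R], where x = ?x and k = 1] by simp
    next
      case False
      then have "(\<lambda>v. v i) \<in> polyfun m" using coord by (auto intro: polyfun.coord)
      then show ?thesis using adjoin_base[OF R, where x = ?x and k = 0] by fastforce
    qed
  next
    case (add F G)
    then show ?case using subringD(6)[OF A add.IH] by (simp add: plus_fun_def)
  next
    case (mult F G)
    then show ?case using subringD(4)[OF A mult.IH] by (simp add: times_fun_def)
  qed
  show "F \<in> polyfun (Suc m)" if F: "F \<in> adjoin (polyfun m) ?x"
  proof -
    note R' = subring_polyfun[of "Suc m"]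
    have pow: "?x ^ d \<in> polyfun (Suc m)" for d
    proof (induction d)
      case (Suc d)
      show ?case unfolding power_Suc by (rule subringD(4)[OF R' polyfun.coord Suc.IH]) simp
    qed (simp only: power_0 subringD(1)[OF R'])
    have "polys_below (polyfun m) ?x d \<subseteq> polyfun (Suc m)" for d
    proof (induction d)
      case (Suc d)
      show ?case
      proof
        fix F assume "F \<in> polys_below (polyfun m) ?x (Suc d)"
        then obtain p r where F: "F = p + r * ?x ^ d" "p \<in> polys_below (polyfun m) ?x d" "r \<in> polyfun m"
          by auto
        show "F \<in> polyfun (Suc m)"
          unfolding F(1) using Suc.IH F polyfun_mono[OF F(3), of "Suc m"] pow[of d]
          by (intro subringD(4,6)[OF R']) auto
      qed
    qed (use subringD(2)[OF R'] in \<open>simp only: polys_below.simps, blast\<close>)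
    then show ?thesis using F unfolding adjoin_def by blast
  qed
qed

lemma noetherian_polyfun: "noetherian (polyfun m :: ('k::field vec \<Rightarrow> 'k) set)"
proof (induction m)
  case 0
  have const: "\<exists>c. F = (\<lambda>_. c)" if "F \<in> polyfun 0" for F :: "'k vec \<Rightarrow> 'k"
    using that by induction auto
  show ?case
    unfolding noetherian_def
  proof (intro allI impI)
    fix f :: "nat \<Rightarrow> 'k vec \<Rightarrow> 'k" assume "range f \<subseteq> polyfun 0"
    then have "f i \<in> polyfun 0" for i by auto
    from const[OF this] have "\<forall>i. \<exists>c. f i = (\<lambda>_. c)" by (rule allI)
    from choice[OF this] obtain c where c: "\<And>i. f i = (\<lambda>_. c i)" by blast
    show "\<exists>N. f N \<in> ideal_span (polyfun 0) (f ` {..<N})"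
    proof (cases "c 0 = 0")
      case True
      then have "f 0 = 0" by (simp add: c zero_fun_def)
      then show ?thesis by (intro exI[of _ 0]) (auto intro: ideal_span.zero)
    next
      case False
      then have "f 1 = 0 + (\<lambda>_. c 1 / c 0) * f 0" by (simp add: c fun_eq_iff)
      also have "\<dots> \<in> ideal_span (polyfun 0) (f ` {..<1})"
        by (intro ideal_span.intros polyfun.const) auto
      finally show ?thesis by blast
    qed
  qed
next
  case (Suc m)
  then show ?case unfolding polyfun_Suc by (intro Hilbert_basis subring_polyfun)
qed

lemma form_polyfun: "form n d F \<Longrightarrow> F \<in> polyfun (Suc n)"
proof (induction rule: form.induct)
  case (add d F G)
  then show ?case using polyfun.add[of F "Suc n" G] by (simp add: plus_fun_def)
next
  case (mult d F e G)
  then show ?case using polyfun.mult[of F "Suc n" G] by (simp add: times_fun_def)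
qed (auto intro: polyfun.intros)

section \<open>Germs of regular functions\<close>

lemma ppoint_self: "v \<in> ppoint v"
  unfolding ppoint_def by (rule CollectI, rule exI[of _ 1]) simp

lemma ppoint_nonempty: "Q \<in> proj_space n \<Longrightarrow> \<exists>v. v \<in> Q"
  using ppoint_self unfolding proj_space_def by blast

lemma topspace_zariski: "topspace (zariski n) = (proj_space n :: 'k::field ppoint set)"
proof
  show "topspace (zariski n) \<subseteq> (proj_space n :: 'k ppoint set)"
    unfolding topspace_def by (auto simp: openin_zariski_iff nonvanishing_locus_def)
  have "proj_space n \<subseteq> nonvanishing_locus n {\<lambda>_. 1::'k}"
    using ppoint_nonempty by (auto simp: nonvanishing_locus_def)
  moreover have "openin (zariski n) (nonvanishing_locus n {\<lambda>_. 1::'k})"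
    unfolding openin_zariski_iff by (intro exI[of _ "{\<lambda>_. 1}"]) (auto intro: form.const)
  ultimately show "(proj_space n :: 'k ppoint set) \<subseteq> topspace (zariski n)"
    by (meson openin_subset subset_trans)
qed

lemma openin_nonvanishing: "form n d F \<Longrightarrow> openin (zariski n) {P \<in> proj_space n. \<exists>v\<in>P. F v \<noteq> 0}"
  unfolding openin_zariski_iff nonvanishing_locus_def by (intro exI[of _ "{F}"]) auto

lemma zopen_subset: "zopen n C U \<Longrightarrow> U \<subseteq> C"
  using openin_subset by fastforce

definition coord_vec :: "'k::field ppoint \<Rightarrow> 'k vec" where "coord_vec Q = (SOME v. v \<in> Q)"

lemma coord_vec_in: "Q \<in> proj_space n \<Longrightarrow> coord_vec Q \<in> Q"
  unfolding coord_vec_def by (rule someI_ex[OF ppoint_nonempty])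

lemma ppoint_scaled:
  assumes "Q \<in> proj_space n" "v \<in> Q" "w \<in> Q"
  shows "\<exists>c. c \<noteq> 0 \<and> w = (\<lambda>i. c * v i)"
proof -
  obtain u a b where "v = (\<lambda>i. a * u i)" "w = (\<lambda>i. b * u i)" "a \<noteq> 0" "b \<noteq> 0"
    using assms by (auto simp: proj_space_def ppoint_def)
  then show ?thesis by (intro exI[of _ "b / a"]) auto
qed

lemma scaled_in: "Q \<in> proj_space n \<Longrightarrow> v \<in> Q \<Longrightarrow> c \<noteq> 0 \<Longrightarrow> (\<lambda>i. c * v i) \<in> Q"
  by (auto simp: proj_space_def ppoint_def) (metis mult.assoc mult_eq_0_iff)

lemma ppoint_eqI:
  assumes "P \<in> proj_space n" "Q \<in> proj_space n" "v \<in> P" "v \<in> Q" shows "P = Q"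
proof -
  have "A \<subseteq> B" if "A \<in> proj_space n" "B \<in> proj_space n" "v \<in> A" "v \<in> B" for A B
    using ppoint_scaled[OF that(1,3)] scaled_in[OF that(2,4)] by blast
  then show ?thesis using assms by blast
qed

lemma coord_vec_beyond: "Q \<in> proj_space n \<Longrightarrow> i > n \<Longrightarrow> coord_vec Q i = 0"
  using coord_vec_in[of Q n] by (auto simp: proj_space_def ppoint_def)

lemma coord_vec_nonzero: assumes "Q \<in> proj_space n" shows "\<exists>j\<le>n. coord_vec Q j \<noteq> 0"
proof -
  obtain v c where "v \<noteq> (\<lambda>_. 0)" "c \<noteq> 0" "coord_vec Q = (\<lambda>i. c * v i)"
    using coord_vec_in[OF assms] assms by (auto simp: proj_space_def ppoint_def)
  then have "\<exists>i. coord_vec Q i \<noteq> 0" by (auto simp: fun_eq_iff)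
  then show ?thesis using coord_vec_beyond[OF assms] by (metis not_le)
qed

text \<open>
  The germ version of \<open>regular\<close>: on an open set, regularity is regularity at each point.  With the
  neighbourhood filter of \<open>P\<close> in \<open>C\<close> all later arguments about shrinking neighbourhoods become
  arguments about events that hold eventually.
\<close>

definition regular_at :: "nat \<Rightarrow> 'k::field ppoint set \<Rightarrow> 'k ppoint \<Rightarrow> ('k ppoint \<Rightarrow> 'k) \<Rightarrow> bool" where
  "regular_at n C P f \<longleftrightarrow> (\<exists>d F G. form n d F \<and> form n d G \<and>
     (\<forall>\<^sub>F Q in nhdsin (subtopology (zariski n) C) P. \<forall>v\<in>Q. G v \<noteq> 0 \<and> f Q = F v / G v))"

text \<open>
  The point with its coordinate \<open>j\<close> normalised to 1.  It depends only on \<open>Q\<close>, so that polynomial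
  functions of \<open>dehom j Q\<close> are honest functions on the chart where coordinate \<open>j\<close> does not vanish.
\<close>

definition dehom :: "nat \<Rightarrow> 'k::field ppoint \<Rightarrow> 'k vec" where
  "dehom j Q = (\<lambda>i. coord_vec Q i / coord_vec Q j)"

lemma form_dehom:
  assumes "form n d F" "Q \<in> proj_space n" "v \<in> Q" "coord_vec Q j \<noteq> 0"
  shows "F v = v j ^ d * F (dehom j Q)" "v j \<noteq> 0"
proof -
  obtain c where c: "c \<noteq> 0" "v = (\<lambda>i. c * coord_vec Q i)"
    using ppoint_scaled[OF assms(2) coord_vec_in[OF assms(2)] assms(3)] by blast
  then show "v j \<noteq> 0" using assms(4) by auto
  have "v = (\<lambda>i. v j * dehom j Q i)" using c assms(4) by (auto simp: dehom_def fun_eq_iff)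
  then have "F v = F (\<lambda>i. v j * dehom j Q i)" by simp
  then show "F v = v j ^ d * F (dehom j Q)" by (simp only: form_homogeneous[OF assms(1)])
qed

locale projective_set =
  fixes n :: nat and C :: "'k::field ppoint set"
  assumes C_subset: "C \<subseteq> proj_space n"
begin

abbreviation near :: "'k ppoint \<Rightarrow> 'k ppoint filter" where
  "near \<equiv> nhdsin (subtopology (zariski n) C)"

abbreviation reg :: "'k ppoint \<Rightarrow> ('k ppoint \<Rightarrow> 'k) \<Rightarrow> bool" where
  "reg \<equiv> regular_at n C"

lemma topspace_C: "topspace (subtopology (zariski n) C) = C"
  using C_subset by (simp add: topspace_zariski Int_absorb1)

lemma zopen_C: "zopen n C C"
  using openin_topspace[of "subtopology (zariski n) C"] unfolding topspace_C .

lemma eventually_near: "P \<in> C \<Longrightarrow> eventually \<Phi> (near P) \<longleftrightarrow> (\<exists>U. zopen n C U \<and> P \<in> U \<and> (\<forall>x\<in>U. \<Phi> x))"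
  unfolding eventually_nhdsin topspace_C by simp

lemma eventually_open: "zopen n C U \<Longrightarrow> P \<in> U \<Longrightarrow> \<forall>\<^sub>F x in near P. x \<in> U"
  unfolding eventually_nhdsin by auto

lemma near_self: "P \<in> C \<Longrightarrow> eventually \<Phi> (near P) \<Longrightarrow> \<Phi> P"
  by (auto simp: eventually_near)

lemma eventually_in_C: "\<forall>\<^sub>F x in near P. x \<in> C"
  unfolding eventually_nhdsin topspace_C using zopen_C by auto

lemma eventually_near_near:
  assumes "P \<in> C" "eventually \<Phi> (near P)"
  shows "\<forall>\<^sub>F Q in near P. eventually \<Phi> (near Q)"
proof -
  obtain U where U: "zopen n C U" "P \<in> U" "\<forall>x\<in>U. \<Phi> x"
    using assms by (auto simp: eventually_near)
  have "eventually \<Phi> (near Q)" if "Q \<in> U" for Q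
    using eventually_open[OF U(1) that] by (rule eventually_mono) (use U(3) in blast)
  then show ?thesis using U(1,2) eventually_near[OF assms(1)] by blast
qed

lemma zopen_iff: "zopen n C U \<longleftrightarrow> U \<subseteq> C \<and> (\<forall>P\<in>U. \<forall>\<^sub>F x in near P. x \<in> U)"
proof
  assume "U \<subseteq> C \<and> (\<forall>P\<in>U. \<forall>\<^sub>F x in near P. x \<in> U)"
  then have "\<exists>W. zopen n C W \<and> P \<in> W \<and> W \<subseteq> U" if "P \<in> U" for P
    using that eventually_near[of P "\<lambda>x. x \<in> U"] by (meson subset_iff)
  then show "zopen n C U" by (subst openin_subopen) blast
next
  assume U: "zopen n C U"
  then show "U \<subseteq> C \<and> (\<forall>P\<in>U. \<forall>\<^sub>F x in near P. x \<in> U)"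
    using zopen_subset[OF U] eventually_open[OF U] by blast
qed

lemma eventually_form_nonzero:
  assumes "P \<in> C" "form n d F" "v \<in> P" "F v \<noteq> 0"
  shows "\<forall>\<^sub>F Q in near P. \<forall>w\<in>Q. F w \<noteq> 0"
  unfolding eventually_near[OF assms(1)]
proof (intro exI conjI)
  let ?W = "{P \<in> proj_space n. \<exists>v\<in>P. F v \<noteq> 0}"
  show "zopen n C (?W \<inter> C)"
    using openin_nonvanishing[OF assms(2)] by (auto simp: openin_subtopology)
  show "P \<in> ?W \<inter> C" using assms C_subset by auto
  show "\<forall>x\<in>?W \<inter> C. \<forall>w\<in>x. F w \<noteq> 0" using form_nonzero_on_ppoint[OF assms(2)] by blast
qed

lemma regular_iff: assumes "zopen n C U" shows "regular n U f \<longleftrightarrow> (\<forall>P\<in>U. reg P f)"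
proof
  have U: "U \<subseteq> C" using assms zopen_subset by blast
  show "\<forall>P\<in>U. reg P f" if "regular n U f"
  proof
    fix P assume P: "P \<in> U"
    then obtain W d F G where W: "openin (zariski n) W" "P \<in> W" "form n d F" "form n d G"
      "\<forall>Q\<in>W \<inter> U. \<forall>v\<in>Q. G v \<noteq> 0 \<and> f Q = F v / G v"
      using \<open>regular n U f\<close> unfolding regular_def by meson
    have "zopen n C (W \<inter> C)" using W(1) by (auto simp: openin_subtopology)
    then have "zopen n C (W \<inter> C \<inter> U)" using assms by blast
    then have "\<forall>\<^sub>F x in near P. x \<in> W \<inter> C \<inter> U" using W(2) P U by (intro eventually_open) auto
    then have "\<forall>\<^sub>F Q in near P. \<forall>v\<in>Q. G v \<noteq> 0 \<and> f Q = F v / G v"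
      by (rule eventually_mono) (use W(5) in blast)
    then show "reg P f" unfolding regular_at_def using W by blast
  qed
  show "regular n U f" if reg: "\<forall>P\<in>U. reg P f"
    unfolding regular_def
  proof
    fix P assume P: "P \<in> U"
    then obtain d F G where *: "form n d F" "form n d G"
      "\<forall>\<^sub>F Q in near P. \<forall>v\<in>Q. G v \<noteq> 0 \<and> f Q = F v / G v"
      using reg unfolding regular_at_def by blast
    have "P \<in> C" using P U by blast
    from *(3)[unfolded eventually_near[OF this]]
    obtain V where V: "zopen n C V" "P \<in> V" "\<forall>Q\<in>V. \<forall>v\<in>Q. G v \<noteq> 0 \<and> f Q = F v / G v"
      by blast
    then obtain W where W: "openin (zariski n) W" "V = W \<inter> C" by (auto simp: openin_subtopology)
    then show "\<exists>W d F G. openin (zariski n) W \<and> P \<in> W \<and> form n d F \<and> form n d G \<and>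
       (\<forall>Q\<in>W \<inter> U. \<forall>v\<in>Q. G v \<noteq> 0 \<and> f Q = F v / G v)"
      using W V * U by (intro exI[of _ W] exI[of _ d] exI[of _ F] exI[of _ G]) auto
  qed
qed

lemma reg_cong:
  assumes "reg P f" "\<forall>\<^sub>F Q in near P. f Q = g Q" shows "reg P g"
proof -
  obtain d F G where F: "form n d F" "form n d G"
    "\<forall>\<^sub>F Q in near P. \<forall>v\<in>Q. G v \<noteq> 0 \<and> f Q = F v / G v"
    using assms(1) unfolding regular_at_def by blast
  have "\<forall>\<^sub>F Q in near P. \<forall>v\<in>Q. G v \<noteq> 0 \<and> g Q = F v / G v"
    using F(3) assms(2) by eventually_elim auto
  then show ?thesis using F(1,2) unfolding regular_at_def by blast
qed

lemma reg_const [intro]: "reg P (\<lambda>_. c)"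
  unfolding regular_at_def
  by (intro exI[of _ 0] exI[of _ "\<lambda>_. c"] exI[of _ "\<lambda>_. 1"]) (auto intro: form.const)

lemma reg_add [intro]: assumes "reg P f" "reg P g" shows "reg P (\<lambda>Q. f Q + g Q)"
proof -
  obtain d F G where F: "form n d F" "form n d G"
    "\<forall>\<^sub>F Q in near P. \<forall>v\<in>Q. G v \<noteq> 0 \<and> f Q = F v / G v"
    using assms(1) unfolding regular_at_def by blast
  obtain d' F' G' where F': "form n d' F'" "form n d' G'"
    "\<forall>\<^sub>F Q in near P. \<forall>v\<in>Q. G' v \<noteq> 0 \<and> g Q = F' v / G' v"
    using assms(2) unfolding regular_at_def by blast
  have "form n (d + d') (\<lambda>v. F v * G' v + G v * F' v)" "form n (d + d') (\<lambda>v. G v * G' v)"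
    using F F' by (auto intro: form.intros)
  moreover have "\<forall>\<^sub>F Q in near P. \<forall>v\<in>Q. G v * G' v \<noteq> 0 \<and>
      f Q + g Q = (F v * G' v + G v * F' v) / (G v * G' v)"
    using F(3) F'(3) by eventually_elim (auto simp: add_frac_eq algebra_simps)
  ultimately show ?thesis unfolding regular_at_def by blast
qed

lemma reg_mult [intro]: assumes "reg P f" "reg P g" shows "reg P (\<lambda>Q. f Q * g Q)"
proof -
  obtain d F G where F: "form n d F" "form n d G"
    "\<forall>\<^sub>F Q in near P. \<forall>v\<in>Q. G v \<noteq> 0 \<and> f Q = F v / G v"
    using assms(1) unfolding regular_at_def by blast
  obtain d' F' G' where F': "form n d' F'" "form n d' G'"
    "\<forall>\<^sub>F Q in near P. \<forall>v\<in>Q. G' v \<noteq> 0 \<and> g Q = F' v / G' v"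
    using assms(2) unfolding regular_at_def by blast
  have "form n (d + d') (\<lambda>v. F v * F' v)" "form n (d + d') (\<lambda>v. G v * G' v)"
    using F F' by (auto intro: form.intros)
  moreover have "\<forall>\<^sub>F Q in near P. \<forall>v\<in>Q. G v * G' v \<noteq> 0 \<and>
      f Q * g Q = (F v * F' v) / (G v * G' v)"
    using F(3) F'(3) by eventually_elim auto
  ultimately show ?thesis unfolding regular_at_def by blast
qed

lemma reg_inverse:
  assumes "P \<in> C" "reg P f" "f P \<noteq> 0"
  shows "reg P (\<lambda>Q. inverse (f Q))" "\<forall>\<^sub>F Q in near P. f Q \<noteq> 0"
proof -
  obtain d F G where F: "form n d F" "form n d G"
    "\<forall>\<^sub>F Q in near P. \<forall>v\<in>Q. G v \<noteq> 0 \<and> f Q = F v / G v"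
    using assms(2) unfolding regular_at_def by blast
  have P: "coord_vec P \<in> P" using assms(1) C_subset coord_vec_in by blast
  then have "F (coord_vec P) \<noteq> 0" using near_self[OF assms(1) F(3)] assms(3) by auto
  from eventually_form_nonzero[OF assms(1) F(1) P this]
  have ev: "\<forall>\<^sub>F Q in near P. \<forall>w\<in>Q. F w \<noteq> 0" .
  have "\<forall>\<^sub>F Q in near P. \<forall>v\<in>Q. F v \<noteq> 0 \<and> inverse (f Q) = G v / F v"
    using ev F(3) by eventually_elim auto
  then show "reg P (\<lambda>Q. inverse (f Q))" unfolding regular_at_def using F by blast
  show "\<forall>\<^sub>F Q in near P. f Q \<noteq> 0"
    using ev F(3) eventually_in_C
  proof eventually_elim
    case (elim Q)
    then have "coord_vec Q \<in> Q" using C_subset coord_vec_in by blast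
    then show ?case using elim by auto
  qed
qed

lemma reg_uminus [intro]: "reg P f \<Longrightarrow> reg P (\<lambda>Q. - f Q)"
  using reg_mult[OF reg_const[of P "- 1"], of f] by simp

lemma reg_diff [intro]: "reg P f \<Longrightarrow> reg P g \<Longrightarrow> reg P (\<lambda>Q. f Q - g Q)"
  using reg_add[of P f "\<lambda>Q. - g Q"] by auto

lemma reg_power [intro]: "reg P f \<Longrightarrow> reg P (\<lambda>Q. f Q ^ m)"
  by (induction m) auto

lemma reg_sum [intro]: "(\<And>i. i \<in> A \<Longrightarrow> reg P (f i)) \<Longrightarrow> reg P (\<lambda>Q. \<Sum>i\<in>A. f i Q)"
  by (induction A rule: infinite_finite_induct) auto

lemma reg_divide: "P \<in> C \<Longrightarrow> reg P f \<Longrightarrow> reg P g \<Longrightarrow> g P \<noteq> 0 \<Longrightarrow> reg P (\<lambda>Q. f Q / g Q)"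
  unfolding divide_inverse by (intro reg_mult reg_inverse)

lemma reg_powi: "P \<in> C \<Longrightarrow> reg P f \<Longrightarrow> f P \<noteq> 0 \<or> m = 0 \<Longrightarrow> reg P (\<lambda>Q. f Q powi m)"
  unfolding power_int_def by (cases "m \<ge> 0") (auto intro: reg_power reg_inverse)

lemma eventually_reg:
  assumes "P \<in> C" "reg P f" shows "\<forall>\<^sub>F Q in near P. reg Q f"
proof -
  obtain d F G where F: "form n d F" "form n d G"
    "\<forall>\<^sub>F Q in near P. \<forall>v\<in>Q. G v \<noteq> 0 \<and> f Q = F v / G v"
    using assms(2) unfolding regular_at_def by blast
  show ?thesis
    using eventually_near_near[OF assms(1) F(3)]
    by (rule eventually_mono) (use F(1,2) in \<open>unfold regular_at_def, blast\<close>)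
qed

lemma ex_nonzero_coord: "P \<in> C \<Longrightarrow> \<exists>j\<le>n. coord_vec P j \<noteq> 0"
  using C_subset coord_vec_nonzero by blast

lemma eventually_coord_nonzero: assumes "P \<in> C" "j \<le> n" "coord_vec P j \<noteq> 0" shows "\<forall>\<^sub>F Q in near P. coord_vec Q j \<noteq> 0"
proof -
  have "coord_vec P \<in> P" using assms(1) C_subset coord_vec_in by blast
  from eventually_form_nonzero[OF assms(1) form.coord[OF assms(2)] this assms(3)] eventually_in_C
  show ?thesis by eventually_elim (use C_subset coord_vec_in in blast)
qed

lemma reg_dehom:
  assumes P: "P \<in> C" "j \<le> n" "coord_vec P j \<noteq> 0"
  shows "A \<in> polyfun (Suc n) \<Longrightarrow> reg P (\<lambda>Q. A (dehom j Q))"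
proof (induction rule: polyfun.induct)
  case (coord i)
  then have i: "i \<le> n" by simp
  have "\<forall>\<^sub>F Q in near P. \<forall>v\<in>Q. v j \<noteq> 0 \<and> dehom j Q i = v i / v j"
    using eventually_coord_nonzero[OF P] eventually_in_C
  proof eventually_elim
    case (elim Q)
    then have Q: "Q \<in> proj_space n" using C_subset by blast
    show ?case
      using form_dehom[OF form.coord[OF i] Q _ elim(1)] by (auto simp: field_simps)
  qed
  then show ?case unfolding regular_at_def using form.coord[OF i] form.coord[OF P(2)] by blast
qed auto

text \<open>
  Passing from forms to polynomials in affine coordinates frees numerator and denominator from the
  degree condition, which makes ideal-theoretic arguments in the polynomial ring possible.
\<close>

lemma germ_quotient:
  assumes P: "P \<in> C" "j \<le> n" "coord_vec P j \<noteq> 0" and f: "reg P f"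
  shows "\<exists>A\<in>polyfun (Suc n). \<exists>B\<in>polyfun (Suc n). B (dehom j P) \<noteq> 0 \<and>
    (\<forall>\<^sub>F Q in near P. f Q = A (dehom j Q) / B (dehom j Q))"
proof -
  obtain d F G where F: "form n d F" "form n d G"
    "\<forall>\<^sub>F Q in near P. \<forall>v\<in>Q. G v \<noteq> 0 \<and> f Q = F v / G v"
    using f unfolding regular_at_def by blast
  have ev: "\<forall>\<^sub>F Q in near P. G (dehom j Q) \<noteq> 0 \<and> f Q = F (dehom j Q) / G (dehom j Q)"
    using F(3) eventually_coord_nonzero[OF P] eventually_in_C
  proof eventually_elim
    case (elim Q)
    then have Q: "Q \<in> proj_space n" using C_subset by blast
    note r = coord_vec_in[OF Q]
    show ?case
      using elim(1)[rule_format, OF r] form_dehom[OF F(1) Q r elim(2)] form_dehom[OF F(2) Q r elim(2)]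
      by auto
  qed
  then have "G (dehom j P) \<noteq> 0" using near_self[OF P(1) ev] by simp
  moreover have "\<forall>\<^sub>F Q in near P. f Q = F (dehom j Q) / G (dehom j Q)"
    using ev by (rule eventually_mono) simp
  ultimately show ?thesis using form_polyfun[OF F(1)] form_polyfun[OF F(2)] by blast
qed

lemma dehom_inject:
  assumes P: "P \<in> proj_space n" "coord_vec P j \<noteq> 0" and Q: "Q \<in> proj_space n" "coord_vec Q j \<noteq> 0"
    and eq: "\<And>i. i \<le> n \<Longrightarrow> dehom j Q i = dehom j P i"
  shows "Q = P"
proof (rule ppoint_eqI[OF Q(1) P(1)])
  have "dehom j Q = dehom j P"
    using eq coord_vec_beyond[OF P(1)] coord_vec_beyond[OF Q(1)] by (auto simp: fun_eq_iff dehom_def) (metis div_0 not_le)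
  then show "dehom j P \<in> Q" "dehom j P \<in> P"
    using scaled_in[OF Q(1) coord_vec_in[OF Q(1)], of "inverse (coord_vec Q j)"]
      scaled_in[OF P(1) coord_vec_in[OF P(1)], of "inverse (coord_vec P j)"] P Q
    by (auto simp: dehom_def divide_inverse mult.commute)
qed

lemma max_ideal_iff: "P \<in> C \<Longrightarrow> f \<in> max_ideal n C P \<longleftrightarrow> reg P f \<and> f P = 0"
proof
  assume "P \<in> C" "f \<in> max_ideal n C P"
  then show "reg P f \<and> f P = 0" unfolding max_ideal_def using regular_iff by blast
next
  assume P: "P \<in> C" and f: "reg P f \<and> f P = 0"
  then obtain W where W: "zopen n C W" "P \<in> W" "\<forall>Q\<in>W. reg Q f"
    using eventually_reg[of P f] eventually_near[OF P] by blast
  then show "f \<in> max_ideal n C P"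
    unfolding max_ideal_def mem_Collect_eq
    by (intro exI[of _ W] conjI iffD2[OF regular_iff[OF W(1)]]) (use f in auto)
qed

lemma max_ideal_sq_iff:
  assumes P: "P \<in> C"
  shows "f \<in> max_ideal_sq n C P \<longleftrightarrow> (\<exists>(m::nat) a b.
     (\<forall>i<m. a i \<in> max_ideal n C P \<and> b i \<in> max_ideal n C P) \<and>
     (\<forall>\<^sub>F x in near P. f x = (\<Sum>i<m. a i x * b i x)))"
proof
  assume "f \<in> max_ideal_sq n C P"
  then obtain W and m :: nat and a b where "zopen n C W" "P \<in> W"
    "\<forall>i<m. a i \<in> max_ideal n C P \<and> b i \<in> max_ideal n C P" "\<forall>x\<in>W. f x = (\<Sum>i<m. a i x * b i x)"
    unfolding max_ideal_sq_def mem_Collect_eq by (elim exE conjE) (rule that)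
  then show "\<exists>(m::nat) a b. (\<forall>i<m. a i \<in> max_ideal n C P \<and> b i \<in> max_ideal n C P) \<and>
     (\<forall>\<^sub>F x in near P. f x = (\<Sum>i<m. a i x * b i x))"
    by (intro exI[of _ m] exI[of _ a] exI[of _ b] conjI iffD2[OF eventually_near[OF P]] exI[of _ W])
next
  assume "\<exists>(m::nat) a b. (\<forall>i<m. a i \<in> max_ideal n C P \<and> b i \<in> max_ideal n C P) \<and>
     (\<forall>\<^sub>F x in near P. f x = (\<Sum>i<m. a i x * b i x))"
  then obtain m :: nat and a b where *: "\<forall>i<m. a i \<in> max_ideal n C P \<and> b i \<in> max_ideal n C P"
     "\<forall>\<^sub>F x in near P. f x = (\<Sum>i<m. a i x * b i x)" by (elim exE conjE) (rule that)
  from *(2)[unfolded eventually_near[OF P]] obtain W where "zopen n C W" "P \<in> W"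
    "\<forall>x\<in>W. f x = (\<Sum>i<m. a i x * b i x)" by blast
  then show "f \<in> max_ideal_sq n C P"
    unfolding max_ideal_sq_def mem_Collect_eq
    by (intro exI[of _ W] exI[of _ m] exI[of _ a] exI[of _ b] conjI *(1))
qed

end

section \<open>Dimensions of quotients\<close>

lemma indep_mod_empty: "indep_mod W {}"
  by (simp add: indep_mod_def)

text \<open>
  This is how the vanishing of a dimension of $H^1$ is read as an inclusion of cocycles in
  coboundaries, and back.
\<close>

lemma qdim_eq_0_iff:
  fixes V W :: "('x \<Rightarrow> 'k::field) set"
  assumes scale: "\<And>a f. f \<in> W \<Longrightarrow> (\<lambda>x. a * f x) \<in> W"
  shows "qdim V W = 0 \<longleftrightarrow> V \<subseteq> W"
proof
  assume 0: "qdim V W = 0"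
  show "V \<subseteq> W"
  proof (rule ccontr)
    assume "\<not> V \<subseteq> W"
    then obtain f where f: "f \<in> V" "f \<notin> W" by auto
    have "indep_mod W {f}"
      unfolding indep_mod_def
    proof (intro allI impI)
      fix c :: "('x \<Rightarrow> 'k) \<Rightarrow> 'k" assume "(\<lambda>x. \<Sum>b\<in>{f}. c b * b x) \<in> W"
      then have "(\<lambda>x. c f * f x) \<in> W" by simp
      from scale[OF this, of "inverse (c f)"] f(2) have "c f = 0" 
        by (cases "c f = 0") (auto simp: mult.assoc[symmetric])
      then show "\<forall>b\<in>{f}. c b = 0" by simp
    qed
    then have "enat (card {f}) \<in> {enat (card B) | B. finite B \<and> B \<subseteq> V \<and> indep_mod W B}"
      using f by blast
    from Sup_upper[OF this] show False using 0 unfolding qdim_def by (simp add: zero_enat_def)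
  qed
next
  assume V: "V \<subseteq> W"
  have "B = {}" if "finite B" "B \<subseteq> V" "indep_mod W B" for B
  proof (rule ccontr)
    assume "B \<noteq> {}"
    then obtain b where b: "b \<in> B" by auto
    have "(\<lambda>x. \<Sum>b'\<in>B. (if b' = b then 1 else 0) * b' x) = b"
      using that(1) b by (auto simp: if_distrib[of "\<lambda>c. c * _"] cong: if_cong)
    then have "(\<lambda>x. \<Sum>b'\<in>B. (if b' = b then 1 else 0) * b' x) \<in> W" using b V that(2) by auto
    then have "\<forall>b'\<in>B. (if b' = b then 1 else 0 :: 'k) = 0"
      using that(3) unfolding indep_mod_def by (elim allE[of _ "\<lambda>b'. if b' = b then 1 else 0"]) simp
    then show False using b by auto
  qed
  then have "enat (card B) = 0" if "finite B" "B \<subseteq> V" "indep_mod W B" for B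
    using that by (simp add: zero_enat_def)
  then have "{enat (card B) | B. finite B \<and> B \<subseteq> V \<and> indep_mod W B} \<subseteq> {0}"
    by blast
  then have "qdim V W \<le> 0" unfolding qdim_def by (intro Sup_least) auto
  then show "qdim V W = 0" by simp
qed

text \<open>
  A finite supremum of cardinalities is attained, and an independent family of maximal size spans.
\<close>

lemma qdim_basis:
  fixes V W :: "('x \<Rightarrow> 'k::field) set"
  assumes zero: "(\<lambda>_. 0) \<in> W" and scale: "\<And>a f. f \<in> W \<Longrightarrow> (\<lambda>x. a * f x) \<in> W"
    and d: "qdim V W = enat d"
  obtains B where "finite B" "card B = d" "B \<subseteq> V"
    "\<And>f. f \<in> V \<Longrightarrow> \<exists>c. (\<lambda>x. f x - (\<Sum>b\<in>B. c b * b x)) \<in> W"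
proof -
  let ?S = "{enat (card B) | B. finite B \<and> B \<subseteq> V \<and> indep_mod W B}"
  have ne: "?S \<noteq> {}" using indep_mod_empty[of W] by blast
  have Sup: "Sup ?S = enat d" using d unfolding qdim_def .
  have fin: "finite ?S"
  proof (rule ccontr)
    assume "infinite ?S"
    then have "Sup ?S = \<infinity>" by (simp only: Sup_enat_def ne if_False)
    then show False using Sup by simp
  qed
  have "Max ?S = enat d" using Sup by (simp only: Sup_enat_def ne fin if_False if_True)
  then have "enat d \<in> ?S" using Max_in[OF fin ne] by simp
  then obtain B where B: "finite B" "B \<subseteq> V" "indep_mod W B" "card B = d" by auto
  have "\<exists>c. (\<lambda>x. f x - (\<Sum>b\<in>B. c b * b x)) \<in> W" if f: "f \<in> V" for f
  proof (cases "f \<in> B")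
    case True
    have "(\<lambda>x. f x - (\<Sum>b\<in>B. (if b = f then 1 else 0) * b x)) = (\<lambda>_. 0)"
      using B(1) True by (auto simp: if_distrib[of "\<lambda>c. c * _"] cong: if_cong)
    with zero have "(\<lambda>x. f x - (\<Sum>b\<in>B. (if b = f then 1 else 0) * b x)) \<in> W" by (simp only:)
    then show ?thesis by (intro exI[of _ "\<lambda>b. if b = f then 1 else 0"])
  next
    case False
    have "\<not> indep_mod W (insert f B)"
    proof
      assume "indep_mod W (insert f B)"
      then have "enat (card (insert f B)) \<in> ?S" using B f by blast
      from Sup_upper[OF this] show False using d False B unfolding qdim_def by simp
    qed
    then obtain c where c: "(\<lambda>x. \<Sum>b\<in>insert f B. c b * b x) \<in> W" "\<exists>b\<in>insert f B. c b \<noteq> 0"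
      unfolding indep_mod_def by blast
    have sum: "(\<Sum>b\<in>insert f B. c b * b x) = c f * f x + (\<Sum>b\<in>B. c b * b x)" for x
      using B(1) False by simp
    have cf: "c f \<noteq> 0"
    proof
      assume 0: "c f = 0"
      then have "(\<lambda>x. \<Sum>b\<in>B. c b * b x) \<in> W" using c(1) by (simp add: sum)
      then have "\<forall>b\<in>B. c b = 0" using B(3) unfolding indep_mod_def by blast
      then show False using c(2) 0 by auto
    qed
    have "(\<lambda>x. inverse (c f) * (c f * f x + (\<Sum>b\<in>B. c b * b x))) \<in> W"
      using scale[OF c(1)] by (simp only: sum)
    moreover have "inverse (c f) * (c f * f x + (\<Sum>b\<in>B. c b * b x)) =
        f x - (\<Sum>b\<in>B. (- (c b / c f)) * b x)" for x
      using cf by (simp add: distrib_left sum_distrib_left sum_negf divide_inverse mult_ac)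
    ultimately show ?thesis by (intro exI[of _ "\<lambda>b. - (c b / c f)"]) simp
  qed
  then show ?thesis using that B by blast
qed


section \<open>Local parameters and orders of vanishing\<close>

context projective_set
begin

text \<open>
  A polynomial vanishing at a point lies in the ideal generated by the differences of coordinates.
  This makes the maximal ideal of every local ring finitely generated.
\<close>

lemma polyfun_taylor:
  assumes P: "P \<in> C" "j \<le> n" "coord_vec P j \<noteq> 0" and A: "A \<in> polyfun (Suc n)"
  shows "\<exists>u. (\<forall>i\<le>n. reg P (u i)) \<and>
    (\<forall>Q. A (dehom j Q) - A (dehom j P) = (\<Sum>i\<le>n. u i Q * (dehom j Q i - dehom j P i)))"
  using A
proof induction
  case (const c)
  then show ?case by (intro exI[of _ "\<lambda>_ _. 0"]) auto
next
  case (coord i)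
  then show ?case
    by (intro exI[of _ "\<lambda>l _. if l = i then 1 else 0"]) (auto simp: if_distrib[of "\<lambda>c. c * _"] cong: if_cong)
next
  case (add A B)
  then obtain u v where *: "\<forall>i\<le>n. reg P (u i)" "\<forall>i\<le>n. reg P (v i)"
    "\<forall>Q. A (dehom j Q) - A (dehom j P) = (\<Sum>i\<le>n. u i Q * (dehom j Q i - dehom j P i))"
    "\<forall>Q. B (dehom j Q) - B (dehom j P) = (\<Sum>i\<le>n. v i Q * (dehom j Q i - dehom j P i))" by blast
  have "(A + B) (dehom j Q) - (A + B) (dehom j P) = (\<Sum>i\<le>n. (u i Q + v i Q) * (dehom j Q i - dehom j P i))" for Q
  proof -
    have "(A + B) (dehom j Q) - (A + B) (dehom j P) =
      (A (dehom j Q) - A (dehom j P)) + (B (dehom j Q) - B (dehom j P))" by simp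
    also have "\<dots> = (\<Sum>i\<le>n. (u i Q + v i Q) * (dehom j Q i - dehom j P i))"
      by (simp only: * distrib_right sum.distrib)
    finally show ?thesis .
  qed
  then show ?case using *(1,2) by (intro exI[of _ "\<lambda>i Q. u i Q + v i Q"]) auto
next
  case (mult A B)
  then obtain u v where *: "\<forall>i\<le>n. reg P (u i)" "\<forall>i\<le>n. reg P (v i)"
    "\<forall>Q. A (dehom j Q) - A (dehom j P) = (\<Sum>i\<le>n. u i Q * (dehom j Q i - dehom j P i))"
    "\<forall>Q. B (dehom j Q) - B (dehom j P) = (\<Sum>i\<le>n. v i Q * (dehom j Q i - dehom j P i))" by blast
  have "(A * B) (dehom j Q) - (A * B) (dehom j P) =
    (\<Sum>i\<le>n. (A (dehom j Q) * v i Q + B (dehom j P) * u i Q) * (dehom j Q i - dehom j P i))" for Q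
  proof -
    have "(A * B) (dehom j Q) - (A * B) (dehom j P) =
      A (dehom j Q) * (B (dehom j Q) - B (dehom j P)) + B (dehom j P) * (A (dehom j Q) - A (dehom j P))"
      by (simp add: algebra_simps)
    also have "\<dots> = (\<Sum>i\<le>n. (A (dehom j Q) * v i Q + B (dehom j P) * u i Q) * (dehom j Q i - dehom j P i))"
      by (simp only: * distrib_right sum.distrib sum_distrib_left mult.assoc)
    finally show ?thesis .
  qed
  then show ?case using *(1,2) reg_dehom[OF P mult.hyps(1)]
    by (intro exI[of _ "\<lambda>i Q. A (dehom j Q) * v i Q + B (dehom j P) * u i Q"] conjI allI impI
        reg_add reg_mult reg_const) auto
qed

lemma max_ideal_generated:
  assumes P: "P \<in> C" "j \<le> n" "coord_vec P j \<noteq> 0" and f: "f \<in> max_ideal n C P"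
  shows "\<exists>u. (\<forall>i\<le>n. reg P (u i)) \<and>
    (\<forall>\<^sub>F Q in near P. f Q = (\<Sum>i\<le>n. u i Q * (dehom j Q i - dehom j P i)))"
proof -
  have f': "reg P f" "f P = 0" using f max_ideal_iff[OF P(1)] by auto
  obtain A B where AB: "A \<in> polyfun (Suc n)" "B \<in> polyfun (Suc n)" "B (dehom j P) \<noteq> 0"
    "\<forall>\<^sub>F Q in near P. f Q = A (dehom j Q) / B (dehom j Q)"
    using germ_quotient[OF P f'(1)] by blast
  have A0: "A (dehom j P) = 0" using near_self[OF P(1) AB(4)] AB(3) f'(2) by simp
  obtain u where u: "\<forall>i\<le>n. reg P (u i)"
    "\<And>Q. A (dehom j Q) - A (dehom j P) = (\<Sum>i\<le>n. u i Q * (dehom j Q i - dehom j P i))"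
    using polyfun_taylor[OF P AB(1)] by blast
  have "\<forall>\<^sub>F Q in near P. f Q = (\<Sum>i\<le>n. (u i Q / B (dehom j Q)) * (dehom j Q i - dehom j P i))"
    using AB(4) by (rule eventually_mono) (use u(2) A0 in \<open>simp add: sum_divide_distrib\<close>)
  moreover have "\<forall>i\<le>n. reg P (\<lambda>Q. u i Q / B (dehom j Q))"
    using u(1) reg_dehom[OF P AB(2)] AB(3) by (auto intro: reg_divide[OF P(1)])
  ultimately show ?thesis by (intro exI[of _ "\<lambda>i Q. u i Q / B (dehom j Q)"]) blast
qed

lemma max_ideal_sq_generated:
  assumes P: "P \<in> C" "j \<le> n" "coord_vec P j \<noteq> 0" and f: "f \<in> max_ideal_sq n C P"
  shows "\<exists>u. (\<forall>i\<le>n. reg P (u i) \<and> u i P = 0) \<and>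
    (\<forall>\<^sub>F Q in near P. f Q = (\<Sum>i\<le>n. u i Q * (dehom j Q i - dehom j P i)))"
proof -
  obtain m :: nat and a b where *: "\<forall>k<m. a k \<in> max_ideal n C P \<and> b k \<in> max_ideal n C P"
     "\<forall>\<^sub>F x in near P. f x = (\<Sum>k<m. a k x * b k x)"
    using f unfolding max_ideal_sq_iff[OF P(1)] by (elim exE conjE) (rule that)
  have "\<forall>k\<in>{..<m}. \<exists>u. (\<forall>i\<le>n. reg P (u i)) \<and>
    (\<forall>\<^sub>F Q in near P. b k Q = (\<Sum>i\<le>n. u i Q * (dehom j Q i - dehom j P i)))"
    using max_ideal_generated[OF P] * by blast
  from bchoice[OF this] obtain u where u: "\<forall>k<m. (\<forall>i\<le>n. reg P (u k i)) \<and>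
    (\<forall>\<^sub>F Q in near P. b k Q = (\<Sum>i\<le>n. u k i Q * (dehom j Q i - dehom j P i)))" by auto
  have "\<forall>\<^sub>F Q in near P. \<forall>k\<in>{..<m}. b k Q = (\<Sum>i\<le>n. u k i Q * (dehom j Q i - dehom j P i))"
    using u by (intro eventually_ball_finite) auto
  with *(2) have "\<forall>\<^sub>F Q in near P. f Q = (\<Sum>i\<le>n. (\<Sum>k<m. a k Q * u k i Q) * (dehom j Q i - dehom j P i))"
  proof eventually_elim
    case (elim Q)
    have "f Q = (\<Sum>k<m. \<Sum>i\<le>n. a k Q * u k i Q * (dehom j Q i - dehom j P i))"
      using elim by (simp add: sum_distrib_left mult.assoc)
    also have "\<dots> = (\<Sum>i\<le>n. \<Sum>k<m. a k Q * u k i Q * (dehom j Q i - dehom j P i))" by (rule sum.swap)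
    finally show ?case by (simp add: sum_distrib_right)
  qed
  moreover have "\<forall>i\<le>n. reg P (\<lambda>Q. \<Sum>k<m. a k Q * u k i Q) \<and> (\<Sum>k<m. a k P * u k i P) = 0"
    using * u max_ideal_iff[OF P(1)] by (auto intro!: reg_sum reg_mult sum.neutral)
  ultimately show ?thesis by (intro exI[of _ "\<lambda>i Q. \<Sum>k<m. a k Q * u k i Q"]) blast
qed

text \<open>
  Nakayama's lemma: if generators \<open>z i\<close> are congruent to multiples of \<open>t\<close> modulo the maximal ideal
  times the module they generate, then they are multiples of \<open>t\<close>.  The linear system is
  solved by eliminating one generator at a time, because the coefficient \<open>1 - u k\<close> of \<open>z k\<close> is a unit.
\<close>

lemma Nakayama_elimination:
  assumes P: "P \<in> C" and "finite I"
    and "\<And>i. i \<in> I \<Longrightarrow> \<exists>c u. reg P c \<and> (\<forall>l\<in>I. reg P (u l) \<and> u l P = 0) \<and>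
      (\<forall>\<^sub>F Q in near P. z i Q = c Q * t Q + (\<Sum>l\<in>I. u l Q * z l Q))"
    and "i \<in> I"
  shows "\<exists>c. reg P c \<and> (\<forall>\<^sub>F Q in near P. z i Q = c Q * t Q)"
  using assms(2-4)
proof (induction I arbitrary: i rule: finite_induct)
  case (insert k I)
  obtain c u where u: "reg P c" "\<forall>l\<in>insert k I. reg P (u l) \<and> u l P = 0"
      "\<forall>\<^sub>F Q in near P. z k Q = c Q * t Q + (\<Sum>l\<in>insert k I. u l Q * z l Q)"
    using insert.prems(1)[of k] by blast
  have den: "reg P (\<lambda>Q. 1 - u k Q)" "1 - u k P \<noteq> 0" using u(2) by auto
  define c' where "c' Q = c Q / (1 - u k Q)" for Q
  define v where "v l Q = u l Q / (1 - u k Q)" for l Q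
  have c': "reg P c'" unfolding c'_def using reg_divide[OF P u(1) den] .
  have v: "\<forall>l\<in>I. reg P (v l) \<and> v l P = 0" unfolding v_def using reg_divide[OF P _ den] u(2) by auto
  have zk: "\<forall>\<^sub>F Q in near P. z k Q = c' Q * t Q + (\<Sum>l\<in>I. v l Q * z l Q)"
    using u(3) reg_inverse(2)[OF P den]
  proof eventually_elim
    case (elim Q)
    then have "(1 - u k Q) * z k Q = c Q * t Q + (\<Sum>l\<in>I. u l Q * z l Q)"
      using insert.hyps by (simp add: algebra_simps)
    then have "z k Q = (c Q * t Q + (\<Sum>l\<in>I. u l Q * z l Q)) / (1 - u k Q)"
      using elim(2) by (simp add: field_simps)
    then show ?case by (simp add: c'_def v_def add_divide_distrib sum_divide_distrib)
  qed
  have step: "\<exists>c u. reg P c \<and> (\<forall>l\<in>I. reg P (u l) \<and> u l P = 0) \<and>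
      (\<forall>\<^sub>F Q in near P. z i Q = c Q * t Q + (\<Sum>l\<in>I. u l Q * z l Q))" if i: "i \<in> I" for i
  proof -
    obtain d w where w: "reg P d" "\<forall>l\<in>insert k I. reg P (w l) \<and> w l P = 0"
      "\<forall>\<^sub>F Q in near P. z i Q = d Q * t Q + (\<Sum>l\<in>insert k I. w l Q * z l Q)"
      using insert.prems(1)[of i] i by blast
    have "\<forall>\<^sub>F Q in near P. z i Q = (d Q + w k Q * c' Q) * t Q + (\<Sum>l\<in>I. (w l Q + w k Q * v l Q) * z l Q)"
      using w(3) zk
    proof eventually_elim
      case (elim Q)
      have "z i Q = d Q * t Q + w k Q * z k Q + (\<Sum>l\<in>I. w l Q * z l Q)"
        using elim(1) insert.hyps by (simp add: add.assoc)
      also have "\<dots> = d Q * t Q + w k Q * (c' Q * t Q + (\<Sum>l\<in>I. v l Q * z l Q)) + (\<Sum>l\<in>I. w l Q * z l Q)"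
        using elim(2) by simp
      finally show ?case
        by (simp add: distrib_left distrib_right sum.distrib sum_distrib_left mult.assoc add_ac)
    qed
    then show ?thesis using w(1,2) c' v
      by (intro exI[of _ "\<lambda>Q. d Q + w k Q * c' Q"] exI[of _ "\<lambda>l Q. w l Q + w k Q * v l Q"] conjI ballI
          reg_add reg_mult) auto
  qed
  have IH: "\<forall>i\<in>I. \<exists>c. reg P c \<and> (\<forall>\<^sub>F Q in near P. z i Q = c Q * t Q)"
    using insert.IH step by blast
  from bchoice[OF this] obtain e where e: "\<forall>i\<in>I. reg P (e i) \<and> (\<forall>\<^sub>F Q in near P. z i Q = e i Q * t Q)"
    by blast
  have "\<forall>\<^sub>F Q in near P. \<forall>i\<in>I. z i Q = e i Q * t Q"
    using e insert.hyps by (intro eventually_ball_finite) auto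
  with zk have "\<forall>\<^sub>F Q in near P. z k Q = (c' Q + (\<Sum>l\<in>I. v l Q * e l Q)) * t Q"
    by eventually_elim (simp add: distrib_right sum_distrib_right mult.assoc)
  moreover have "reg P (\<lambda>Q. c' Q + (\<Sum>l\<in>I. v l Q * e l Q))"
    using c' v e by (intro reg_add reg_sum reg_mult) auto
  ultimately show ?case using IH insert.prems(2) by blast
qed simp

lemma max_ideal_sq_scale: "P \<in> C \<Longrightarrow> f \<in> max_ideal_sq n C P \<Longrightarrow> (\<lambda>x. a * f x) \<in> max_ideal_sq n C P"
proof -
  assume P: "P \<in> C" and f: "f \<in> max_ideal_sq n C P"
  obtain m :: nat and g h where *: "\<forall>k<m. g k \<in> max_ideal n C P \<and> h k \<in> max_ideal n C P"
     "\<forall>\<^sub>F x in near P. f x = (\<Sum>k<m. g k x * h k x)"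
    using f unfolding max_ideal_sq_iff[OF P] by (elim exE conjE) (rule that)
  have "\<forall>\<^sub>F x in near P. a * f x = (\<Sum>k<m. (a * g k x) * h k x)"
    using *(2) by eventually_elim (simp add: sum_distrib_left mult.assoc)
  moreover have "\<forall>k<m. (\<lambda>x. a * g k x) \<in> max_ideal n C P \<and> h k \<in> max_ideal n C P"
    using *(1) max_ideal_iff[OF P] by auto
  ultimately show ?thesis unfolding max_ideal_sq_iff[OF P]
    by (intro exI[of _ m] exI[of _ "\<lambda>k x. a * g k x"] exI[of _ h] conjI)
qed

lemma max_ideal_sq_zero: "P \<in> C \<Longrightarrow> \<forall>\<^sub>F x in near P. f x = 0 \<Longrightarrow> f \<in> max_ideal_sq n C P"
  unfolding max_ideal_sq_iff by (intro exI[of _ 0]) auto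

end

locale smooth_projective_curve = projective_set +
  assumes closed: "closedin (zariski n) C"
    and irreducible: "irreducible_subset n C"
    and smooth: "P \<in> C \<Longrightarrow> qdim (max_ideal n C P) (max_ideal_sq n C P) = 1"
begin

text \<open>
  At an isolated point every germ in the maximal ideal would be zero, and the cotangent space would
  be zero instead of a line.
\<close>

lemma not_isolated: assumes P: "P \<in> C" shows "\<not> (\<forall>\<^sub>F Q in near P. Q = P)"
proof
  assume ev: "\<forall>\<^sub>F Q in near P. Q = P"
  have "max_ideal n C P \<subseteq> max_ideal_sq n C P"
  proof
    fix f assume "f \<in> max_ideal n C P"
    then have "\<forall>\<^sub>F Q in near P. f Q = 0" using ev max_ideal_iff[OF P] by (auto elim: eventually_mono)
    then show "f \<in> max_ideal_sq n C P" by (rule max_ideal_sq_zero[OF P])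
  qed
  then have "qdim (max_ideal n C P) (max_ideal_sq n C P) = 0"
    using qdim_eq_0_iff[OF max_ideal_sq_scale[OF P]] by blast
  then show False using smooth[OF P] by simp
qed

text \<open>
  Since points are not isolated, a regular function is determined by its values near but off \<open>P\<close>.
  This allows cancellation of a local parameter.
\<close>

lemma reg_eq_off_point:
  assumes P: "P \<in> C" "reg P f" "reg P g" "\<forall>\<^sub>F Q in near P. Q \<noteq> P \<longrightarrow> f Q = g Q"
  shows "\<forall>\<^sub>F Q in near P. f Q = g Q"
proof -
  have "f P - g P = 0"
  proof (rule ccontr)
    assume "f P - g P \<noteq> 0"
    then have "\<forall>\<^sub>F Q in near P. f Q - g Q \<noteq> 0" using P by (intro reg_inverse(2)) auto
    with P(4) have "\<forall>\<^sub>F Q in near P. Q = P" by eventually_elim auto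
    then show False using not_isolated[OF P(1)] by simp
  qed
  then show ?thesis using P(4) by (auto elim: eventually_mono)
qed

text \<open>
  A germ \<open>t\<close> spanning the cotangent line generates the maximal ideal by Nakayama's lemma.  As it then
  divides all differences of affine coordinates, it has no zero near \<open>P\<close> other than \<open>P\<close>.
\<close>

lemma ex_local_param: assumes P: "P \<in> C" shows "\<exists>V t. local_param n C P V t"
proof -
  obtain j where j: "j \<le> n" "coord_vec P j \<noteq> 0" using ex_nonzero_coord[OF P] by blast
  define z where "z i Q = dehom j Q i - dehom j P i" for i Q
  have zm: "z i \<in> max_ideal n C P" if "i \<le> n" for i
    unfolding max_ideal_iff[OF P] z_def using reg_dehom[OF P j polyfun.coord[of i]] that by auto
  have 0: "(\<lambda>_. 0) \<in> max_ideal_sq n C P" by (rule max_ideal_sq_zero[OF P]) simp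
  have q: "qdim (max_ideal n C P) (max_ideal_sq n C P) = enat 1"
    using smooth[OF P] by (simp only: one_enat_def)
  obtain B where B: "finite B" "card B = 1" "B \<subseteq> max_ideal n C P"
    "\<And>f. f \<in> max_ideal n C P \<Longrightarrow> \<exists>c. (\<lambda>x. f x - (\<Sum>b\<in>B. c b * b x)) \<in> max_ideal_sq n C P"
    by (rule qdim_basis[OF 0 _ q]) (erule max_ideal_sq_scale[OF P], rule that)
  obtain t where t: "B = {t}" using B(2) card_1_singletonE by blast
  have tm: "reg P t" "t P = 0" using B(3) t max_ideal_iff[OF P] by auto
  have "\<exists>c. reg P c \<and> (\<forall>\<^sub>F Q in near P. z i Q = c Q * t Q)" if "i \<in> {..n}" for i
  proof (rule Nakayama_elimination[OF P, of "{..n}"])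
    fix i assume i: "i \<in> {..n}"
    obtain c where c: "(\<lambda>x. z i x - c t * t x) \<in> max_ideal_sq n C P"
      using B(4)[OF zm[of i]] i t by auto
    obtain u where u: "\<forall>i\<le>n. reg P (u i) \<and> u i P = 0"
      "\<forall>\<^sub>F Q in near P. z i Q - c t * t Q = (\<Sum>i\<le>n. u i Q * z i Q)"
      using max_ideal_sq_generated[OF P j c] unfolding z_def[symmetric] by blast
    have "\<forall>\<^sub>F Q in near P. z i Q = c t * t Q + (\<Sum>i\<le>n. u i Q * z i Q)"
      using u(2) by eventually_elim (simp add: algebra_simps)
    then show "\<exists>c u. reg P c \<and> (\<forall>l\<in>{..n}. reg P (u l) \<and> u l P = 0) \<and>
      (\<forall>\<^sub>F Q in near P. z i Q = c Q * t Q + (\<Sum>l\<in>{..n}. u l Q * z l Q))"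
      using u(1) by (intro exI[of _ "\<lambda>_. c t"] exI[of _ u]) auto
  qed (use that in auto)
  then have "\<forall>i\<in>{..n}. \<exists>c. reg P c \<and> (\<forall>\<^sub>F Q in near P. z i Q = c Q * t Q)" by blast
  from bchoice[OF this] obtain d where d: "\<forall>i\<in>{..n}. reg P (d i) \<and> (\<forall>\<^sub>F Q in near P. z i Q = d i Q * t Q)"
    by blast
  have zd: "\<forall>\<^sub>F Q in near P. \<forall>i\<in>{..n}. z i Q = d i Q * t Q"
    using d by (intro eventually_ball_finite) auto
  have "\<forall>\<^sub>F Q in near P. reg Q t \<and> (t Q = 0 \<longleftrightarrow> Q = P)"
    using zd eventually_reg[OF P tm(1)] eventually_coord_nonzero[OF P j] eventually_in_C
  proof eventually_elim
    case (elim Q)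
    have "Q = P" if "t Q = 0"
    proof (rule dehom_inject)
      show "P \<in> proj_space n" "Q \<in> proj_space n" using P elim C_subset by auto
      show "coord_vec P j \<noteq> 0" "coord_vec Q j \<noteq> 0" using j elim by auto
      show "dehom j Q i = dehom j P i" if "i \<le> n" for i
        using elim(1) \<open>t Q = 0\<close> that by (auto simp: z_def)
    qed
    then show ?case using elim tm by auto
  qed
  then obtain V where V: "zopen n C V" "P \<in> V" "\<forall>Q\<in>V. reg Q t \<and> (t Q = 0 \<longleftrightarrow> Q = P)"
    using eventually_near[OF P] by auto
  have "local_param n C P V t"
    unfolding local_param_def
  proof (intro conjI ballI V(1,2))
    show "regular n V t" using V(3) regular_iff[OF V(1)] by blast
    show "t x = 0 \<longleftrightarrow> x = P" if "x \<in> V" for x using V that by blast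
    fix f assume "f \<in> max_ideal n C P"
    from max_ideal_generated[OF P j this] obtain u where u: "\<forall>i\<le>n. reg P (u i)"
      "\<forall>\<^sub>F Q in near P. f Q = (\<Sum>i\<le>n. u i Q * z i Q)" unfolding z_def[symmetric] by blast
    define w where "w Q = (\<Sum>i\<le>n. u i Q * d i Q)" for Q
    have w: "reg P w" unfolding w_def using u d by (intro reg_sum reg_mult) auto
    have "\<forall>\<^sub>F Q in near P. reg Q w \<and> f Q = t Q * w Q"
      using u(2) zd eventually_reg[OF P w]
      by eventually_elim (simp add: w_def sum_distrib_left mult_ac)
    then obtain W where W: "zopen n C W" "P \<in> W" "\<forall>Q\<in>W. reg Q w \<and> f Q = t Q * w Q"
      using eventually_near[OF P] by auto
    then show "\<exists>W u. zopen n C W \<and> P \<in> W \<and> regular n W u \<and> (\<forall>x\<in>W. f x = t x * u x)"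
      using regular_iff[OF W(1)] by (intro exI[of _ W] exI[of _ w]) auto
  qed
  then show ?thesis by blast
qed

lemma local_paramD:
  assumes "local_param n C P V t"
  shows "P \<in> C" "reg P t" "t P = 0" "\<forall>\<^sub>F Q in near P. t Q = 0 \<longleftrightarrow> Q = P"
    "reg P f \<Longrightarrow> f P = 0 \<Longrightarrow> \<exists>u. reg P u \<and> (\<forall>\<^sub>F Q in near P. f Q = t Q * u Q)"
    "zopen n C V" "P \<in> V" "x \<in> V \<Longrightarrow> reg x t" "x \<in> V \<Longrightarrow> t x = 0 \<longleftrightarrow> x = P"
proof -
  note * = assms[unfolded local_param_def]
  show V: "zopen n C V" "P \<in> V" using * by auto
  show P: "P \<in> C" using zopen_subset[OF V(1)] V(2) by blast
  have reg: "\<forall>x\<in>V. reg x t" using * unfolding regular_iff[OF V(1)] by blast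
  then show "x \<in> V \<Longrightarrow> reg x t" by blast
  show "reg P t" using reg V(2) by blast
  have zero: "\<forall>x\<in>V. t x = 0 \<longleftrightarrow> x = P" using * by blast
  then show "x \<in> V \<Longrightarrow> t x = 0 \<longleftrightarrow> x = P" by blast
  show "t P = 0" using zero V(2) by blast
  show "\<forall>\<^sub>F Q in near P. t Q = 0 \<longleftrightarrow> Q = P"
    unfolding eventually_near[OF P] using zero V by blast
  show "\<exists>u. reg P u \<and> (\<forall>\<^sub>F Q in near P. f Q = t Q * u Q)" if "reg P f" "f P = 0"
  proof -
    have "f \<in> max_ideal n C P" using that max_ideal_iff[OF P] by blast
    then have "\<exists>W u. zopen n C W \<and> P \<in> W \<and> regular n W u \<and> (\<forall>x\<in>W. f x = t x * u x)"
      using * by blast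
    then obtain W u where W: "zopen n C W" "P \<in> W" "regular n W u" "\<forall>x\<in>W. f x = t x * u x"
      by (elim exE conjE) (rule that)
    then have "reg P u" using regular_iff[OF W(1)] by blast
    moreover have "\<forall>\<^sub>F Q in near P. f Q = t Q * u Q" unfolding eventually_near[OF P] using W by blast
    ultimately show ?thesis by blast
  qed
qed

text \<open>
  If \<open>f\<close> could be divided by \<open>t\<close> indefinitely, the successive quotients \<open>g m\<close> would have numerators
  \<open>A m\<close> in a Noetherian ring.  Some \<open>A N\<close> is then a combination of its predecessors, all of which are
  multiples of \<open>t * g N\<close>.  So \<open>g N = w * t * g N\<close> up to a unit, whence \<open>g N\<close> and \<open>f\<close> vanish near \<open>P\<close>.
\<close>

lemma order_exists:
  assumes t: "local_param n C P V t" and f: "reg P f" "\<not> (\<forall>\<^sub>F Q in near P. f Q = 0)"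
  shows "\<exists>m u. reg P u \<and> u P \<noteq> 0 \<and> (\<forall>\<^sub>F Q in near P. f Q = t Q ^ m * u Q)"
proof (rule ccontr)
  assume no: "\<not> ?thesis"
  note P = local_paramD(1)[OF t] and tP = local_paramD(2)[OF t]
  obtain j where j: "j \<le> n" "coord_vec P j \<noteq> 0" using ex_nonzero_coord[OF P] by blast
  have "\<exists>g. \<forall>m. (reg P (g m) \<and> (\<forall>\<^sub>F Q in near P. f Q = t Q ^ m * g m Q)) \<and>
      (\<forall>\<^sub>F Q in near P. g m Q = t Q * g (Suc m) Q)"
  proof (rule dependent_nat_choice)
    show "\<exists>x. reg P x \<and> (\<forall>\<^sub>F Q in near P. f Q = t Q ^ 0 * x Q)" using f by auto
    fix h m assume h: "reg P h \<and> (\<forall>\<^sub>F Q in near P. f Q = t Q ^ m * h Q)"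
    then have "h P = 0" using no by blast
    then obtain u where u: "reg P u" "\<forall>\<^sub>F Q in near P. h Q = t Q * u Q"
      using local_paramD(5)[OF t] h by blast
    have "\<forall>\<^sub>F Q in near P. f Q = t Q ^ Suc m * u Q"
      using conjunct2[OF h] u(2) by eventually_elim simp
    then show "\<exists>y. (reg P y \<and> (\<forall>\<^sub>F Q in near P. f Q = t Q ^ Suc m * y Q)) \<and>
       (\<forall>\<^sub>F Q in near P. h Q = t Q * y Q)" using u by blast
  qed
  then obtain g where g: "\<And>m. reg P (g m)" "\<And>m. \<forall>\<^sub>F Q in near P. f Q = t Q ^ m * g m Q"
    "\<And>m. \<forall>\<^sub>F Q in near P. g m Q = t Q * g (Suc m) Q" by blast
  have gk: "\<forall>\<^sub>F Q in near P. g i Q = t Q ^ k * g (i + k) Q" for i k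
  proof (induction k)
    case (Suc k)
    show ?case using Suc g(3)[of "i + k"] by eventually_elim simp
  qed simp
  have "\<forall>m. \<exists>A B. A \<in> polyfun (Suc n) \<and> B \<in> polyfun (Suc n) \<and> B (dehom j P) \<noteq> 0 \<and>
    (\<forall>\<^sub>F Q in near P. g m Q = A (dehom j Q) / B (dehom j Q))"
    using germ_quotient[OF P j g(1)] by blast
  from choice[OF this] obtain A where "\<forall>m. \<exists>B. A m \<in> polyfun (Suc n) \<and> B \<in> polyfun (Suc n) \<and>
    B (dehom j P) \<noteq> 0 \<and> (\<forall>\<^sub>F Q in near P. g m Q = A m (dehom j Q) / B (dehom j Q))" by (rule exE)
  from choice[OF this] obtain B where AB: "\<And>m. A m \<in> polyfun (Suc n)" "\<And>m. B m \<in> polyfun (Suc n)"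
    "\<And>m. B m (dehom j P) \<noteq> 0" "\<And>m. \<forall>\<^sub>F Q in near P. g m Q = A m (dehom j Q) / B m (dehom j Q)" by blast
  have Ag: "\<forall>\<^sub>F Q in near P. A m (dehom j Q) = B m (dehom j Q) * g m Q" for m
    using AB(4)[of m] reg_inverse(2)[OF P reg_dehom[OF P j AB(2)[of m]] AB(3)] by eventually_elim simp
  obtain N where N: "A N \<in> ideal_span (polyfun (Suc n)) (A ` {..<N})"
    using noetherian_polyfun[of "Suc n"] AB(1) unfolding noetherian_def by blast
  have "\<exists>w. reg P w \<and> (\<forall>\<^sub>F Q in near P. q (dehom j Q) = w Q * t Q * g N Q)"
    if "q \<in> ideal_span (polyfun (Suc n)) (A ` {..<N})" for q
    using that
  proof induction
    case zero
    show ?case by (intro exI[of _ "\<lambda>_. 0"]) auto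
  next
    case (step q a s)
    then obtain w i where w: "reg P w" "\<forall>\<^sub>F Q in near P. q (dehom j Q) = w Q * t Q * g N Q"
      and i: "i < N" "s = A i" by auto
    obtain k where k: "N = i + Suc k" using i(1) less_iff_Suc_add by auto
    have "\<forall>\<^sub>F Q in near P. (q + a * s) (dehom j Q) =
        (w Q + a (dehom j Q) * B i (dehom j Q) * t Q ^ k) * t Q * g N Q"
      using w(2) Ag[of i] gk[of i "Suc k"]
    proof eventually_elim
      case (elim Q)
      then show ?case by (simp add: i k algebra_simps)
    qed
    moreover have "reg P (\<lambda>Q. w Q + a (dehom j Q) * B i (dehom j Q) * t Q ^ k)"
      using w(1) tP reg_dehom[OF P j step.hyps(2)] reg_dehom[OF P j AB(2)[of i]]
      by (intro reg_add reg_mult reg_power)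
    ultimately show ?case by blast
  qed
  from this[OF N] obtain w where w: "reg P w" "\<forall>\<^sub>F Q in near P. A N (dehom j Q) = w Q * t Q * g N Q"
    by blast
  have "\<forall>\<^sub>F Q in near P. B N (dehom j Q) - w Q * t Q \<noteq> 0"
    using w(1) tP reg_dehom[OF P j AB(2)] AB(3) local_paramD(3)[OF t] by (intro reg_inverse(2)[OF P]) auto
  with w(2) Ag[of N] g(2)[of N] have "\<forall>\<^sub>F Q in near P. f Q = 0"
    by eventually_elim auto
  then show False using f(2) by simp
qed

text \<open>
  Two local parameters at the same point may occur here, since the definition of the order of
  vanishing leaves the local parameter free.
\<close>

lemma order_le:
  assumes t: "local_param n C P V t" and t': "local_param n C P V' t'"
    and u: "reg P u" "u P \<noteq> 0" "\<forall>\<^sub>F Q in near P. f Q = t Q ^ m * u Q"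
    and u': "reg P u'" "\<forall>\<^sub>F Q in near P. f Q = t' Q ^ m' * u' Q"
  shows "m' \<le> m"
proof (rule ccontr)
  assume "\<not> m' \<le> m"
  then obtain k where k: "m' = m + Suc k" using less_iff_Suc_add[of m m'] by auto
  note P = local_paramD(1)[OF t] and tP = local_paramD(2,3)[OF t]
  obtain v where v: "reg P v" "\<forall>\<^sub>F Q in near P. t' Q = t Q * v Q"
    using local_paramD(5)[OF t local_paramD(2,3)[OF t']] by blast
  have "\<forall>\<^sub>F Q in near P. Q \<noteq> P \<longrightarrow> u Q = t Q ^ Suc k * v Q ^ m' * u' Q"
    using u(3) u'(2) v(2) local_paramD(4)[OF t]
  proof eventually_elim
    case (elim Q)
    have "t' Q ^ m' = t Q ^ m * (t Q ^ Suc k * v Q ^ m')"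
      unfolding elim(3) power_mult_distrib by (simp only: k power_add mult.assoc)
    then have "t Q ^ m * u Q = t Q ^ m * (t Q ^ Suc k * v Q ^ m' * u' Q)"
      using elim(1,2) by (simp only: mult.assoc)
    moreover have "t Q ^ m \<noteq> 0" if "Q \<noteq> P" using elim(4) that by simp
    ultimately show ?case using mult_left_cancel by blast
  qed
  then have "\<forall>\<^sub>F Q in near P. u Q = t Q ^ Suc k * v Q ^ m' * u' Q"
    by (intro reg_eq_off_point[OF P u(1)] reg_mult reg_power tP(1) v(1) u'(1))
  from near_self[OF P this] show False using u(2) tP by simp
qed

lemma vanishing_order_factor:
  assumes t: "local_param n C P V t" and f: "reg P f" "\<not> (\<forall>\<^sub>F Q in near P. f Q = 0)"
  obtains u where "reg P u" "u P \<noteq> 0" "\<forall>\<^sub>F Q in near P. f Q = t Q ^ vanishing_order n C P f * u Q"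
proof -
  note P = local_paramD(1)[OF t]
  obtain m u where u: "reg P u" "u P \<noteq> 0" "\<forall>\<^sub>F Q in near P. f Q = t Q ^ m * u Q"
    using order_exists[OF t f] by blast
  have "vanishing_order n C P f = m"
    unfolding vanishing_order_def
  proof (rule the_equality)
    have "\<forall>\<^sub>F Q in near P. reg Q u \<and> f Q = t Q ^ m * u Q"
      using eventually_reg[OF P u(1)] u(3) by eventually_elim simp
    then obtain W where W: "zopen n C W" "P \<in> W" "\<forall>Q\<in>W. reg Q u \<and> f Q = t Q ^ m * u Q"
      unfolding eventually_near[OF P] by blast
    then show "\<exists>V t W u. local_param n C P V t \<and> zopen n C W \<and> P \<in> W \<and> regular n W u \<and>
        u P \<noteq> 0 \<and> (\<forall>x\<in>W. f x = t x ^ m * u x)"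
      using regular_iff[OF W(1)] t u(2)
      by (intro exI[of _ V] exI[of _ t] exI[of _ W] exI[of _ u]) auto
  next
    fix m' assume "\<exists>V t W u. local_param n C P V t \<and> zopen n C W \<and> P \<in> W \<and> regular n W u \<and>
        u P \<noteq> 0 \<and> (\<forall>x\<in>W. f x = t x ^ m' * u x)"
    then obtain V' t' W u' where *: "local_param n C P V' t'" "zopen n C W" "P \<in> W" "regular n W u'"
        "u' P \<noteq> 0" "\<forall>x\<in>W. f x = t' x ^ m' * u' x" by (elim exE conjE) (rule that)
    have u': "reg P u'" "\<forall>\<^sub>F Q in near P. f Q = t' Q ^ m' * u' Q"
      using *(2-4,6) unfolding regular_iff[OF *(2)] eventually_near[OF P] by blast+
    show "m' = m"
      using order_le[OF t *(1) u u'] order_le[OF *(1) t u'(1) *(5) u'(2) u(1,3)] by simp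
  qed
  then show ?thesis using that u by blast
qed

lemma chosen_param: assumes "P \<in> C"
  shows "local_param n C P (fst (chosen_param n C P)) (snd (chosen_param n C P))"
proof -
  obtain V t where t: "local_param n C P V t" using ex_local_param[OF assms] by (elim exE) (rule that)
  have "case chosen_param n C P of (V, t) \<Rightarrow> local_param n C P V t"
    unfolding chosen_param_def
    by (rule someI[of "\<lambda>p. case p of (V, t) \<Rightarrow> local_param n C P V t" "(V, t)"]) (simp add: t)
  then show ?thesis by (simp add: case_prod_beta)
qed

end

lemma smooth_projective_curve:
  assumes "smooth_curve n C" shows "smooth_projective_curve n C"
proof
  note * = assms[unfolded smooth_curve_def]
  then show "closedin (zariski n) C" "irreducible_subset n C" by blast+
  then show "C \<subseteq> proj_space n" using closedin_subset[of "zariski n" C] unfolding topspace_zariski by blast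
  show "qdim (max_ideal n C P) (max_ideal_sq n C P) = 1" if "P \<in> C" for P using * that by simp
qed

section \<open>Sections of line bundles and their cocycles\<close>

text \<open>
  In the chart at \<open>P\<close>, a section represented by \<open>\<sigma>\<close> is the function \<open>\<lambda>x. trans L P x x * \<sigma> x\<close>.  The
  factor \<open>trans L P x x\<close> is called the weight of \<open>L\<close> at \<open>P\<close>.  Sections near \<open>P\<close> depend on the weight
  only, weights of tensor products are products of weights, and so the sections of two bundles with
  eventually equal weights are literally the same functions.
\<close>

context projective_set
begin

abbreviation sec :: "'k line_bundle \<Rightarrow> 'k ppoint \<Rightarrow> ('k ppoint \<Rightarrow> 'k) \<Rightarrow> bool" where
  "sec L P \<sigma> \<equiv> reg P (\<lambda>x. trans L P x x * \<sigma> x)"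

lemma line_bundleD:
  assumes "is_line_bundle n C L"
  shows "i \<in> C \<Longrightarrow> zopen n C (triv L i)" "i \<in> C \<Longrightarrow> i \<in> triv L i"
    "i \<in> C \<Longrightarrow> j \<in> C \<Longrightarrow> P \<in> triv L i \<Longrightarrow> P \<in> triv L j \<Longrightarrow> reg P (trans L i j)"
    "i \<in> C \<Longrightarrow> x \<in> triv L i \<Longrightarrow> trans L i i x = 1"
    "i \<in> C \<Longrightarrow> j \<in> C \<Longrightarrow> x \<in> triv L i \<Longrightarrow> x \<in> triv L j \<Longrightarrow>
      trans L i x x = trans L i j x * trans L j x x"
    "i \<in> C \<Longrightarrow> x \<in> triv L i \<Longrightarrow> trans L i x x \<noteq> 0"
proof -
  note * = assms[unfolded is_line_bundle_def]
  show open_: "\<And>i. i \<in> C \<Longrightarrow> zopen n C (triv L i)" and self: "\<And>i. i \<in> C \<Longrightarrow> i \<in> triv L i"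
    using * by blast+
  have sub: "x \<in> C" if "i \<in> C" "x \<in> triv L i" for i x using zopen_subset[OF open_] that by blast
  show "reg P (trans L i j)" if "i \<in> C" "j \<in> C" "P \<in> triv L i" "P \<in> triv L j" for i j P
  proof -
    have "zopen n C (triv L i \<inter> triv L j)" using open_ that by blast
    from regular_iff[OF this] show ?thesis using * that by blast
  qed
  show one: "\<And>i x. i \<in> C \<Longrightarrow> x \<in> triv L i \<Longrightarrow> trans L i i x = 1" using * by blast
  have cocycle: "\<And>i j k x. i \<in> C \<Longrightarrow> j \<in> C \<Longrightarrow> k \<in> C \<Longrightarrow> x \<in> triv L i \<inter> triv L j \<inter> triv L k \<Longrightarrow>
      trans L i j x * trans L j k x = trans L i k x"
    using * by blast
  show "trans L i x x = trans L i j x * trans L j x x"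
    if "i \<in> C" "j \<in> C" "x \<in> triv L i" "x \<in> triv L j" for i j x
    using cocycle[of i j x x] that self sub by auto
  show "trans L i x x \<noteq> 0" if "i \<in> C" "x \<in> triv L i" for i x
    using cocycle[of i x i x] one[of i x] that self sub by auto
qed

lemma eventually_triv: "is_line_bundle n C L \<Longrightarrow> P \<in> C \<Longrightarrow> \<forall>\<^sub>F x in near P. x \<in> triv L P"
  using line_bundleD(1,2) by (intro eventually_open)

lemma eventually_weight_nonzero:
  "is_line_bundle n C L \<Longrightarrow> P \<in> C \<Longrightarrow> \<forall>\<^sub>F x in near P. trans L P x x \<noteq> 0"
  using eventually_triv by (rule eventually_mono) (use line_bundleD(6) in auto)

text \<open>
  By the cocycle identity the chart at \<open>P\<close> itself suffices to test regularity at \<open>P\<close>.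
\<close>

lemma lb_section_iff:
  assumes L: "is_line_bundle n C L" and V: "zopen n C V"
  shows "lb_section n C L V \<sigma> \<longleftrightarrow> (\<forall>P\<in>V. sec L P \<sigma>)"
proof -
  have VC: "V \<subseteq> C" using zopen_subset[OF V] .
  have op: "zopen n C (V \<inter> triv L i)" if "i \<in> C" for i using V line_bundleD(1)[OF L that] by blast
  show ?thesis
  proof
    assume s: "lb_section n C L V \<sigma>"
    show "\<forall>P\<in>V. sec L P \<sigma>"
    proof
      fix P assume P: "P \<in> V"
      then have "P \<in> C" "P \<in> V \<inter> triv L P" using VC line_bundleD(2)[OF L] by auto
      then show "sec L P \<sigma>"
        using s op[of P] regular_iff[OF op[of P]] unfolding lb_section_def by blast
    qed
  next
    assume s: "\<forall>P\<in>V. sec L P \<sigma>"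
    have "reg P (\<lambda>x. trans L i x x * \<sigma> x)" if i: "i \<in> C" and P: "P \<in> V \<inter> triv L i" for i P
    proof -
      have PC: "P \<in> C" using P VC by blast
      have "reg P (\<lambda>x. trans L i P x * (trans L P x x * \<sigma> x))"
        using s P line_bundleD(3)[OF L i PC, of P] line_bundleD(2)[OF L PC] by auto
      moreover have "P \<in> triv L i" using P by blast
      from eventually_triv[OF L PC] eventually_open[OF line_bundleD(1)[OF L i] this]
      have "\<forall>\<^sub>F x in near P. trans L i P x * (trans L P x x * \<sigma> x) = trans L i x x * \<sigma> x"
        by eventually_elim (use line_bundleD(5)[OF L i PC] in auto)
      ultimately show ?thesis by (rule reg_cong)
    qed
    then show "lb_section n C L V \<sigma>"
      unfolding lb_section_def using regular_iff[OF op] by blast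
  qed
qed

lemma H0_iff:
  assumes L: "is_line_bundle n C L"
  shows "\<sigma> \<in> H0 n C L \<longleftrightarrow> (\<forall>P\<in>C. sec L P \<sigma>) \<and> (\<forall>x. x \<notin> C \<longrightarrow> \<sigma> x = 0)"
  unfolding H0_def using lb_section_iff[OF L zopen_C] by simp

lemma H0_sec: "is_line_bundle n C L \<Longrightarrow> \<sigma> \<in> H0 n C L \<Longrightarrow> P \<in> C \<Longrightarrow> sec L P \<sigma>"
  using H0_iff[of L \<sigma>] by blast

lemma sec_cong: "sec L P \<sigma> \<Longrightarrow> \<forall>\<^sub>F x in near P. \<sigma> x = \<tau> x \<Longrightarrow> sec L P \<tau>"
  by (erule reg_cong) (auto elim: eventually_mono)

lemma sec_add: "sec L P \<sigma> \<Longrightarrow> sec L P \<tau> \<Longrightarrow> sec L P (\<lambda>x. \<sigma> x + \<tau> x)"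
  using reg_add[of P "\<lambda>x. trans L P x x * \<sigma> x" "\<lambda>x. trans L P x x * \<tau> x"] by (simp add: distrib_left)

lemma sec_diff: "sec L P \<sigma> \<Longrightarrow> sec L P \<tau> \<Longrightarrow> sec L P (\<lambda>x. \<sigma> x - \<tau> x)"
  using reg_diff[of P "\<lambda>x. trans L P x x * \<sigma> x" "\<lambda>x. trans L P x x * \<tau> x"] by (simp add: right_diff_distrib)

lemma sec_scale: "sec L P \<sigma> \<Longrightarrow> sec L P (\<lambda>x. c * \<sigma> x)"
  using reg_mult[OF reg_const[of P c], of "\<lambda>x. trans L P x x * \<sigma> x"] by (simp add: mult.left_commute)

lemma sec_mult: "sec L P \<sigma> \<Longrightarrow> sec M P \<tau> \<Longrightarrow> sec (lb_tensor L M) P (\<lambda>x. \<sigma> x * \<tau> x)"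
  using reg_mult[of P "\<lambda>x. trans L P x x * \<sigma> x" "\<lambda>x. trans M P x x * \<tau> x"]
  by (simp add: lb_tensor_def mult_ac)

lemma sec_cancel:
  assumes L: "is_line_bundle n C L" and P: "P \<in> C" and s: "sec L P s" "s P \<noteq> 0"
    and f: "sec (lb_tensor B L) P (\<lambda>x. s x * f x)"
  shows "sec B P f"
proof -
  have 1: "trans L P P P * s P \<noteq> 0" using s(2) line_bundleD(2,6)[OF L P] by simp
  have "\<forall>\<^sub>F x in near P. trans (lb_tensor B L) P x x * (s x * f x) / (trans L P x x * s x) = trans B P x x * f x"
    using reg_inverse(2)[OF P s(1) 1] by eventually_elim (simp add: lb_tensor_def)
  with reg_divide[OF P f s(1) 1] show ?thesis by (rule reg_cong)
qed

lemma is_line_bundle_tensor: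
  assumes L: "is_line_bundle n C L" and M: "is_line_bundle n C M"
  shows "is_line_bundle n C (lb_tensor L M)"
proof -
  have op: "zopen n C (triv L i \<inter> triv M i)" if "i \<in> C" for i
    using line_bundleD(1)[OF L that] line_bundleD(1)[OF M that] by blast
  have "regular n (triv L i \<inter> triv M i \<inter> (triv L j \<inter> triv M j)) (\<lambda>x. trans L i j x * trans M i j x)"
    if ij: "i \<in> C" "j \<in> C" for i j
  proof -
    have "zopen n C (triv L i \<inter> triv M i \<inter> (triv L j \<inter> triv M j))"
      using openin_Int[OF op[OF ij(1)] op[OF ij(2)]] .
    then show ?thesis
      unfolding regular_iff by (subst regular_iff) (auto intro!: reg_mult line_bundleD(3)[OF L ij] line_bundleD(3)[OF M ij])
  qed
  moreover have "trans L i j x * trans M i j x * (trans L j k x * trans M j k x) = trans L i k x * trans M i k x"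
    if "i \<in> C" "j \<in> C" "k \<in> C" "x \<in> triv L i \<inter> triv M i \<inter> (triv L j \<inter> triv M j) \<inter> (triv L k \<inter> triv M k)" for i j k x
  proof -
    have "trans L i j x * trans L j k x = trans L i k x" "trans M i j x * trans M j k x = trans M i k x"
      using L M that unfolding is_line_bundle_def by blast+
    then show ?thesis by (metis mult.assoc mult.commute)
  qed
  ultimately show ?thesis
    using op line_bundleD(2,4)[OF L] line_bundleD(2,4)[OF M]
    unfolding is_line_bundle_def lb_tensor_def by simp
qed

lemma is_line_bundle_trivial: "is_line_bundle n C (lb_trivial C)"
  unfolding is_line_bundle_def lb_trivial_def using zopen_C regular_iff[OF zopen_C] by auto

lemma lb_power_2: "lb_power C L 2 = lb_tensor L (lb_tensor L (lb_trivial C))"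
  by (simp add: lb_power_def numeral_2_eq_2)

lemma is_line_bundle_power_2: "is_line_bundle n C L \<Longrightarrow> is_line_bundle n C (lb_power C L 2)"
  unfolding lb_power_2 by (intro is_line_bundle_tensor is_line_bundle_trivial)

lemma weight_simps:
  "trans (lb_tensor L M) P x x = trans L P x x * trans M P x x"
  "trans (lb_power C L 2) P x x = trans L P x x * trans L P x x"
  by (simp_all add: lb_power_2 lb_tensor_def lb_trivial_def)

text \<open>
  Canonical isomorphisms, such as $(M \otimes A)^2 \cong M^2 \otimes A \otimes A$ or
  $A^{-1} \otimes A \cong O$, are equalities of weights here.
\<close>

definition same_weight :: "'k line_bundle \<Rightarrow> 'k line_bundle \<Rightarrow> bool" where
  "same_weight L L' \<longleftrightarrow> is_line_bundle n C L \<and> is_line_bundle n C L' \<and>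
     (\<forall>P\<in>C. \<forall>\<^sub>F x in near P. trans L P x x = trans L' P x x)"

lemma same_weight_sec: "same_weight L L' \<Longrightarrow> P \<in> C \<Longrightarrow> sec L P \<sigma> \<longleftrightarrow> sec L' P \<sigma>"
proof
  assume *: "same_weight L L'" "P \<in> C"
  then have ev: "\<forall>\<^sub>F x in near P. trans L P x x = trans L' P x x" by (auto simp: same_weight_def)
  show "sec L P \<sigma> \<Longrightarrow> sec L' P \<sigma>" by (erule reg_cong) (use ev in \<open>auto elim: eventually_mono\<close>)
  show "sec L' P \<sigma> \<Longrightarrow> sec L P \<sigma>" by (erule reg_cong) (use ev in \<open>auto elim: eventually_mono\<close>)
qed

lemma same_weight_lb_section:
  assumes "same_weight L L'" "zopen n C V"
  shows "lb_section n C L V \<sigma> \<longleftrightarrow> lb_section n C L' V \<sigma>"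
proof -
  have "is_line_bundle n C L" "is_line_bundle n C L'" using assms by (auto simp: same_weight_def)
  then show ?thesis
    using lb_section_iff[OF _ assms(2)] same_weight_sec[OF assms(1)] zopen_subset[OF assms(2)] by blast
qed

lemma same_weight_H0: "same_weight L L' \<Longrightarrow> H0 n C L = H0 n C L'"
  unfolding H0_def using same_weight_lb_section[OF _ zopen_C] by simp

lemma pointed_coverD: "pointed_cover n C V \<Longrightarrow> P \<in> C \<Longrightarrow> zopen n C (V P)"
  "pointed_cover n C V \<Longrightarrow> P \<in> C \<Longrightarrow> P \<in> V P"
  by (auto simp: pointed_cover_def)

lemma pointed_cover_Int:
  "pointed_cover n C V \<Longrightarrow> pointed_cover n C W \<Longrightarrow> pointed_cover n C (\<lambda>P. V P \<inter> W P)"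
  by (auto simp: pointed_cover_def)

lemma same_weight_Z1: assumes "same_weight L L'" shows "cech_Z1 n C L = cech_Z1 n C L'"
proof -
  have "(pointed_cover n C V \<and>
     (\<forall>P\<in>C. \<forall>Q\<in>C. lb_section n C L (V P \<inter> V Q) (\<lambda>x. c (P, Q, x))) \<and> Z) \<longleftrightarrow>
     (pointed_cover n C V \<and>
     (\<forall>P\<in>C. \<forall>Q\<in>C. lb_section n C L' (V P \<inter> V Q) (\<lambda>x. c (P, Q, x))) \<and> Z)" for V c Z
    using same_weight_lb_section[OF assms] pointed_coverD(1)[of V] by (meson openin_Int)
  then show ?thesis unfolding cech_Z1_def by simp
qed

lemma same_weight_B1: assumes "same_weight L L'" shows "cech_B1 n C L = cech_B1 n C L'"
proof -
  have "(pointed_cover n C V \<and> (\<forall>P\<in>C. lb_section n C L (V P) (h P)) \<and> Z) \<longleftrightarrow>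
     (pointed_cover n C V \<and> (\<forall>P\<in>C. lb_section n C L' (V P) (h P)) \<and> Z)" for V h Z
    using same_weight_lb_section[OF assms] pointed_coverD(1)[of V] by meson
  then show ?thesis unfolding cech_B1_def by simp
qed

lemma cech_Z1_iff:
  assumes L: "is_line_bundle n C L"
  shows "c \<in> cech_Z1 n C L \<longleftrightarrow> (\<exists>V. pointed_cover n C V \<and>
     (\<forall>P\<in>C. \<forall>Q\<in>C. \<forall>R\<in>V P \<inter> V Q. sec L R (\<lambda>x. c (P, Q, x))) \<and>
     (\<forall>P\<in>C. \<forall>Q\<in>C. \<forall>R\<in>C. \<forall>x\<in>V P \<inter> V Q \<inter> V R. c (P, R, x) = c (P, Q, x) + c (Q, R, x)))"
proof -
  have "(pointed_cover n C V \<and>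
     (\<forall>P\<in>C. \<forall>Q\<in>C. lb_section n C L (V P \<inter> V Q) (\<lambda>x. c (P, Q, x))) \<and> Z) \<longleftrightarrow>
     (pointed_cover n C V \<and>
     (\<forall>P\<in>C. \<forall>Q\<in>C. \<forall>R\<in>V P \<inter> V Q. sec L R (\<lambda>x. c (P, Q, x))) \<and> Z)" for V Z
  proof -
    have "lb_section n C L (V P \<inter> V Q) (\<lambda>x. c (P, Q, x)) \<longleftrightarrow> (\<forall>R\<in>V P \<inter> V Q. sec L R (\<lambda>x. c (P, Q, x)))"
      if "pointed_cover n C V" "P \<in> C" "Q \<in> C" for P Q
      by (rule lb_section_iff[OF L openin_Int[OF pointed_coverD(1)[OF that(1,2)] pointed_coverD(1)[OF that(1,3)]]])
    then show ?thesis by (intro conj_cong refl ball_cong) auto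
  qed
  then show ?thesis unfolding cech_Z1_def mem_Collect_eq by simp
qed

lemma cech_B1_iff:
  assumes L: "is_line_bundle n C L"
  shows "c \<in> cech_B1 n C L \<longleftrightarrow> (\<exists>V h. pointed_cover n C V \<and> (\<forall>P\<in>C. \<forall>R\<in>V P. sec L R (h P)) \<and>
     (\<forall>P\<in>C. \<forall>Q\<in>C. \<forall>x\<in>V P \<inter> V Q. c (P, Q, x) = h Q x - h P x))"
proof -
  have "(pointed_cover n C V \<and> (\<forall>P\<in>C. lb_section n C L (V P) (h P)) \<and> Z) \<longleftrightarrow>
     (pointed_cover n C V \<and> (\<forall>P\<in>C. \<forall>R\<in>V P. sec L R (h P)) \<and> Z)" for V h Z
  proof -
    have "lb_section n C L (V P) (h P) \<longleftrightarrow> (\<forall>R\<in>V P. sec L R (h P))"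
      if "pointed_cover n C V" "P \<in> C" for P
      by (rule lb_section_iff[OF L pointed_coverD(1)[OF that]])
    then show ?thesis by (intro conj_cong refl ball_cong) auto
  qed
  then show ?thesis unfolding cech_B1_def mem_Collect_eq by simp
qed

lemma h1_eq_0_iff:
  assumes L: "is_line_bundle n C L"
  shows "h1 n C L = 0 \<longleftrightarrow> cech_Z1 n C L \<subseteq> cech_B1 n C L"
  unfolding h1_def
proof (rule qdim_eq_0_iff)
  fix a c assume "c \<in> cech_B1 n C L"
  then obtain V h where *: "pointed_cover n C V" "\<forall>P\<in>C. \<forall>R\<in>V P. sec L R (h P)"
    "\<forall>P\<in>C. \<forall>Q\<in>C. \<forall>x\<in>V P \<inter> V Q. c (P, Q, x) = h Q x - h P x"
    unfolding cech_B1_iff[OF L] by (elim exE conjE) (rule that)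
  have "\<forall>P\<in>C. \<forall>R\<in>V P. sec L R (\<lambda>x. a * h P x)"
    using *(2) sec_scale by blast
  moreover have "\<forall>P\<in>C. \<forall>Q\<in>C. \<forall>x\<in>V P \<inter> V Q. a * c (P, Q, x) = a * h Q x - a * h P x"
    using *(3) by (simp add: right_diff_distrib)
  ultimately show "(\<lambda>x. a * c x) \<in> cech_B1 n C L"
    unfolding cech_B1_iff[OF L] using *(1)
    by (intro exI[of _ V] exI[of _ "\<lambda>P x. a * h P x"] conjI)
qed


section \<open>The base-point-free pencil trick\<close>

lemma H0_mult:
  assumes "is_line_bundle n C L" "is_line_bundle n C M" "\<sigma> \<in> H0 n C L" "\<tau> \<in> H0 n C M"
  shows "(\<lambda>x. \<sigma> x * \<tau> x) \<in> H0 n C (lb_tensor L M)"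
  using assms H0_iff[OF assms(1)] H0_iff[OF assms(2)] H0_iff[OF is_line_bundle_tensor[OF assms(1,2)]]
  by (auto intro: sec_mult)

lemma H0_add:
  "is_line_bundle n C L \<Longrightarrow> \<sigma> \<in> H0 n C L \<Longrightarrow> \<tau> \<in> H0 n C L \<Longrightarrow> (\<lambda>x. \<sigma> x + \<tau> x) \<in> H0 n C L"
  by (auto simp: H0_iff intro: sec_add)

lemma H0_scale: "is_line_bundle n C L \<Longrightarrow> \<sigma> \<in> H0 n C L \<Longrightarrow> (\<lambda>x. c * \<sigma> x) \<in> H0 n C L"
  by (auto simp: H0_iff intro: sec_scale)

lemma H0_0: "is_line_bundle n C L \<Longrightarrow> (\<lambda>_. 0) \<in> H0 n C L"
  by (auto simp: H0_iff)

lemma H0_sum: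
  "is_line_bundle n C L \<Longrightarrow> (\<And>i. i \<in> I \<Longrightarrow> \<sigma> i \<in> H0 n C L) \<Longrightarrow> (\<lambda>x. \<Sum>i\<in>I. \<sigma> i x) \<in> H0 n C L"
proof (induction I rule: infinite_finite_induct)
  case (insert i I)
  then have "(\<lambda>x. \<sigma> i x + (\<Sum>i\<in>I. \<sigma> i x)) \<in> H0 n C L" by (intro H0_add) auto
  then show ?case using insert.hyps by simp
qed (auto intro: H0_0)

definition pencil :: "'k line_bundle \<Rightarrow> ('k ppoint \<Rightarrow> 'k) \<Rightarrow> ('k ppoint \<Rightarrow> 'k) \<Rightarrow> bool" where
  "pencil A s t \<longleftrightarrow> is_line_bundle n C A \<and> s \<in> H0 n C A \<and> t \<in> H0 n C A \<and> (\<forall>x\<in>C. s x \<noteq> 0 \<or> t x \<noteq> 0)"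

text \<open>
  Near any point one of \<open>s\<close>, \<open>t\<close> is a generator of \<open>A\<close> and can be divided out.
\<close>

lemma pencil_divide:
  assumes pen: "pencil A s t" and P: "P \<in> C"
    and h: "sec (lb_tensor B A) P h" and k: "sec (lb_tensor B A) P k"
    and f: "\<forall>\<^sub>F x in near P. s x * f x = h x \<and> t x * f x = k x"
  shows "sec B P f"
proof -
  have A: "is_line_bundle n C A" and st: "sec A P s" "sec A P t"
    using pen P H0_iff[of A] unfolding pencil_def by auto
  have "sec (lb_tensor B A) P (\<lambda>x. s x * f x)"
    using h by (rule sec_cong) (use f in \<open>auto elim: eventually_mono\<close>)
  moreover have "sec (lb_tensor B A) P (\<lambda>x. t x * f x)"
    using k by (rule sec_cong) (use f in \<open>auto elim: eventually_mono\<close>)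
  moreover have "s P \<noteq> 0 \<or> t P \<noteq> 0" using pen P unfolding pencil_def by blast
  ultimately show ?thesis using sec_cancel[OF A P st(1)] sec_cancel[OF A P st(2)] by blast
qed

text \<open>
  The common value of \<open>h / s\<close> and \<open>k / t\<close> when \<open>t * h = s * k\<close>.
\<close>

definition pencil_quotient ::
  "('k ppoint \<Rightarrow> 'k) \<Rightarrow> ('k ppoint \<Rightarrow> 'k) \<Rightarrow> ('k ppoint \<Rightarrow> 'k) \<Rightarrow> ('k ppoint \<Rightarrow> 'k) \<Rightarrow> 'k ppoint \<Rightarrow> 'k" where
  "pencil_quotient s t h k x = (if s x \<noteq> 0 then h x / s x else k x / t x)"

lemma pencil_quotient:
  assumes "t x * h x = s x * k x" "s x \<noteq> 0 \<or> t x \<noteq> 0"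
  shows "s x * pencil_quotient s t h k x = h x" "t x * pencil_quotient s t h k x = k x"
  using assms by (auto simp: pencil_quotient_def field_simps)

lemma pencil_Z1:
  assumes B: "is_line_bundle n C B" and A: "is_line_bundle n C A" and s: "s \<in> H0 n C A"
    and c: "c \<in> cech_Z1 n C B"
  shows "(\<lambda>(P, Q, x). s x * c (P, Q, x)) \<in> cech_Z1 n C (lb_tensor B A)"
proof -
  obtain V where V: "pointed_cover n C V" "\<forall>P\<in>C. \<forall>Q\<in>C. \<forall>R\<in>V P \<inter> V Q. sec B R (\<lambda>x. c (P, Q, x))"
     "\<forall>P\<in>C. \<forall>Q\<in>C. \<forall>R\<in>C. \<forall>x\<in>V P \<inter> V Q \<inter> V R. c (P, R, x) = c (P, Q, x) + c (Q, R, x)"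
    using c unfolding cech_Z1_iff[OF B] by (elim exE conjE) (rule that)
  have sec: "sec (lb_tensor B A) R (\<lambda>x. s x * c (P, Q, x))" if "P \<in> C" "Q \<in> C" "R \<in> V P \<inter> V Q" for P Q R
  proof -
    have "R \<in> C" using zopen_subset[OF pointed_coverD(1)[OF V(1) that(1)]] that(3) by blast
    then have "sec A R s" using s H0_iff[OF A] by blast
    from sec_mult[OF _ this, of B "\<lambda>x. c (P, Q, x)"] show ?thesis using V(2) that by (simp add: mult.commute)
  qed
  have coc: "s x * c (P, R, x) = s x * c (P, Q, x) + s x * c (Q, R, x)"
    if "P \<in> C" "Q \<in> C" "R \<in> C" "x \<in> V P \<inter> V Q \<inter> V R" for P Q R x
    using V(3) that by (metis distrib_left)
  show ?thesis
    unfolding cech_Z1_iff[OF is_line_bundle_tensor[OF B A]] prod.case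
    by (intro exI[of _ V] conjI ballI V(1) sec coc)
qed

text \<open>
  The long exact sequence of $0 \to B \to (B A)^2 \to B A^2 \to 0$, at the only place where it
  is needed.
\<close>

proposition pencil_H1:
  assumes B: "is_line_bundle n C B" and pen: "pencil A s t"
    and H1: "cech_Z1 n C (lb_tensor B A) \<subseteq> cech_B1 n C (lb_tensor B A)"
    and gen: "\<And>\<eta>. \<eta> \<in> H0 n C (lb_tensor (lb_tensor B A) A) \<Longrightarrow>
      \<exists>p\<in>H0 n C (lb_tensor B A). \<exists>r\<in>H0 n C (lb_tensor B A). \<eta> = (\<lambda>x. s x * p x + t x * r x)"
  shows "cech_Z1 n C B \<subseteq> cech_B1 n C B"
proof
  let ?BA = "lb_tensor B A"
  have A: "is_line_bundle n C A" and st: "s \<in> H0 n C A" "t \<in> H0 n C A"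
    and base: "\<And>x. x \<in> C \<Longrightarrow> s x \<noteq> 0 \<or> t x \<noteq> 0" using pen unfolding pencil_def by auto
  note BA = is_line_bundle_tensor[OF B A]
  fix c assume c: "c \<in> cech_Z1 n C B"
  obtain V where V: "pointed_cover n C V" "\<forall>P\<in>C. \<forall>Q\<in>C. \<forall>R\<in>V P \<inter> V Q. sec B R (\<lambda>x. c (P, Q, x))"
     "\<forall>P\<in>C. \<forall>Q\<in>C. \<forall>R\<in>C. \<forall>x\<in>V P \<inter> V Q \<inter> V R. c (P, R, x) = c (P, Q, x) + c (Q, R, x)"
    using c unfolding cech_Z1_iff[OF B] by (elim exE conjE) (rule that)
  have "(\<lambda>(P, Q, x). s x * c (P, Q, x)) \<in> cech_B1 n C ?BA"
    using H1 pencil_Z1[OF B A st(1) c] by blast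
  then obtain W1 h where h: "pointed_cover n C W1" "\<forall>P\<in>C. \<forall>R\<in>W1 P. sec ?BA R (h P)"
    "\<And>P Q x. P \<in> C \<Longrightarrow> Q \<in> C \<Longrightarrow> x \<in> W1 P \<Longrightarrow> x \<in> W1 Q \<Longrightarrow> s x * c (P, Q, x) = h Q x - h P x"
    unfolding cech_B1_iff[OF BA] by auto
  have "(\<lambda>(P, Q, x). t x * c (P, Q, x)) \<in> cech_B1 n C ?BA"
    using H1 pencil_Z1[OF B A st(2) c] by blast
  then obtain W2 k where k: "pointed_cover n C W2" "\<forall>P\<in>C. \<forall>R\<in>W2 P. sec ?BA R (k P)"
    "\<And>P Q x. P \<in> C \<Longrightarrow> Q \<in> C \<Longrightarrow> x \<in> W2 P \<Longrightarrow> x \<in> W2 Q \<Longrightarrow> t x * c (P, Q, x) = k Q x - k P x"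
    unfolding cech_B1_iff[OF BA] by auto
  define W where "W P = W1 P \<inter> W2 P" for P
  have W: "pointed_cover n C W" unfolding W_def using pointed_cover_Int h(1) k(1) .
  note Wo = pointed_coverD(1)[OF W] and Wi = pointed_coverD(2)[OF W]
  have WC: "x \<in> C" if "x \<in> W P" "P \<in> C" for x P using zopen_subset[OF Wo] that by blast
  \<comment> \<open>The sections \<open>t * h P - s * k P\<close> agree on overlaps, since \<open>t * h\<close> and \<open>s * k\<close> have the same coboundary;
    the glued section is read off at \<open>x\<close> from the member of the cover that belongs to \<open>x\<close>.\<close>
  define \<eta> where "\<eta> x = (if x \<in> C then t x * h x x - s x * k x x else 0)" for x
  have \<eta>: "\<eta> x = t x * h P x - s x * k P x" if P: "P \<in> C" "x \<in> W P" for P x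
  proof -
    note x = WC[OF P(2,1)]
    have "t x * (s x * c (x, P, x)) = t x * (h P x - h x x)"
      using h(3)[OF x P(1)] P(2) Wi[OF x] by (simp add: W_def)
    moreover have "s x * (t x * c (x, P, x)) = s x * (k P x - k x x)"
      using k(3)[OF x P(1)] P(2) Wi[OF x] by (simp add: W_def)
    moreover have "t x * (s x * c (x, P, x)) = s x * (t x * c (x, P, x))" by (rule mult.left_commute)
    ultimately have "t x * (h P x - h x x) = s x * (k P x - k x x)" by simp
    then show ?thesis using x by (simp add: \<eta>_def algebra_simps)
  qed
  have "sec (lb_tensor ?BA A) P \<eta>" if P: "P \<in> C" for P
  proof -
    have "sec A P s" "sec A P t" using st P H0_iff[OF A] by auto
    moreover have "sec ?BA P (h P)" "sec ?BA P (k P)"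
      using h(2) k(2) Wi[OF P] P by (auto simp: W_def)
    ultimately have "sec (lb_tensor ?BA A) P (\<lambda>x. h P x * t x - k P x * s x)"
      by (intro sec_diff sec_mult)
    then show ?thesis
      by (rule sec_cong) (use eventually_open[OF Wo[OF P] Wi[OF P]] \<eta>[OF P] in
          \<open>auto elim!: eventually_mono simp: mult.commute\<close>)
  qed
  then have "\<eta> \<in> H0 n C (lb_tensor ?BA A)"
    unfolding H0_iff[OF is_line_bundle_tensor[OF BA A]] by (auto simp: \<eta>_def)
  from gen[OF this] obtain p r where p: "p \<in> H0 n C ?BA" "r \<in> H0 n C ?BA"
    "\<eta> = (\<lambda>x. s x * p x + t x * r x)" by blast
  \<comment> \<open>Changing \<open>h\<close> and \<open>k\<close> by global sections does not affect their coboundaries.\<close>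
  define h' where "h' P x = h P x - r x" for P x
  define k' where "k' P x = k P x + p x" for P x
  define f where "f P = pencil_quotient s t (h' P) (k' P)" for P
  have f: "s x * f P x = h' P x" "t x * f P x = k' P x" if P: "P \<in> C" "x \<in> W P" for P x
  proof -
    have "t x * h' P x = s x * k' P x"
      using \<eta>[OF P] unfolding p(3) by (simp add: h'_def k'_def algebra_simps)
    from pencil_quotient[where s = s and t = t and h = "h' P" and k = "k' P", OF this base[OF WC[OF P(2,1)]]]
    show "s x * f P x = h' P x" "t x * f P x = k' P x" by (simp_all add: f_def)
  qed
  have secf: "sec B R (f P)" if P: "P \<in> C" "R \<in> W P" for P R
  proof (rule pencil_divide[OF pen])
    show R: "R \<in> C" using WC P by blast
    show "sec ?BA R (h' P)" unfolding h'_def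
      using h(2) P p(2) R H0_iff[OF BA] by (intro sec_diff) (auto simp: W_def)
    show "sec ?BA R (k' P)" unfolding k'_def
      using k(2) P p(1) R H0_iff[OF BA] by (intro sec_add) (auto simp: W_def)
    show "\<forall>\<^sub>F x in near R. s x * f P x = h' P x \<and> t x * f P x = k' P x"
      using eventually_open[OF Wo[OF P(1)] P(2)] by (rule eventually_mono) (use f[OF P(1)] in auto)
  qed
  have cob: "c (P, Q, x) = f Q x - f P x" if PQ: "P \<in> C" "Q \<in> C" "x \<in> W P \<inter> W Q" for P Q x
  proof -
    have x: "x \<in> W P" "x \<in> W Q" using PQ by auto
    have "s x * (f Q x - f P x) = s x * c (P, Q, x)"
      using f(1)[OF PQ(1) x(1)] f(1)[OF PQ(2) x(2)] h(3)[OF PQ(1,2)] x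
      by (simp add: right_diff_distrib h'_def W_def)
    moreover have "t x * (f Q x - f P x) = t x * c (P, Q, x)"
      using f(2)[OF PQ(1) x(1)] f(2)[OF PQ(2) x(2)] k(3)[OF PQ(1,2)] x
      by (simp add: right_diff_distrib k'_def W_def)
    ultimately show ?thesis using base[OF WC[OF x(1) PQ(1)]] by (metis mult_left_cancel)
  qed
  show "c \<in> cech_B1 n C B"
    unfolding cech_B1_iff[OF B] by (intro exI[of _ W] exI[of _ f] conjI ballI W secf cob)
qed

text \<open>
  Both applications of the pencil trick.  The bundle \<open>A'\<close> is the inverse of \<open>A\<close>.
\<close>

proposition two_normal_imp_H1_zero:
  assumes M: "is_line_bundle n C M" and pen: "pencil A s t"
    and span: "\<And>\<tau>. \<tau> \<in> H0 n C A \<Longrightarrow> \<exists>a b. \<tau> = (\<lambda>x. a * s x + b * t x)"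
    and A': "is_line_bundle n C A'" and inv: "\<And>P x. trans A' P x x = inverse (trans A P x x)"
    and H1: "cech_Z1 n C (lb_tensor (lb_power C M 2) A) \<subseteq> cech_B1 n C (lb_tensor (lb_power C M 2) A)"
    and surj: "mult_map_surj n C M A"
    and two: "two_normal n C (lb_tensor M A)"
  shows "cech_Z1 n C (lb_tensor (lb_power C M 2) A') \<subseteq> cech_B1 n C (lb_tensor (lb_power C M 2) A')"
proof -
  define N where "N = lb_power C M 2"
  have A: "is_line_bundle n C A" and st: "s \<in> H0 n C A" "t \<in> H0 n C A"
    and base: "\<And>x. x \<in> C \<Longrightarrow> s x \<noteq> 0 \<or> t x \<noteq> 0" using pen unfolding pencil_def by auto
  have N: "is_line_bundle n C N" unfolding N_def by (rule is_line_bundle_power_2[OF M])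
  note NA = is_line_bundle_tensor[OF N A] and MA = is_line_bundle_tensor[OF M A]
  note NAA = is_line_bundle_tensor[OF NA A]
  have MM: "(\<lambda>x. a x * b x) \<in> H0 n C N" if "a \<in> H0 n C M" "b \<in> H0 n C M" for a b
  proof -
    have "same_weight (lb_tensor M M) N"
      unfolding same_weight_def N_def using N is_line_bundle_tensor[OF M M]
      by (auto simp: weight_simps N_def)
    from same_weight_H0[OF this] show ?thesis using H0_mult[OF M M that] by simp
  qed
  have MA_split: "\<exists>a\<in>H0 n C M. \<exists>b\<in>H0 n C M. \<sigma> = (\<lambda>x. s x * a x + t x * b x)"
    if \<sigma>: "\<sigma> \<in> H0 n C (lb_tensor M A)" for \<sigma>
  proof -
    obtain m :: nat and a b where ab: "\<forall>i<m. a i \<in> H0 n C M \<and> b i \<in> H0 n C A"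
       "\<sigma> = (\<lambda>x. \<Sum>i<m. a i x * b i x)"
      using surj \<sigma> unfolding mult_map_surj_def by blast
    have "\<forall>i\<in>{..<m}. \<exists>\<alpha>. b i = (\<lambda>x. fst \<alpha> * s x + snd \<alpha> * t x)"
    proof
      fix i assume "i \<in> {..<m}"
      then obtain \<alpha> \<beta> where "b i = (\<lambda>x. \<alpha> * s x + \<beta> * t x)" using ab(1) span[of "b i"] by auto
      then show "\<exists>\<alpha>. b i = (\<lambda>x. fst \<alpha> * s x + snd \<alpha> * t x)" by (intro exI[of _ "(\<alpha>, \<beta>)"]) simp
    qed
    from bchoice[OF this] obtain \<alpha> where \<alpha>: "\<forall>i<m. b i = (\<lambda>x. fst (\<alpha> i) * s x + snd (\<alpha> i) * t x)"
      by auto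
    have "\<sigma> = (\<lambda>x. s x * (\<Sum>i<m. fst (\<alpha> i) * a i x) + t x * (\<Sum>i<m. snd (\<alpha> i) * a i x))"
      unfolding ab(2) using \<alpha>
      by (auto simp: sum_distrib_left sum.distrib[symmetric] algebra_simps intro!: sum.cong)
    moreover have "(\<lambda>x. \<Sum>i<m. fst (\<alpha> i) * a i x) \<in> H0 n C M" "(\<lambda>x. \<Sum>i<m. snd (\<alpha> i) * a i x) \<in> H0 n C M"
      using ab(1) by (auto intro!: H0_sum[OF M] H0_scale[OF M])
    ultimately show ?thesis
      by (intro bexI[of _ "\<lambda>x. \<Sum>i<m. fst (\<alpha> i) * a i x"] bexI[of _ "\<lambda>x. \<Sum>i<m. snd (\<alpha> i) * a i x"])
  qed
  have quad: "\<exists>p\<in>H0 n C N. \<exists>q\<in>H0 n C N. \<exists>r\<in>H0 n C N.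
      \<eta> = (\<lambda>x. s x * s x * p x + s x * t x * q x + t x * t x * r x)"
    if \<eta>: "\<eta> \<in> H0 n C (lb_tensor (lb_tensor N A) A)" for \<eta>
  proof -
    have "same_weight (lb_tensor (lb_tensor N A) A) (lb_power C (lb_tensor M A) 2)"
      unfolding same_weight_def using NAA is_line_bundle_power_2[OF MA]
      by (auto simp: weight_simps N_def mult_ac)
    then have "\<eta> \<in> H0 n C (lb_power C (lb_tensor M A) 2)" using \<eta> same_weight_H0 by blast
    then obtain m :: nat and a b where ab: "\<forall>i<m. a i \<in> H0 n C (lb_tensor M A) \<and> b i \<in> H0 n C (lb_tensor M A)"
       "\<eta> = (\<lambda>x. \<Sum>i<m. a i x * b i x)"
      using two unfolding two_normal_def by blast
    have split: "\<exists>a'. fst a' \<in> H0 n C M \<and> snd a' \<in> H0 n C M \<and> \<sigma> = (\<lambda>x. s x * fst a' x + t x * snd a' x)"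
      if "\<sigma> \<in> H0 n C (lb_tensor M A)" for \<sigma>
    proof -
      from MA_split[OF that] obtain u v where "u \<in> H0 n C M" "v \<in> H0 n C M" "\<sigma> = (\<lambda>x. s x * u x + t x * v x)"
        by (elim bexE) (rule that)
      then show ?thesis by (intro exI[of _ "(u, v)"]) simp
    qed
    have "\<forall>i\<in>{..<m}. \<exists>a'. fst a' \<in> H0 n C M \<and> snd a' \<in> H0 n C M \<and> a i = (\<lambda>x. s x * fst a' x + t x * snd a' x)"
      by (intro ballI split) (use ab(1) in auto)
    from bchoice[OF this] obtain a' where a': "\<forall>i\<in>{..<m}. fst (a' i) \<in> H0 n C M \<and> snd (a' i) \<in> H0 n C M \<and>
      a i = (\<lambda>x. s x * fst (a' i) x + t x * snd (a' i) x)" by (rule exE)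
    have "\<forall>i\<in>{..<m}. \<exists>a'. fst a' \<in> H0 n C M \<and> snd a' \<in> H0 n C M \<and> b i = (\<lambda>x. s x * fst a' x + t x * snd a' x)"
      by (intro ballI split) (use ab(1) in auto)
    from bchoice[OF this] obtain b' where b': "\<forall>i\<in>{..<m}. fst (b' i) \<in> H0 n C M \<and> snd (b' i) \<in> H0 n C M \<and>
      b i = (\<lambda>x. s x * fst (b' i) x + t x * snd (b' i) x)" by (rule exE)
    let ?p = "\<lambda>x. \<Sum>i<m. fst (a' i) x * fst (b' i) x"
    let ?q = "\<lambda>x. \<Sum>i<m. fst (a' i) x * snd (b' i) x + snd (a' i) x * fst (b' i) x"
    let ?r = "\<lambda>x. \<Sum>i<m. snd (a' i) x * snd (b' i) x"
    have "\<eta> = (\<lambda>x. s x * s x * ?p x + s x * t x * ?q x + t x * t x * ?r x)"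
      unfolding ab(2) sum_distrib_left sum.distrib[symmetric] using a' b'
      by (auto simp: algebra_simps intro!: sum.cong)
    moreover have "?p \<in> H0 n C N" "?q \<in> H0 n C N" "?r \<in> H0 n C N"
      using a' b' by (auto intro!: H0_sum[OF N] H0_add[OF N] MM)
    ultimately show ?thesis by (intro bexI[of _ ?p] bexI[of _ ?q] bexI[of _ ?r])
  qed
  have NA_mult: "(\<lambda>x. u x * p x) \<in> H0 n C (lb_tensor N A)" if "p \<in> H0 n C N" "u \<in> H0 n C A" for p u
    using H0_mult[OF N A that] by (simp add: mult.commute)
  have H1_N: "cech_Z1 n C N \<subseteq> cech_B1 n C N"
  proof (rule pencil_H1[OF N pen])
    show "cech_Z1 n C (lb_tensor N A) \<subseteq> cech_B1 n C (lb_tensor N A)" using H1 by (simp add: N_def)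
    fix \<eta> assume "\<eta> \<in> H0 n C (lb_tensor (lb_tensor N A) A)"
    from quad[OF this] obtain p q r where p: "p \<in> H0 n C N" "q \<in> H0 n C N" "r \<in> H0 n C N"
      "\<eta> = (\<lambda>x. s x * s x * p x + s x * t x * q x + t x * t x * r x)" by blast
    have "\<eta> = (\<lambda>x. s x * (s x * p x + t x * q x) + t x * (t x * r x))"
      unfolding p(4) by (auto simp: algebra_simps)
    moreover have "(\<lambda>x. s x * p x + t x * q x) \<in> H0 n C (lb_tensor N A)" "(\<lambda>x. t x * r x) \<in> H0 n C (lb_tensor N A)"
      using NA_mult p st H0_add[OF NA] by auto
    ultimately show "\<exists>p\<in>H0 n C (lb_tensor N A). \<exists>r\<in>H0 n C (lb_tensor N A). \<eta> = (\<lambda>x. s x * p x + t x * r x)"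
      by (intro bexI[of _ "\<lambda>x. s x * p x + t x * q x"] bexI[of _ "\<lambda>x. t x * r x"])
  qed
  have NA': "is_line_bundle n C (lb_tensor N A')" by (rule is_line_bundle_tensor[OF N A'])
  have sw: "same_weight (lb_tensor (lb_tensor N A') A) N"
    unfolding same_weight_def
  proof (intro conjI ballI N is_line_bundle_tensor A' A)
    fix P assume "P \<in> C"
    from eventually_weight_nonzero[OF A this]
    show "\<forall>\<^sub>F x in near P. trans (lb_tensor (lb_tensor N A') A) P x x = trans N P x x"
      by eventually_elim (simp add: weight_simps inv)
  qed
  have sw2: "same_weight (lb_tensor (lb_tensor (lb_tensor N A') A) A) (lb_tensor N A)"
    unfolding same_weight_def
  proof (intro conjI ballI NA is_line_bundle_tensor N A' A)
    fix P assume "P \<in> C"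
    from eventually_weight_nonzero[OF A this]
    show "\<forall>\<^sub>F x in near P. trans (lb_tensor (lb_tensor (lb_tensor N A') A) A) P x x = trans (lb_tensor N A) P x x"
      by eventually_elim (simp add: weight_simps inv)
  qed
  have "cech_Z1 n C (lb_tensor N A') \<subseteq> cech_B1 n C (lb_tensor N A')"
  proof (rule pencil_H1[OF NA' pen])
    show "cech_Z1 n C (lb_tensor (lb_tensor N A') A) \<subseteq> cech_B1 n C (lb_tensor (lb_tensor N A') A)"
      unfolding same_weight_Z1[OF sw] same_weight_B1[OF sw] by (rule H1_N)
    fix \<eta> assume "\<eta> \<in> H0 n C (lb_tensor (lb_tensor (lb_tensor N A') A) A)"
    then have \<eta>: "\<eta> \<in> H0 n C (lb_tensor N A)" unfolding same_weight_H0[OF sw2] .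
    have "(\<lambda>x. \<eta> x * s x) \<in> H0 n C (lb_tensor (lb_tensor N A) A)" by (rule H0_mult[OF NA A \<eta> st(1)])
    \<comment> \<open>The section \<open>\<eta>\<close> of \<open>N \<otimes> A\<close> is multiplied by \<open>s\<close> to bring 2-normality to bear.\<close>
    from quad[OF this] obtain p q r where p: "p \<in> H0 n C N" "q \<in> H0 n C N" "r \<in> H0 n C N" and
      eq: "(\<lambda>x. \<eta> x * s x) = (\<lambda>x. s x * s x * p x + s x * t x * q x + t x * t x * r x)" by blast
    let ?e = "\<lambda>x. \<eta> x - (s x * p x + t x * q x)"
    have eq': "t x * (t x * r x) = s x * ?e x" for x
      using fun_cong[OF eq, of x] by (simp add: algebra_simps)
    \<comment> \<open>A section of \<open>N\<close> with \<open>s * y = t * r\<close> and \<open>t * y = \<eta> - s * p - t * q\<close>.\<close>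
    define y where "y x = (if x \<in> C then pencil_quotient s t (\<lambda>x. t x * r x) ?e x else 0)" for x
    have y: "s x * y x = t x * r x" "t x * y x = ?e x" if "x \<in> C" for x
      using pencil_quotient[where t = t and s = s and x = x and h = "\<lambda>x. t x * r x" and k = ?e, OF eq' base[OF that]]
        that by (simp_all add: y_def)
    have tr: "(\<lambda>x. t x * r x) \<in> H0 n C (lb_tensor N A)" using NA_mult p st by auto
    have spq: "(\<lambda>x. s x * p x + t x * q x) \<in> H0 n C (lb_tensor N A)"
      using NA_mult p st H0_add[OF NA] by auto
    have "sec N P y" if P: "P \<in> C" for P
    proof (rule pencil_divide[OF pen P])
      show "sec (lb_tensor N A) P (\<lambda>x. t x * r x)" by (rule H0_sec[OF NA tr P])
      show "sec (lb_tensor N A) P ?e" by (rule sec_diff[OF H0_sec[OF NA \<eta> P] H0_sec[OF NA spq P]])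
      show "\<forall>\<^sub>F x in near P. s x * y x = t x * r x \<and> t x * y x = ?e x"
        using eventually_in_C by (rule eventually_mono) (use y in blast)
    qed
    then have "y \<in> H0 n C N" unfolding H0_iff[OF N] by (auto simp: y_def)
    then have "(\<lambda>x. q x + y x) \<in> H0 n C N" by (rule H0_add[OF N p(2)])
    moreover have "\<eta> = (\<lambda>x. s x * p x + t x * (q x + y x))"
    proof
      fix x
      show "\<eta> x = s x * p x + t x * (q x + y x)"
      proof (cases "x \<in> C")
        case True
        then show ?thesis using y(2)[OF True] by (simp add: algebra_simps)
      next
        case False
        then show ?thesis using \<eta> st H0_iff[OF NA] H0_iff[OF A] by simp
      qed
    qed
    ultimately show "\<exists>p\<in>H0 n C (lb_tensor (lb_tensor N A') A). \<exists>r\<in>H0 n C (lb_tensor (lb_tensor N A') A).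
        \<eta> = (\<lambda>x. s x * p x + t x * r x)"
      unfolding same_weight_H0[OF sw] using p(1)
      by (intro bexI[of _ p] bexI[of _ "\<lambda>x. q x + y x"])
  qed
  then show ?thesis by (simp add: N_def)
qed

end

section \<open>The line bundle of the divisor of a section\<close>

lemma lb_of_div_simps:
  "triv (lb_of_div n C D) P = fst (chosen_param n C P) - ({Q. D Q \<noteq> 0} - {P})"
  "trans (lb_of_div n C D) P Q x = (if P = Q then 1
     else snd (chosen_param n C P) x powi D P / snd (chosen_param n C Q) x powi D Q)"
  by (simp_all add: lb_of_div_def)

lemma weight_lb_of_div_minus:
  "trans (lb_of_div n C (- D)) P x x = inverse (trans (lb_of_div n C D) P x x)"
  by (simp add: lb_of_div_simps power_int_minus divide_inverse)

context smooth_projective_curve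
begin

text \<open>
  A transition function $t_P^{D(P)} / t_Q^{D(Q)}$ could fail to be regular or nonzero only at \<open>P\<close> or at
  \<open>Q\<close>, but \<open>P\<close> lies in the chart of \<open>Q \<noteq> P\<close> only if \<open>D P = 0\<close>.  The charts are open because the support of
  \<open>D\<close> is discrete and closed.
\<close>

lemma is_line_bundle_of_div:
  assumes discrete: "\<And>P. P \<in> C \<Longrightarrow> \<forall>\<^sub>F x in near P. x \<noteq> P \<longrightarrow> D x = 0"
  shows "is_line_bundle n C (lb_of_div n C D)"
proof -
  let ?L = "lb_of_div n C D"
  define t where "t P = snd (chosen_param n C P)" for P
  define V where "V P = fst (chosen_param n C P)" for P
  have lp: "local_param n C P (V P) (t P)" if "P \<in> C" for P
    using chosen_param[OF that] by (simp add: t_def V_def)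
  have trivD: "x \<in> V P" "x = P \<or> D x = 0" if "x \<in> triv ?L P" for x P
    using that by (auto simp: lb_of_div_simps V_def)
  have trans: "trans ?L P Q = (if P = Q then (\<lambda>_. 1) else (\<lambda>x. t P x powi D P / t Q x powi D Q))" for P Q
    by (auto simp: lb_of_div_simps t_def)
  have op: "zopen n C (triv ?L P)" if P: "P \<in> C" for P
    unfolding zopen_iff
  proof (intro conjI ballI)
    note VP = local_paramD(6)[OF lp[OF P]]
    show "triv ?L P \<subseteq> C" using trivD(1) zopen_subset[OF VP] by blast
    fix R assume R: "R \<in> triv ?L P"
    then have "R \<in> V P" "R \<in> C" using trivD(1) zopen_subset[OF VP] by blast+
    from eventually_open[OF VP this(1)] discrete[OF this(2)]
    show "\<forall>\<^sub>F x in near R. x \<in> triv ?L P"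
      by eventually_elim (use R in \<open>auto simp: lb_of_div_simps V_def\<close>)
  qed
  have self: "P \<in> triv ?L P" if "P \<in> C" for P
    using local_paramD(7)[OF lp[OF that]] by (simp add: lb_of_div_simps V_def)
  have nz: "t P x \<noteq> 0 \<or> D P = 0" if "P \<in> C" "x \<in> triv ?L P" "x \<in> triv ?L Q" "P \<noteq> Q" for P Q x
    using local_paramD(9)[OF lp[OF that(1)] trivD(1)[OF that(2)]] trivD(2)[OF that(2)] trivD(2)[OF that(3)] that(4)
    by auto
  have reg: "regular n (triv ?L P \<inter> triv ?L Q) (trans ?L P Q)" if PQ: "P \<in> C" "Q \<in> C" for P Q
  proof -
    have o: "zopen n C (triv ?L P \<inter> triv ?L Q)" using op PQ by blast
    show ?thesis
      unfolding regular_iff[OF o]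
    proof
      fix R assume R: "R \<in> triv ?L P \<inter> triv ?L Q"
      then have RC: "R \<in> C" using zopen_subset[OF o] by blast
      show "reg R (trans ?L P Q)"
      proof (cases "P = Q")
        case False
        have "reg R (\<lambda>x. t P x powi D P)"
          using local_paramD(8)[OF lp[OF PQ(1)] trivD(1), of R] nz[OF PQ(1) _ _ False, of R] R
          by (intro reg_powi[OF RC]) auto
        moreover have "reg R (\<lambda>x. t Q x powi D Q)"
          using local_paramD(8)[OF lp[OF PQ(2)] trivD(1), of R] nz[OF PQ(2) _ _ not_sym[OF False], of R] R
          by (intro reg_powi[OF RC]) auto
        moreover have "t Q R powi D Q \<noteq> 0" 
          using nz[OF PQ(2) _ _ not_sym[OF False], of R] R by (auto simp: power_int_eq_0_iff)
        ultimately show ?thesis using False unfolding trans by (simp add: reg_divide[OF RC])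
      qed (auto simp: trans)
    qed
  qed
  have cocycle: "trans ?L P Q x * trans ?L Q R x = trans ?L P R x"
    if PQ: "P \<in> C" "Q \<in> C" "R \<in> C" "x \<in> triv ?L P \<inter> triv ?L Q \<inter> triv ?L R" for P Q R x
  proof -
    have "t Q x powi D Q \<noteq> 0" if "P \<noteq> Q"
      using nz[of Q x P] PQ that by (auto simp: power_int_eq_0_iff)
    moreover have "t P x powi D P \<noteq> 0" if "P \<noteq> Q"
      using nz[of P x Q] PQ that by (auto simp: power_int_eq_0_iff)
    ultimately show ?thesis by (auto simp: trans)
  qed
  show ?thesis
    unfolding is_line_bundle_def using op self reg cocycle by (simp add: trans)
qed

text \<open>
  The zero locus is closed; if it contained a nonempty open set, \<open>C\<close> would be a union of two proper
  closed subsets unless the section is zero.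
\<close>

lemma section_not_locally_zero:
  assumes L: "is_line_bundle n C L" and \<sigma>: "\<sigma> \<in> H0 n C L" "\<sigma> \<noteq> (\<lambda>_. 0)" and P: "P \<in> C"
  shows "\<not> (\<forall>\<^sub>F x in near P. \<sigma> x = 0)"
proof
  assume "\<forall>\<^sub>F x in near P. \<sigma> x = 0"
  then obtain U where U: "zopen n C U" "P \<in> U" "\<forall>x\<in>U. \<sigma> x = 0" unfolding eventually_near[OF P] by blast
  let ?N = "{x \<in> C. \<sigma> x \<noteq> 0}"
  have "zopen n C ?N"
    unfolding zopen_iff
  proof (intro conjI ballI)
    fix Q assume "Q \<in> ?N"
    then have Q: "Q \<in> C" "\<sigma> Q \<noteq> 0" by auto
    then have "trans L Q Q Q * \<sigma> Q \<noteq> 0" using line_bundleD(2,6)[OF L Q(1)] by simp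
    from reg_inverse(2)[OF Q(1) H0_sec[OF L \<sigma>(1) Q(1)] this] eventually_in_C
    show "\<forall>\<^sub>F x in near Q. x \<in> ?N" by eventually_elim auto
  qed auto
  have cl: "closedin (zariski n) (C - W)" if "zopen n C W" for W
  proof -
    have "closedin (subtopology (zariski n) C) (C - W)"
      using closedin_diff[OF closedin_topspace that] unfolding topspace_C .
    then show ?thesis using closedin_closed_subtopology[OF closed] by blast
  qed
  have "C \<subseteq> (C - U) \<union> (C - ?N)" using U(3) by auto
  then have "C \<subseteq> C - U \<or> C \<subseteq> C - ?N"
    using irreducible cl[OF U(1)] cl[OF \<open>zopen n C ?N\<close>] unfolding irreducible_subset_def by blast
  then have "\<forall>x\<in>C. \<sigma> x = 0" using P U(2) by blast
  moreover have "\<forall>x. x \<notin> C \<longrightarrow> \<sigma> x = 0" using \<sigma>(1) H0_iff[OF L] by blast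
  ultimately have "\<sigma> x = 0" for x by (cases "x \<in> C") simp_all
  then show False using \<sigma>(2) by (simp add: fun_eq_iff)
qed

text \<open>
  In the chart at \<open>P\<close> the section is $t_P^{D(P)} u_P$ with a unit $u_P$.  Division by the section
  identifies \<open>L\<close> with the bundle of its divisor; expressed by representing functions, it is
  division by the nowhere vanishing function \<open>\<epsilon>\<close> with $\epsilon(x) = u_x(x)$, which equals \<open>\<sigma>\<close> away
  from the zeros of \<open>\<sigma>\<close>.
\<close>

proposition lb_of_div_of_section:
  assumes L: "is_line_bundle n C L" and \<sigma>: "\<sigma> \<in> H0 n C L" "\<sigma> \<noteq> (\<lambda>_. 0)"
    and D: "D = div_of_section n C L \<sigma>"
  shows "is_line_bundle n C (lb_of_div n C D)" (is ?bundle)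
    "is_line_bundle n C (lb_of_div n C (- D))" (is ?bundle')
    "\<exists>\<epsilon>. (\<forall>x\<in>C. \<epsilon> x \<noteq> 0) \<and>
      (\<forall>P\<in>C. \<forall>\<tau>. sec (lb_of_div n C D) P \<tau> \<longleftrightarrow> sec L P (\<lambda>x. \<epsilon> x * \<tau> x))" (is ?iso)
proof -
  define t where "t P = snd (chosen_param n C P)" for P
  have lp: "local_param n C P (fst (chosen_param n C P)) (t P)" if "P \<in> C" for P
    using chosen_param[OF that] by (simp add: t_def)
  define m where "m P = vanishing_order n C P (\<lambda>x. trans L P x x * \<sigma> x)" for P
  have Dm: "D P = int (m P)" if "P \<in> C" for P using that by (simp add: D div_of_section_def m_def)
  have "\<exists>u. reg P u \<and> u P \<noteq> 0 \<and> (\<forall>\<^sub>F x in near P. trans L P x x * \<sigma> x = t P x ^ m P * u x)" if P: "P \<in> C" for P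
  proof -
    have "\<not> (\<forall>\<^sub>F x in near P. trans L P x x * \<sigma> x = 0)"
    proof
      assume "\<forall>\<^sub>F x in near P. trans L P x x * \<sigma> x = 0"
      with eventually_weight_nonzero[OF L P] have "\<forall>\<^sub>F x in near P. \<sigma> x = 0" by eventually_elim auto
      then show False using section_not_locally_zero[OF L \<sigma> P] by simp
    qed
    from vanishing_order_factor[OF lp[OF P] H0_sec[OF L \<sigma>(1) P] this]
    show ?thesis unfolding m_def by blast
  qed
  then have "\<forall>P\<in>C. \<exists>u. reg P u \<and> u P \<noteq> 0 \<and> (\<forall>\<^sub>F x in near P. trans L P x x * \<sigma> x = t P x ^ m P * u x)" by blast
  from bchoice[OF this] obtain u where "\<forall>P\<in>C. reg P (u P) \<and> u P P \<noteq> 0 \<and>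
     (\<forall>\<^sub>F x in near P. trans L P x x * \<sigma> x = t P x ^ m P * u P x)" by (rule exE)
  then have u: "reg P (u P)" "u P P \<noteq> 0" "\<forall>\<^sub>F x in near P. trans L P x x * \<sigma> x = t P x ^ m P * u P x"
    if "P \<in> C" for P using that by blast+
  have one: "trans L P P P = 1" if "P \<in> C" for P using line_bundleD(2,4)[OF L that] by simp
  have at_point: "\<sigma> P = t P P ^ m P * u P P" if "P \<in> C" for P
    using near_self[OF that u(3)[OF that]] one[OF that] by simp
  have D_zero: "D x = 0" if "x \<in> C" "\<sigma> x \<noteq> 0" for x
    using at_point[OF that(1)] local_paramD(3)[OF lp[OF that(1)]] that Dm by (cases "m x") auto
  have isolated: "\<forall>\<^sub>F x in near P. x \<noteq> P \<longrightarrow> \<sigma> x \<noteq> 0" if P: "P \<in> C" for P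
    using u(3)[OF P] reg_inverse(2)[OF P u(1,2)[OF P]] local_paramD(4)[OF lp[OF P]]
  proof eventually_elim
    case (elim x)
    show ?case
    proof
      assume "x \<noteq> P"
      then have "t P x ^ m P * u P x \<noteq> 0" using elim(2,3) by simp
      then show "\<sigma> x \<noteq> 0" using elim(1) by auto
    qed
  qed
  have discrete: "\<forall>\<^sub>F x in near P. x \<noteq> P \<longrightarrow> D x = 0" if P: "P \<in> C" for P
    using isolated[OF P] eventually_in_C by eventually_elim (use D_zero in auto)
  show ?bundle using discrete by (rule is_line_bundle_of_div)
  show ?bundle' using discrete by (intro is_line_bundle_of_div) auto
  define \<epsilon> where "\<epsilon> x = u x x" for x
  have weight: "\<forall>\<^sub>F x in near P. trans (lb_of_div n C D) P x x * u P x = trans L P x x * \<epsilon> x" if P: "P \<in> C" for P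
    using u(3)[OF P] isolated[OF P] eventually_in_C
  proof eventually_elim
    case (elim x)
    show ?case
    proof (cases "x = P")
      case True
      then show ?thesis using one[OF P] by (simp add: lb_of_div_simps \<epsilon>_def)
    next
      case False
      then have "D x = 0" using elim D_zero by blast
      then have "m x = 0" using Dm[OF elim(3)] by simp
      then have "\<epsilon> x = \<sigma> x" using at_point[OF elim(3)] by (simp add: \<epsilon>_def)
      moreover have "trans (lb_of_div n C D) P x x = t P x ^ m P"
        using False \<open>D x = 0\<close> Dm[OF P] by (simp add: lb_of_div_simps t_def)
      ultimately show ?thesis using elim(1) by simp
    qed
  qed
  have "sec (lb_of_div n C D) P \<tau> \<longleftrightarrow> sec L P (\<lambda>x. \<epsilon> x * \<tau> x)" if P: "P \<in> C" for P \<tau>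
  proof
    assume "sec (lb_of_div n C D) P \<tau>"
    from reg_mult[OF u(1)[OF P] this] show "sec L P (\<lambda>x. \<epsilon> x * \<tau> x)"
    proof (rule reg_cong)
      show "\<forall>\<^sub>F x in near P. u P x * (trans (lb_of_div n C D) P x x * \<tau> x) = trans L P x x * (\<epsilon> x * \<tau> x)"
        using weight[OF P]
      proof eventually_elim
        case (elim x)
        show ?case unfolding mult.assoc[symmetric] elim[symmetric] by (simp only: mult_ac)
      qed
    qed
  next
    assume "sec L P (\<lambda>x. \<epsilon> x * \<tau> x)"
    from reg_divide[OF P this u(1,2)[OF P]] show "sec (lb_of_div n C D) P \<tau>"
    proof (rule reg_cong)
      show "\<forall>\<^sub>F x in near P. trans L P x x * (\<epsilon> x * \<tau> x) / u P x = trans (lb_of_div n C D) P x x * \<tau> x"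
        using weight[OF P] reg_inverse(2)[OF P u(1,2)[OF P]]
      proof eventually_elim
        case (elim x)
        have "trans L P x x * (\<epsilon> x * \<tau> x) = trans (lb_of_div n C D) P x x * \<tau> x * u P x"
          unfolding mult.assoc[symmetric] elim(1)[symmetric] by (simp only: mult_ac)
        then show ?case using elim(2) by (simp only: nonzero_mult_div_cancel_right not_False_eq_True)
      qed
    qed
  qed
  moreover have "\<forall>x\<in>C. \<epsilon> x \<noteq> 0" using u(2) by (simp add: \<epsilon>_def)
  ultimately show ?iso by blast
qed

proposition ex_pencil:
  assumes L: "is_line_bundle n C L" and gg: "globally_generated n C L" and h0: "h0 n C L = 2"
    and D: "D \<in> complete_linear_system n C L"
  obtains s t where "pencil (lb_of_div n C D) s t"
    "\<And>\<tau>. \<tau> \<in> H0 n C (lb_of_div n C D) \<Longrightarrow> \<exists>a b. \<tau> = (\<lambda>x. a * s x + b * t x)"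
    "is_line_bundle n C (lb_of_div n C (- D))"
proof -
  let ?A = "lb_of_div n C D"
  obtain \<sigma> where \<sigma>: "\<sigma> \<in> H0 n C L" "\<sigma> \<noteq> (\<lambda>_. 0)" "D = div_of_section n C L \<sigma>"
    using D unfolding complete_linear_system_def by auto
  note iso = lb_of_div_of_section[OF L \<sigma>]
  note A = iso(1)
  obtain \<epsilon> where \<epsilon>: "\<forall>x\<in>C. \<epsilon> x \<noteq> 0" "\<And>P \<tau>. P \<in> C \<Longrightarrow> sec ?A P \<tau> \<longleftrightarrow> sec L P (\<lambda>x. \<epsilon> x * \<tau> x)"
    using iso(3) by blast
  have dim: "qdim (H0 n C L) {\<lambda>_. 0} = enat 2" using h0 by (simp add: h0_def numeral_eq_enat)
  obtain B where B: "finite B" "card B = 2" "B \<subseteq> H0 n C L"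
    "\<And>f. f \<in> H0 n C L \<Longrightarrow> \<exists>c. (\<lambda>x. f x - (\<Sum>b\<in>B. c b * b x)) \<in> {\<lambda>_. 0}"
    by (rule qdim_basis[OF _ _ dim]) (simp, simp, rule that)
  then obtain s' t' where st: "B = {s', t'}" "s' \<noteq> t'" by (auto simp: card_2_iff)
  have span: "\<exists>a b. f = (\<lambda>x. a * s' x + b * t' x)" if f: "f \<in> H0 n C L" for f
  proof -
    obtain c where c: "(\<lambda>x. f x - (\<Sum>b\<in>B. c b * b x)) \<in> {\<lambda>_. 0}" using B(4)[OF f] by blast
    have "f x - (c s' * s' x + c t' * t' x) = 0" for x
      using c st by (auto simp: fun_eq_iff)
    then show ?thesis by (intro exI[of _ "c s'"] exI[of _ "c t'"]) (simp add: fun_eq_iff)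
  qed
  define s where "s x = (if x \<in> C then s' x / \<epsilon> x else 0)" for x
  define t where "t x = (if x \<in> C then t' x / \<epsilon> x else 0)" for x
  have H: "(\<lambda>x. if x \<in> C then f x / \<epsilon> x else 0) \<in> H0 n C ?A" if f: "f \<in> H0 n C L" for f
  proof -
    have "sec L P (\<lambda>x. \<epsilon> x * (if x \<in> C then f x / \<epsilon> x else 0))" if P: "P \<in> C" for P
      using H0_sec[OF L f P]
    proof (rule sec_cong)
      show "\<forall>\<^sub>F x in near P. f x = \<epsilon> x * (if x \<in> C then f x / \<epsilon> x else 0)"
        using eventually_in_C by eventually_elim (use \<epsilon>(1) in auto)
    qed
    then show ?thesis unfolding H0_iff[OF A] using \<epsilon>(2) by auto
  qed
  have "pencil ?A s t"
    unfolding pencil_def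
  proof (intro conjI ballI A)
    show "s \<in> H0 n C ?A" "t \<in> H0 n C ?A" unfolding s_def t_def using H B(3) st(1) by auto
    fix x assume x: "x \<in> C"
    then obtain f where f: "f \<in> H0 n C L" "f x \<noteq> 0" using gg unfolding globally_generated_def by blast
    obtain a b where "f = (\<lambda>x. a * s' x + b * t' x)" using span[OF f(1)] by blast
    then show "s x \<noteq> 0 \<or> t x \<noteq> 0" using f(2) x \<epsilon>(1) by (auto simp: s_def t_def)
  qed
  moreover have "\<exists>a b. \<tau> = (\<lambda>x. a * s x + b * t x)" if \<tau>: "\<tau> \<in> H0 n C ?A" for \<tau>
  proof -
    have "(\<lambda>x. \<epsilon> x * \<tau> x) \<in> H0 n C L"
      using \<tau> \<epsilon>(2) unfolding H0_iff[OF A] H0_iff[OF L] by auto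
    then obtain a b where ab: "(\<lambda>x. \<epsilon> x * \<tau> x) = (\<lambda>x. a * s' x + b * t' x)" using span by blast
    have "\<tau> x = a * s x + b * t x" for x
    proof (cases "x \<in> C")
      case True
      then show ?thesis using fun_cong[OF ab, of x] \<epsilon>(1) by (simp add: s_def t_def field_simps)
    next
      case False
      then show ?thesis using \<tau> H0_iff[OF A] by (simp add: s_def t_def)
    qed
    then show ?thesis by blast
  qed
  ultimately show ?thesis using that iso(2) by blast
qed

end

section \<open>Projective normality implies 2-normality\<close>

lemma form_linear:
  assumes "k \<le> m" shows "form m 1 (\<lambda>v. \<Sum>j\<le>k. a j * v j)"
  using assms
proof (induction k)
  case 0
  show ?case using form.mult[OF form.const[of m "a 0"] form.coord[of 0 m]] by simp
next
  case (Suc k)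
  have "form m 1 (\<lambda>v. a (Suc k) * v (Suc k))"
    using form.mult[OF form.const[of m "a (Suc k)"] form.coord[OF Suc.prems]] by simp
  then show ?case using form.add[OF Suc.IH] Suc.prems by simp
qed

lemma form_substitution:
  assumes "form m d F"
  shows "form r d (\<lambda>v. F (\<lambda>i. if i \<le> m then \<Sum>j\<le>r. a i j * v j else 0))"
  using assms
proof induction
  case (coord i)
  then show ?case using form_linear[of r r "a i"] by simp
qed (auto intro: form.intros)

definition section_vec :: "nat \<Rightarrow> (nat \<Rightarrow> 'k ppoint \<Rightarrow> 'k::field) \<Rightarrow> 'k ppoint \<Rightarrow> 'k vec" where
  "section_vec r s x = (\<lambda>i. if i \<le> r then s i x else 0)"

lemma phi_map_eq: "phi_map r s x = ppoint (section_vec r s x)"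
  by (simp add: phi_map_def section_vec_def)

lemma ppoint_scale: assumes "c \<noteq> 0" shows "ppoint (\<lambda>i. c * v i) = ppoint v"
proof -
  have "(\<lambda>i. b * (c * v i)) \<in> ppoint v" if "b \<noteq> 0" for b
    unfolding ppoint_def by (rule CollectI, rule exI[of _ "b * c"]) (use that assms in \<open>auto simp: mult.assoc\<close>)
  moreover have "(\<lambda>i. b * v i) \<in> ppoint (\<lambda>i. c * v i)" if "b \<noteq> 0" for b
    unfolding ppoint_def by (rule CollectI, rule exI[of _ "b / c"]) (use that assms in auto)
  ultimately show ?thesis unfolding ppoint_def[of v] ppoint_def[of "\<lambda>i. c * v i"] by auto
qed

lemma ppoint_in_proj_space:
  "i \<le> r \<Longrightarrow> s i x \<noteq> 0 \<Longrightarrow> ppoint (section_vec r s x) \<in> proj_space r"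
  unfolding proj_space_def
  by (rule CollectI, rule exI[of _ "section_vec r s x"]) (auto simp: section_vec_def fun_eq_iff)

lemma morphism_regular:
  "morphism n X m Y \<phi> \<Longrightarrow> zopen m Y V \<Longrightarrow> regular m V f \<Longrightarrow> regular n {x \<in> X. \<phi> x \<in> V} (f \<circ> \<phi>)"
  unfolding morphism_def by blast

context projective_set
begin

text \<open>
  A regular function on \<open>C\<close> is, through the inverse of the embedding, locally a quotient of forms on
  the image.  The neighbourhood is shrunk to the complement of a single hypersurface \<open>E = 0\<close>, a
  shape that is stable under linear substitution of the coordinates.
\<close>

lemma regular_via_embedding:
  assumes iso: "isomorphism n C r (phi_map r s ` C) (phi_map r s)" and base: "off_base_locus C r s = C"
    and x: "x \<in> C" and f: "reg x f"
  obtains d e E F G where "form r d F" "form r d G" "form r e E" "E (section_vec r s x) \<noteq> 0"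
    "\<And>y. y \<in> C \<Longrightarrow> E (section_vec r s y) \<noteq> 0 \<Longrightarrow>
      G (section_vec r s y) \<noteq> 0 \<and> f y = F (section_vec r s y) / G (section_vec r s y)"
proof -
  let ?X = "phi_map r s ` C" and ?\<phi> = "phi_map r s"
  obtain \<psi> where \<psi>: "morphism r ?X n C \<psi>" "\<forall>x\<in>C. \<psi> (?\<phi> x) = x" using iso unfolding isomorphism_def by blast
  have phi: "?\<phi> y \<in> proj_space r" "section_vec r s y \<in> ?\<phi> y" if "y \<in> C" for y
    using that base ppoint_in_proj_space[of _ r s y] ppoint_self
    unfolding off_base_locus_def phi_map_eq by auto
  obtain U where U: "zopen n C U" "x \<in> U" "\<forall>Q\<in>U. reg Q f"
    using eventually_reg[OF x f] unfolding eventually_near[OF x] by blast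
  define V where "V = {y \<in> ?X. \<psi> y \<in> U}"
  have "regular n U f" using U regular_iff[OF U(1)] by blast
  from morphism_regular[OF \<psi>(1) U(1) this] have regV: "regular r V (f \<circ> \<psi>)" unfolding V_def .
  have xV: "?\<phi> x \<in> V" using x U(2) \<psi>(2) by (simp add: V_def)
  then have "\<exists>W d F G. openin (zariski r) W \<and> ?\<phi> x \<in> W \<and> form r d F \<and> form r d G \<and>
     (\<forall>Q\<in>W \<inter> V. \<forall>v\<in>Q. G v \<noteq> 0 \<and> (f \<circ> \<psi>) Q = F v / G v)"
    using regV unfolding regular_def by (rule bspec[rotated])
  then obtain W d F G where W: "openin (zariski r) W" "?\<phi> x \<in> W" "form r d F" "form r d G"
     "\<forall>Q\<in>W \<inter> V. \<forall>v\<in>Q. G v \<noteq> 0 \<and> (f \<circ> \<psi>) Q = F v / G v" by (elim exE conjE) (rule that)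
  have "continuous_map (subtopology (zariski r) ?X) (subtopology (zariski n) C) \<psi>"
    using \<psi>(1) unfolding morphism_def by blast
  from openin_continuous_map_preimage[OF this U(1)]
  have "zopen r ?X {y \<in> topspace (subtopology (zariski r) ?X). \<psi> y \<in> U}" .
  moreover have top: "topspace (subtopology (zariski r) ?X) = ?X"
    using phi(1) by (auto simp: topspace_zariski)
  ultimately have "zopen r ?X V" unfolding V_def top by blast
  then obtain W' where W': "openin (zariski r) W'" "V = W' \<inter> ?X" unfolding openin_subtopology by blast
  have "openin (zariski r) (W \<inter> W')" using W(1) W'(1) by blast
  then obtain S where S: "S \<subseteq> {F. \<exists>d. form r d F}" "W \<inter> W' = nonvanishing_locus r S"
    unfolding openin_zariski_iff by (elim exE conjE) (rule that)
  have "?\<phi> x \<in> nonvanishing_locus r S" using S(2) W(2) xV W'(2) by blast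
  then obtain E v where E: "E \<in> S" "v \<in> ?\<phi> x" "E v \<noteq> 0" unfolding nonvanishing_locus_def by blast
  obtain e where e: "form r e E" using S(1) E(1) by blast
  show ?thesis
  proof
    show "form r d F" "form r d G" "form r e E" by fact+
    show "E (section_vec r s x) \<noteq> 0"
      using form_nonzero_on_ppoint[OF e phi(1)[OF x] E(2) phi(2)[OF x] E(3)] .
    fix y assume y: "y \<in> C" "E (section_vec r s y) \<noteq> 0"
    have "?\<phi> y \<in> nonvanishing_locus r S"
      unfolding nonvanishing_locus_def using phi[OF y(1)] E(1) y(2) by blast
    then have "?\<phi> y \<in> W \<inter> V" using S(2) W'(2) y(1) by blast
    from bspec[OF bspec[OF W(5) this] phi(2)[OF y(1)]]
    show "G (section_vec r s y) \<noteq> 0 \<and> f y = F (section_vec r s y) / G (section_vec r s y)"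
      using \<psi>(2) y(1) by simp
  qed
qed

text \<open>
  Very ampleness provides an embedding by one basis, and projective normality concerns another.  The
  consequences of being an embedding are transported along the linear map between the
  two coordinate systems.
\<close>

lemma very_ample_in_basis:
  assumes va: "very_ample n C L" and basis: "section_basis n C L r s"
  shows "x \<in> C \<Longrightarrow> \<exists>i\<le>r. s i x \<noteq> 0"
    and "x \<in> C \<Longrightarrow> y \<in> C \<Longrightarrow> c \<noteq> 0 \<Longrightarrow> section_vec r s y = (\<lambda>i. c * section_vec r s x i) \<Longrightarrow> y = x"
    and "x \<in> C \<Longrightarrow> reg x f \<Longrightarrow> \<exists>d e E F G. form r d F \<and> form r d G \<and> form r e E \<and> E (section_vec r s x) \<noteq> 0 \<and>
      (\<forall>y\<in>C. E (section_vec r s y) \<noteq> 0 \<longrightarrow>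
        G (section_vec r s y) \<noteq> 0 \<and> f y = F (section_vec r s y) / G (section_vec r s y))"
proof -
  obtain r' s' where va': "section_basis n C L r' s'" "off_base_locus C r' s' = C"
    "isomorphism n C r' (phi_map r' s' ` C) (phi_map r' s')"
    using va unfolding very_ample_def by blast
  have "\<forall>i\<in>{..r'}. \<exists>a. s' i = (\<lambda>x. \<Sum>j\<le>r. a j * s j x)"
  proof
    fix i assume "i \<in> {..r'}"
    then have "s' i \<in> H0 n C L" using va'(1) unfolding section_basis_def by blast
    then have "\<exists>!c. (\<forall>i>r. c i = 0) \<and> s' i = (\<lambda>x. \<Sum>i\<le>r. c i * s i x)"
      using basis unfolding section_basis_def by blast
    then show "\<exists>a. s' i = (\<lambda>x. \<Sum>j\<le>r. a j * s j x)" by blast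
  qed
  from bchoice[OF this] obtain a where a: "\<forall>i\<in>{..r'}. s' i = (\<lambda>x. \<Sum>j\<le>r. a i j * s j x)" by (rule exE)
  define lin where "lin v = (\<lambda>i. if i \<le> r' then \<Sum>j\<le>r. a i j * v j else 0)" for v :: "'k vec"
  have lin: "section_vec r' s' x = lin (section_vec r s x)" for x
    using a by (auto simp: section_vec_def lin_def)
  have lin_scale: "lin (\<lambda>i. c * v i) = (\<lambda>i. c * lin v i)" for c v
    by (auto simp: lin_def sum_distrib_left mult_ac)
  show "\<exists>i\<le>r. s i x \<noteq> 0" if "x \<in> C" for x
  proof (rule ccontr)
    assume "\<not> ?thesis"
    then have "s' i x = 0" if "i \<le> r'" for i using a that by simp
    then show False using va'(2) \<open>x \<in> C\<close> unfolding off_base_locus_def by blast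
  qed
  show "y = x" if "x \<in> C" "y \<in> C" "c \<noteq> 0" "section_vec r s y = (\<lambda>i. c * section_vec r s x i)" for x y c
  proof -
    have "section_vec r' s' y = (\<lambda>i. c * section_vec r' s' x i)" unfolding lin that(4) lin_scale ..
    then have "phi_map r' s' y = phi_map r' s' x" unfolding phi_map_eq using ppoint_scale[OF that(3)] by simp
    then show "y = x" using va'(3) that(1,2) unfolding isomorphism_def by metis
  qed
  show "\<exists>d e E F G. form r d F \<and> form r d G \<and> form r e E \<and> E (section_vec r s x) \<noteq> 0 \<and>
      (\<forall>y\<in>C. E (section_vec r s y) \<noteq> 0 \<longrightarrow>
        G (section_vec r s y) \<noteq> 0 \<and> f y = F (section_vec r s y) / G (section_vec r s y))"
    if "x \<in> C" "reg x f" for x f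
  proof -
    obtain d e E F G where *: "form r' d F" "form r' d G" "form r' e E" "E (section_vec r' s' x) \<noteq> 0"
      "\<And>y. y \<in> C \<Longrightarrow> E (section_vec r' s' y) \<noteq> 0 \<Longrightarrow>
        G (section_vec r' s' y) \<noteq> 0 \<and> f y = F (section_vec r' s' y) / G (section_vec r' s' y)"
      by (rule regular_via_embedding[OF va'(3,2) \<open>x \<in> C\<close> \<open>reg x f\<close>]) (rule that)
    have sub: "form r k (\<lambda>v. H (lin v))" if "form r' k H" for k H
      unfolding lin_def by (rule form_substitution[OF that])
    show ?thesis
    proof (intro exI conjI ballI impI)
      show "form r d (\<lambda>v. F (lin v))" "form r d (\<lambda>v. G (lin v))" "form r e (\<lambda>v. E (lin v))"
        using sub * by blast+
      show "E (lin (section_vec r s x)) \<noteq> 0" using *(4) unfolding lin .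
      fix y assume "y \<in> C" "E (lin (section_vec r s y)) \<noteq> 0"
      then show "G (lin (section_vec r s y)) \<noteq> 0"
        "f y = F (lin (section_vec r s y)) / G (lin (section_vec r s y))"
        using *(5)[of y] unfolding lin by blast+
    qed
  qed
qed

definition product_sums :: "'k line_bundle \<Rightarrow> ('k ppoint \<Rightarrow> 'k) set" where
  "product_sums L = {\<sigma>. \<exists>(m::nat) a b. (\<forall>i<m. a i \<in> H0 n C L \<and> b i \<in> H0 n C L) \<and>
     \<sigma> = (\<lambda>x. \<Sum>i<m. a i x * b i x)}"

lemma product_sums_add_product:
  assumes "\<sigma> \<in> product_sums L" "u \<in> H0 n C L" "v \<in> H0 n C L"
  shows "(\<lambda>x. \<sigma> x + u x * v x) \<in> product_sums L"
proof -
  obtain m :: nat and a b where *: "\<forall>i<m. a i \<in> H0 n C L \<and> b i \<in> H0 n C L" "\<sigma> = (\<lambda>x. \<Sum>i<m. a i x * b i x)"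
    using assms(1) unfolding product_sums_def mem_Collect_eq by (elim exE conjE) (rule that)
  have "\<forall>i<Suc m. (a(m := u)) i \<in> H0 n C L \<and> (b(m := v)) i \<in> H0 n C L"
    using * assms(2,3) by (auto simp: less_Suc_eq)
  moreover have "(\<lambda>x. \<sigma> x + u x * v x) = (\<lambda>x. \<Sum>i<Suc m. (a(m := u)) i x * (b(m := v)) i x)"
    using *(2) by auto
  ultimately show ?thesis unfolding product_sums_def mem_Collect_eq
    by (intro exI[of _ "Suc m"] exI[of _ "a(m := u)"] exI[of _ "b(m := v)"] conjI)
qed

lemma product_sums_add:
  assumes "\<sigma> \<in> product_sums L" "\<tau> \<in> product_sums L"
  shows "(\<lambda>x. \<sigma> x + \<tau> x) \<in> product_sums L"
proof -
  obtain m :: nat and a b where *: "\<forall>i<m. a i \<in> H0 n C L \<and> b i \<in> H0 n C L" "\<tau> = (\<lambda>x. \<Sum>i<m. a i x * b i x)"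
    using assms(2) unfolding product_sums_def mem_Collect_eq by (elim exE conjE) (rule that)
  have "(\<lambda>x. \<sigma> x + (\<Sum>i<k. a i x * b i x)) \<in> product_sums L" if "k \<le> m" for k
    using that
  proof (induction k)
    case (Suc k)
    then have "(\<lambda>x. (\<sigma> x + (\<Sum>i<k. a i x * b i x)) + a k x * b k x) \<in> product_sums L"
      using * by (intro product_sums_add_product) auto
    then show ?case by (simp add: add.assoc)
  qed (simp add: assms(1))
  then show ?thesis using *(2) by blast
qed

lemma product_sums_scale:
  assumes L: "is_line_bundle n C L" and "\<sigma> \<in> product_sums L"
  shows "(\<lambda>x. c * \<sigma> x) \<in> product_sums L"
proof -
  obtain m :: nat and a b where *: "\<forall>i<m. a i \<in> H0 n C L \<and> b i \<in> H0 n C L" "\<sigma> = (\<lambda>x. \<Sum>i<m. a i x * b i x)"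
    using assms(2) unfolding product_sums_def mem_Collect_eq by (elim exE conjE) (rule that)
  have "\<forall>i<m. (\<lambda>x. c * a i x) \<in> H0 n C L \<and> b i \<in> H0 n C L"
    using * H0_scale[OF L] by blast
  moreover have "(\<lambda>x. c * \<sigma> x) = (\<lambda>x. \<Sum>i<m. (c * a i x) * b i x)"
    using *(2) by (auto simp: sum_distrib_left mult.assoc)
  ultimately show ?thesis unfolding product_sums_def mem_Collect_eq
    by (intro exI[of _ m] exI[of _ "\<lambda>i x. c * a i x"] exI[of _ b] conjI)
qed

text \<open>
  A quadratic form is built from forms of degree 0, 1 and 2, so the induction has to cover all three.
\<close>

lemma quadric_product_sums:
  assumes L: "is_line_bundle n C L" and s: "\<And>i. i \<le> r \<Longrightarrow> s i \<in> H0 n C L" and F: "form r d F"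
  shows "(d = 0 \<longrightarrow> (\<exists>c. \<forall>v. F v = c)) \<and> (d = 1 \<longrightarrow> (\<lambda>x. F (section_vec r s x)) \<in> H0 n C L) \<and>
    (d = 2 \<longrightarrow> (\<lambda>x. F (section_vec r s x)) \<in> product_sums L)"
  using F
proof induction
  case (coord i)
  then show ?case using s by (simp add: section_vec_def)
next
  case (add d F G)
  show ?case
  proof (intro conjI impI)
    assume "d = 0"
    then obtain a b where "\<forall>v. F v = a" "\<forall>v. G v = b" using add.IH by blast
    then show "\<exists>c. \<forall>v. F v + G v = c" by simp
  next
    assume "d = 1"
    then show "(\<lambda>x. F (section_vec r s x) + G (section_vec r s x)) \<in> H0 n C L"
      using add.IH by (intro H0_add[OF L]) blast+
  next
    assume "d = 2"
    then show "(\<lambda>x. F (section_vec r s x) + G (section_vec r s x)) \<in> product_sums L"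
      using add.IH by (intro product_sums_add) blast+
  qed
next
  case (mult d F e G)
  show ?case
  proof (intro conjI impI)
    assume "d + e = 0"
    then obtain a b where "\<forall>v. F v = a" "\<forall>v. G v = b" using mult.IH by auto
    then show "\<exists>c. \<forall>v. F v * G v = c" by simp
  next
    assume "d + e = 1"
    then consider "d = 0" "e = 1" | "d = 1" "e = 0" by linarith
    then show "(\<lambda>x. F (section_vec r s x) * G (section_vec r s x)) \<in> H0 n C L"
    proof cases
      case 1
      then obtain c where "\<forall>v. F v = c" using mult.IH by blast
      then show ?thesis using mult.IH 1 H0_scale[OF L] by simp
    next
      case 2
      then obtain c where "\<forall>v. G v = c" using mult.IH by blast
      then show ?thesis using mult.IH 2 H0_scale[OF L, of _ c] by (simp add: mult.commute)
    qed
  next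
    assume "d + e = 2"
    then consider "d = 0" "e = 2" | "d = 1" "e = 1" | "d = 2" "e = 0" by linarith
    then show "(\<lambda>x. F (section_vec r s x) * G (section_vec r s x)) \<in> product_sums L"
    proof cases
      case 1
      then obtain c where "\<forall>v. F v = c" using mult.IH by blast
      then show ?thesis using mult.IH 1 product_sums_scale[OF L] by simp
    next
      case 2
      have "(\<lambda>_. 0) \<in> product_sums L" unfolding product_sums_def by (intro CollectI exI[of _ 0]) simp
      from product_sums_add_product[OF this] show ?thesis using mult.IH 2 by fastforce
    next
      case 3
      then obtain c where "\<forall>v. G v = c" using mult.IH by blast
      then show ?thesis using mult.IH 3 product_sums_scale[OF L, of _ c] by (simp add: mult.commute)
    qed
  qed
qed auto

text \<open>
  A section \<open>\<sigma>\<close> of $L^2$ defines the function \<open>t\<close> on the cone over the image that is homogeneous of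
  degree 2 and has the value \<open>\<sigma> x\<close> at the vector of basis sections at \<open>x\<close>.  Locally
  $t = s_i^2 \cdot (\sigma / s_i^2)$, where the second factor is a regular function on \<open>C\<close>, hence a
  quotient of forms.  So \<open>t\<close> is a section of $O(2)$ and agrees with a quadratic form.
\<close>

proposition normally_generated_imp_two_normal:
  assumes L: "is_line_bundle n C L" and ng: "normally_generated n C L"
  shows "two_normal n C L"
  unfolding two_normal_def
proof
  fix \<sigma> assume "\<sigma> \<in> H0 n C (lb_power C L 2)"
  note L2 = is_line_bundle_power_2[OF L]
  note \<sigma> = \<open>\<sigma> \<in> H0 n C (lb_power C L 2)\<close>
  obtain r s where basis: "section_basis n C L r s" and pn: "projectively_normal r (phi_map r s ` C)"
    and va: "very_ample n C L"
    using ng unfolding normally_generated_def by blast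
  note base = very_ample_in_basis(1)[OF va basis] and inj = very_ample_in_basis(2)[OF va basis]
    and local_form = very_ample_in_basis(3)[OF va basis]
  have s: "s i \<in> H0 n C L" if "i \<le> r" for i using basis that unfolding section_basis_def by blast
  let ?v = "section_vec r s"
  have v_nz: "\<exists>i. ?v x i \<noteq> 0" if "x \<in> C" for x using base[OF that] by (auto simp: section_vec_def)
  define t where "t w = (let (x, c) = (SOME (x, c). x \<in> C \<and> c \<noteq> 0 \<and> w = (\<lambda>i. c * ?v x i)) in c\<^sup>2 * \<sigma> x)" for w
  have t: "t (\<lambda>i. c * ?v x i) = c\<^sup>2 * \<sigma> x" if x: "x \<in> C" and c: "c \<noteq> 0" for x c
  proof -
    let ?P = "\<lambda>(x', c'). x' \<in> C \<and> c' \<noteq> 0 \<and> (\<lambda>i. c * ?v x i) = (\<lambda>i. c' * ?v x' i)"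
    obtain x' c' where xc: "(SOME p. ?P p) = (x', c')" by (cases "SOME p. ?P p")
    have "?P (SOME p. ?P p)" by (rule someI[of ?P "(x, c)"]) (use x c in simp)
    then have P: "x' \<in> C" "c' \<noteq> 0" "(\<lambda>i. c * ?v x i) = (\<lambda>i. c' * ?v x' i)" unfolding xc by auto
    have "?v x' i = (c / c') * ?v x i" for i using fun_cong[OF P(3), of i] P(2) by (simp add: field_simps)
    then have eq: "x' = x" using inj[OF x P(1), of "c / c'"] c P(2) by auto
    obtain i where "?v x i \<noteq> 0" using v_nz[OF x] by blast
    then have "c' = c" using fun_cong[OF P(3), of i] eq by simp
    then show ?thesis unfolding t_def xc using eq by simp
  qed
  have in_ppoint: "\<exists>c. c \<noteq> 0 \<and> w = (\<lambda>i. c * ?v x i)" if "w \<in> phi_map r s x" for w x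
    using that unfolding phi_map_eq ppoint_def by blast
  have proj: "phi_map r s x \<in> proj_space r" if "x \<in> C" for x
    using base[OF that] ppoint_in_proj_space unfolding phi_map_eq by blast
  \<comment> \<open>Injectivity of the embedding has made \<open>t\<close> well defined; it remains to write it as a local quotient of forms.\<close>
  have "t \<in> twisting_sections r (phi_map r s ` C) 2"
    unfolding twisting_sections_def mem_Collect_eq
  proof
    fix P assume "P \<in> phi_map r s ` C"
    then obtain x where x: "x \<in> C" "P = phi_map r s x" by blast
    obtain i where i: "i \<le> r" "s i x \<noteq> 0" using base[OF x(1)] by blast
    define f where "f y = \<sigma> y / (s i y)\<^sup>2" for y
    have "reg x f"
    proof (rule reg_cong)
      have "(trans L x x x * s i x)\<^sup>2 \<noteq> 0" using line_bundleD(2,4)[OF L x(1)] i(2) x(1) by simp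
      then show "reg x (\<lambda>y. trans (lb_power C L 2) x y y * \<sigma> y / (trans L x y y * s i y)\<^sup>2)"
        using H0_sec[OF L2 \<sigma> x(1)] H0_sec[OF L s[OF i(1)] x(1)] by (intro reg_divide[OF x(1)] reg_power)
      show "\<forall>\<^sub>F y in near x. trans (lb_power C L 2) x y y * \<sigma> y / (trans L x y y * s i y)\<^sup>2 = f y"
        using eventually_weight_nonzero[OF L x(1)]
        by eventually_elim (simp add: f_def weight_simps power2_eq_square)
    qed
    from local_form[OF x(1) this] obtain d e E F G where E: "form r d F" "form r d G" "form r e E" "E (?v x) \<noteq> 0"
      "\<forall>y\<in>C. E (?v y) \<noteq> 0 \<longrightarrow> G (?v y) \<noteq> 0 \<and> f y = F (?v y) / G (?v y)"
      by (elim exE conjE) (rule that)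
    have Ei: "form r (e + 1) (\<lambda>w. E w * w i)" by (rule form.mult[OF E(3) form.coord[OF i(1)]])
    let ?W = "{Q \<in> proj_space r. \<exists>w\<in>Q. E w * w i \<noteq> 0}"
    show "\<exists>W e F G. openin (zariski r) W \<and> P \<in> W \<and> form r (e + 2) F \<and> form r e G \<and>
        (\<forall>Q\<in>W \<inter> phi_map r s ` C. \<forall>v\<in>Q. G v \<noteq> 0 \<and> t v = F v / G v)"
    proof (intro exI conjI)
      show "openin (zariski r) ?W" by (rule openin_nonvanishing[OF Ei])
      have "E (?v x) * ?v x i \<noteq> 0" using E(4) i by (simp add: section_vec_def)
      then show "P \<in> ?W" using proj[OF x(1)] ppoint_self[of "?v x"] unfolding x(2) phi_map_eq by blast
      show "form r (d + 2) (\<lambda>w. F w * (w i * w i))"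
        using form.mult[OF E(1) form.mult[OF form.coord[OF i(1)] form.coord[OF i(1)]]] by simp
      show "form r d G" by fact
      show "\<forall>Q\<in>?W \<inter> phi_map r s ` C. \<forall>v\<in>Q. G v \<noteq> 0 \<and> t v = F v * (v i * v i) / G v"
      proof (intro ballI)
        fix Q w assume Q: "Q \<in> ?W \<inter> phi_map r s ` C" and w: "w \<in> Q"
        then obtain y where y: "y \<in> C" "Q = phi_map r s y" by blast
        obtain c where c: "c \<noteq> 0" "w = (\<lambda>i. c * ?v y i)" using in_ppoint w y(2) by blast
        have vy: "?v y \<in> Q" unfolding y(2) phi_map_eq by (rule ppoint_self)
        obtain w' where "w' \<in> Q" "E w' * w' i \<noteq> 0" using Q by blast
        from form_nonzero_on_ppoint[OF Ei _ this(1) vy this(2)] Q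
        have nz: "E (?v y) \<noteq> 0" "?v y i \<noteq> 0" by auto
        then have fy: "G (?v y) \<noteq> 0" "f y = F (?v y) / G (?v y)" using E(5) y(1) by blast+
        have "s i y \<noteq> 0" using nz(2) i(1) by (simp add: section_vec_def)
        then have "\<sigma> y = f y * (?v y i * ?v y i)" using i(1) by (simp add: f_def section_vec_def power2_eq_square)
        moreover have "t w = c\<^sup>2 * \<sigma> y" unfolding c(2) by (rule t[OF y(1) c(1)])
        moreover have "F w = c ^ d * F (?v y)" "G w = c ^ d * G (?v y)"
          unfolding c(2) by (rule form_homogeneous[OF E(1)], rule form_homogeneous[OF E(2)])
        moreover have "w i = c * ?v y i" by (simp add: c(2))
        ultimately show "G w \<noteq> 0 \<and> t w = F w * (w i * w i) / G w"
          using c(1) fy by (simp add: power2_eq_square)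
      qed
    qed
  qed
  then obtain F where F: "form r 2 F" "\<forall>P\<in>phi_map r s ` C. \<forall>v\<in>P. F v = t v"
    using pn unfolding projectively_normal_def by blast
  have F\<sigma>: "\<sigma> x = F (?v x)" if "x \<in> C" for x
  proof -
    have "?v x \<in> phi_map r s x" unfolding phi_map_eq by (rule ppoint_self)
    then have "F (?v x) = t (?v x)" using F(2) that by blast
    then show ?thesis using t[OF that, of 1] by simp
  qed
  have "(\<lambda>x. F (?v x)) \<in> product_sums L" using quadric_product_sums[OF L s F(1)] by simp
  then obtain m :: nat and a b where ab: "\<forall>i<m. a i \<in> H0 n C L \<and> b i \<in> H0 n C L"
    "(\<lambda>x. F (?v x)) = (\<lambda>x. \<Sum>i<m. a i x * b i x)"
    unfolding product_sums_def mem_Collect_eq by (elim exE conjE) (rule that)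
  have "\<sigma> x = (\<Sum>i<m. a i x * b i x)" for x
  proof (cases "x \<in> C")
    case True
    then show ?thesis using F\<sigma> fun_cong[OF ab(2), of x] by simp
  next
    case False
    then have "a i x = 0" if "i < m" for i using ab(1) that H0_iff[OF L, of "a i"] by blast
    moreover have "\<sigma> x = 0" using False \<sigma> H0_iff[OF L2] by blast
    ultimately show ?thesis by simp
  qed
  then show "\<exists>(m::nat) a b. (\<forall>i<m. a i \<in> H0 n C L \<and> b i \<in> H0 n C L) \<and> \<sigma> = (\<lambda>x. \<Sum>i<m. a i x * b i x)"
    using ab(1) by (intro exI[of _ m] exI[of _ a] exI[of _ b] conjI ext)
qed

end


section \<open>Failure of 2-normality\<close>

theorem theorem1p2:
  fixes n :: nat
    and C :: "'k::{alg_closed_field, field_char_0} ppoint set"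
    and \<M> \<F> :: "'k line_bundle"
    and F :: "'k ppoint \<Rightarrow> int"
  assumes "smooth_curve n C"
    and "is_line_bundle n C \<M>" and "birationally_very_ample n C \<M>"
    and "is_line_bundle n C \<F>" and "globally_generated n C \<F>" and "h0 n C \<F> = 2"
    and "F \<in> complete_linear_system n C \<F>"
    and "h1 n C (lb_twist n C (lb_power C \<M> 2) F) = 0"
    and "h1 n C (lb_power C \<M> 2) + 1 \<le> h1 n C (lb_twist n C (lb_power C \<M> 2) (- F))"
    and "mult_map_surj n C \<M> (lb_of_div n C F)"
  shows "\<not> normally_generated n C (lb_twist n C \<M> F) \<and>
         \<not> two_normal n C (lb_twist n C \<M> F)"
proof -
  interpret smooth_projective_curve n C by (rule smooth_projective_curve[OF assms(1)])
  let ?A = "lb_of_div n C F" and ?A' = "lb_of_div n C (- F)" and ?N = "lb_power C \<M> 2"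
  obtain s t where pen: "pencil ?A s t"
    and span: "\<And>\<tau>. \<tau> \<in> H0 n C ?A \<Longrightarrow> \<exists>a b. \<tau> = (\<lambda>x. a * s x + b * t x)"
    and A': "is_line_bundle n C ?A'"
    using ex_pencil[OF assms(4-7)] by blast
  have A: "is_line_bundle n C ?A" using pen unfolding pencil_def by blast
  note N = is_line_bundle_power_2[OF assms(2)]
  have H1: "cech_Z1 n C (lb_tensor ?N ?A) \<subseteq> cech_B1 n C (lb_tensor ?N ?A)"
    using assms(8) h1_eq_0_iff[OF is_line_bundle_tensor[OF N A]] unfolding lb_twist_def by blast
  have not_two: "\<not> two_normal n C (lb_twist n C \<M> F)"
  proof
    assume "two_normal n C (lb_twist n C \<M> F)"
    then have "two_normal n C (lb_tensor \<M> ?A)" by (simp add: lb_twist_def)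
    from two_normal_imp_H1_zero[OF assms(2) pen span A' weight_lb_of_div_minus H1 assms(10) this]
    have "h1 n C (lb_twist n C ?N (- F)) = 0"
      unfolding lb_twist_def h1_eq_0_iff[OF is_line_bundle_tensor[OF N A']] .
    then show False using assms(9) by simp
  qed
  moreover have "is_line_bundle n C (lb_twist n C \<M> F)"
    unfolding lb_twist_def by (rule is_line_bundle_tensor[OF assms(2) A])
  ultimately show ?thesis using normally_generated_imp_two_normal by blast
qed

end
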